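(* Let $H_1,\dots,H_N:\mathbb{R}\to\mathbb{R}$ be continuous, quasi-convex and coercive, let $F:\mathbb{R}^N\to\mathbb{R}$ be continuous and non-increasing with respect to each of its variables, and let $u_0:J\to\mathbb{R}$ be uniformly continuous. Then there exists a unique continuous relaxed viscosity solution $u:[0,+\infty)\times J\to\mathbb{R}$ of $$u_t+H_i(u_x)=0 \ \text{ for } t>0,\ x\in J_i^*\ (i=1,\dots,N),\qquad u_t+F(u_x)=0\ \text{ for } t>0,\ x=0,$$ with $u(0,x)=u_0(x)$ for $x\in J$, such that for every $T>0$ there exists a constant $C_T>0$ with $$|u(t,x)-u_0(x)|\le C_T\qquad\text{for all }(t,x)\in[0,T)\times J.$$
   Context: Junction: $N\ge 1$; $J=\bigcup_{i=1}^N J_i$, where each branch $J_i$ is isometric to $[0,+\infty)$ and $J_i\cap J_j=\{0\}$ for $i\ne j$; $J_i^*=J_i\setminus\{0\}$. $J$ carries the geodesic distance $d(x,y)=|x-y|$ if $x,y$ are on the same branch and $|x|+|y|$ otherwise. $J_T=(0,T)\times J$. $\partial_i u(x)$ is the derivative at $x\in J_i$; $u_x(x)=\partial_i u(x)$ if $x\in J_i^*$ and $u_x(0)=(\partial_1u(0),\dots,\partial_Nu(0))$. $H_i$ is quasi-convex if its sub-level sets $\{H_i\le\lambda\}$ are convex; coercive means $H_i(p)\to+\infty$ as $|p|\to+\infty$. Test functions: $C^1(J_T)$ is the set of $\varphi\in C(J_T)$ whose restriction to $(0,T)\times J_i$ is $C^1$ for every $i$. $\varphi$ touches $u$ from above (resp.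 below) at a point if $u-\varphi$ has a local maximum (resp. minimum) there. $u^*,u_*$ denote upper and lower semi-continuous envelopes. Relaxed sub-solution (resp. super-solution) on $(0,T)\times J$: for every $\varphi\in C^1(J_T)$ touching $u^*$ from above (resp. $u_*$ from below) at $(t_0,x_0)\in J_T$: if $x_0\in J_i^*$, $\varphi_t+H_i(\varphi_x)\le0$ (resp. $\ge0$) at $(t_0,x_0)$; if $x_0=0$, either $\varphi_t+F(\varphi_x)\le0$ (resp. $\ge0$) or $\varphi_t+H_i(\partial_i\varphi)\le0$ (resp. $\ge0$) for some $i$, at $(t_0,0)$. It satisfies the initial condition if $u^*(0,x)\le u_0(x)$ (resp. $u_*(0,x)\ge u_0(x)$) for all $x\in J$. A relaxed solution is both a relaxed sub-solution and a relaxed super-solution; a relaxed solution on $[0,+\infty)\times J$ is one on $[0,T)\times J$ for every $T>0$. *)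

theory Defs
  imports "HOL-Analysis.Analysis"
begin

section \<open>The junction\<close>

text \<open>
  The junction with \<open>N = CARD('n)\<close> branches: its points are the points of the nonnegative coordinate
  half-axes of \<open>real^'n\<close>, which meet only in \<open>0\<close>.  It is not given the Euclidean metric of the
  ambient space but the geodesic one.
\<close>

typedef ('n::finite) junction = "{axis i r | (i::'n) (r::real). 0 \<le> r}"
  by blast

definition origin :: "('n::finite) junction" where
  "origin = Abs_junction 0"

text \<open>The arc-length parametrisation of the \<open>i\<close>-th branch, meaningful for \<open>r \<ge> 0\<close> only.\<close>

definition branch_pt :: "'n::finite \<Rightarrow> real \<Rightarrow> 'n junction" where
  "branch_pt i r = Abs_junction (axis i r)"

definition branch :: "'n::finite \<Rightarrow> 'n junction set" where
  "branch i = branch_pt i ` {0..}"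

definition radius :: "('n::finite) junction \<Rightarrow> real" where
  "radius x = norm (Rep_junction x)"

lemma Rep_branch_pt: "0 \<le> r \<Longrightarrow> Rep_junction (branch_pt i r) = axis i r"
  unfolding branch_pt_def by (rule Abs_junction_inverse) blast

lemma branch_pt_0: "branch_pt i 0 = origin"
  by (simp add: branch_pt_def origin_def axis_eq_0_iff[THEN iffD2])

lemma radius_branch_pt: "0 \<le> r \<Longrightarrow> radius (branch_pt i r) = r"
  by (simp add: radius_def Rep_branch_pt norm_eq_sqrt_inner inner_axis_axis)

lemma junction_cases: obtains i r where "0 \<le> r" "x = branch_pt i r"
  unfolding branch_pt_def using Rep_junction[of x] Rep_junction_inverse[of x] by fastforce

lemma branch_pt_eq_iff:
  assumes "0 \<le> r" "0 \<le> s"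
  shows "branch_pt i r = branch_pt j s \<longleftrightarrow> r = s \<and> (i = j \<or> r = 0)"
  by (metis Rep_branch_pt assms axis_eq_0_iff axis_eq_axis branch_pt_0)

lemma branch_Un: "(\<Union>i. branch i) = (UNIV :: ('n::finite) junction set)"
proof -
  have "x \<in> (\<Union>i. branch i)" for x :: "'n junction"
    by (cases x rule: junction_cases) (auto simp: branch_def)
  then show ?thesis by blast
qed

lemma branch_pt_in_branch_iff:
  assumes "0 \<le> r"
  shows "branch_pt i r \<in> branch j \<longleftrightarrow> i = j \<or> r = 0"
  using assms by (auto simp: branch_def image_iff Bex_def branch_pt_eq_iff)

lemma branch_Int: "i \<noteq> j \<Longrightarrow> branch i \<inter> branch j = {origin}"
  by (auto simp: branch_pt_in_branch_iff branch_def branch_pt_eq_iff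
      simp flip: branch_pt_0[of i] branch_pt_0[of j])
     (metis atLeast_iff branch_pt_0 image_eqI order_refl)+

instantiation junction :: (finite) metric_space
begin

definition dist_junction :: "'a junction \<Rightarrow> 'a junction \<Rightarrow> real" where
  "dist_junction x y =
     (if \<exists>i. x \<in> branch i \<and> y \<in> branch i then \<bar>radius x - radius y\<bar> else radius x + radius y)"

definition uniformity_junction :: "('a junction \<times> 'a junction) filter" where
  "uniformity_junction = (INF e\<in>{0<..}. principal {(x, y). dist x y < e})"

definition open_junction :: "'a junction set \<Rightarrow> bool" where
  "open_junction U = (\<forall>x\<in>U. eventually (\<lambda>(x', y). x' = x \<longrightarrow> y \<in> U) uniformity)"

lemma dist_branch_pt_aux:
  assumes "0 \<le> r" "0 \<le> s"
  shows "dist (branch_pt i r) (branch_pt j s) = (if i = j then \<bar>r - s\<bar> else r + s)"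
  using assms by (auto simp: dist_junction_def branch_pt_in_branch_iff radius_branch_pt)

instance
proof
  fix x y z :: "'a junction"
  obtain i r where x: "0 \<le> r" "x = branch_pt i r" by (rule junction_cases)
  obtain j s where y: "0 \<le> s" "y = branch_pt j s" by (rule junction_cases)
  obtain k t where z: "0 \<le> t" "z = branch_pt k t" by (rule junction_cases)
  show "(dist x y = 0) = (x = y)"
    using x y by (auto simp: dist_branch_pt_aux branch_pt_eq_iff)
  show "dist x y \<le> dist x z + dist y z"
    using x y z by (auto simp: dist_branch_pt_aux)
qed (rule uniformity_junction_def open_junction_def)+

end

lemma dist_branch_pt:
  assumes "0 \<le> r" "0 \<le> s"
  shows "dist (branch_pt i r) (branch_pt j s) = (if i = j then \<bar>r - s\<bar> else r + s)"
  using assms by (rule dist_branch_pt_aux)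

section \<open>Test functions\<close>

text \<open>
  \<open>C1_on S \<psi>\<close>: \<open>\<psi>\<close> has on \<open>S\<close> a derivative relative to \<open>S\<close> which is continuous on \<open>S\<close>.  It is used for
  \<open>S = (0,T) \<times> [0,\<infinity>)\<close>, hence means \<open>C\<^sup>1\<close> up to the boundary \<open>r = 0\<close>.
\<close>

definition C1_on :: "(real \<times> real) set \<Rightarrow> (real \<times> real \<Rightarrow> real) \<Rightarrow> bool" where
  "C1_on S \<psi> \<longleftrightarrow>
     (\<exists>D :: real \<times> real \<Rightarrow> (real \<times> real) \<Rightarrow>\<^sub>L real. continuous_on S D \<and>
        (\<forall>z\<in>S. (\<psi> has_derivative blinfun_apply (D z)) (at z within S)))"

definition C1_test :: "real \<Rightarrow> (real \<times> ('n::finite) junction \<Rightarrow> real) \<Rightarrow> bool" where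
  "C1_test T \<phi> \<longleftrightarrow>
     continuous_on ({0<..<T} \<times> UNIV) \<phi> \<and>
     (\<forall>i. C1_on ({0<..<T} \<times> {0..}) (\<lambda>(t, r). \<phi> (t, branch_pt i r)))"

definition time_deriv :: "(real \<times> ('n::finite) junction \<Rightarrow> real) \<Rightarrow> real \<Rightarrow> 'n junction \<Rightarrow> real" where
  "time_deriv \<phi> t x = deriv (\<lambda>s. \<phi> (s, x)) t"

text \<open>\<open>branch_deriv i \<phi> t x\<close> is \<open>\<partial>\<^sub>i \<phi>(t, x)\<close> for \<open>x\<close> on branch \<open>i\<close>; it is one-sided at the origin.\<close>

definition branch_deriv ::
    "'n::finite \<Rightarrow> (real \<times> 'n junction \<Rightarrow> real) \<Rightarrow> real \<Rightarrow> 'n junction \<Rightarrow> real" where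
  "branch_deriv i \<phi> t x =
     vector_derivative (\<lambda>r. \<phi> (t, branch_pt i r)) (at (radius x) within {0..})"

definition gradient_at_origin ::
    "(real \<times> ('n::finite) junction \<Rightarrow> real) \<Rightarrow> real \<Rightarrow> real ^ 'n" where
  "gradient_at_origin \<phi> t = (\<chi> i. branch_deriv i \<phi> t origin)"

section \<open>Relaxed viscosity solutions\<close>

text \<open>
  Envelopes relative to the set \<open>S\<close> on which \<open>u\<close> is considered.  They are extended-real valued, so that
  no local boundedness of \<open>u\<close> has to be presupposed.
\<close>

definition usc_env :: "'a::metric_space set \<Rightarrow> ('a \<Rightarrow> real) \<Rightarrow> 'a \<Rightarrow> ereal" where
  "usc_env S u z = (INF e\<in>{0<..}. SUP w\<in>S \<inter> ball z e. ereal (u w))"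

definition lsc_env :: "'a::metric_space set \<Rightarrow> ('a \<Rightarrow> real) \<Rightarrow> 'a \<Rightarrow> ereal" where
  "lsc_env S u z = (SUP e\<in>{0<..}. INF w\<in>S \<inter> ball z e. ereal (u w))"

definition touches_above ::
    "'a::metric_space set \<Rightarrow> ('a \<Rightarrow> real) \<Rightarrow> ('a \<Rightarrow> ereal) \<Rightarrow> 'a \<Rightarrow> bool" where
  "touches_above S \<phi> v z \<longleftrightarrow>
     (\<exists>e>0. \<forall>w\<in>S \<inter> ball z e. v w - ereal (\<phi> w) \<le> v z - ereal (\<phi> z))"

definition touches_below ::
    "'a::metric_space set \<Rightarrow> ('a \<Rightarrow> real) \<Rightarrow> ('a \<Rightarrow> ereal) \<Rightarrow> 'a \<Rightarrow> bool" where
  "touches_below S \<phi> v z \<longleftrightarrow>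
     (\<exists>e>0. \<forall>w\<in>S \<inter> ball z e. v z - ereal (\<phi> z) \<le> v w - ereal (\<phi> w))"

definition relaxed_subsolution ::
    "real \<Rightarrow> ('n::finite \<Rightarrow> real \<Rightarrow> real) \<Rightarrow> (real ^ 'n \<Rightarrow> real) \<Rightarrow>
     (real \<times> 'n junction \<Rightarrow> real) \<Rightarrow> bool" where
  "relaxed_subsolution T H F u \<longleftrightarrow>
     (\<forall>\<phi>. C1_test T \<phi> \<longrightarrow>
       (\<forall>t\<in>{0<..<T}. \<forall>x.
          touches_above ({0<..<T} \<times> UNIV) \<phi> (usc_env ({0..<T} \<times> UNIV) u) (t, x) \<longrightarrow>
            (\<forall>i. x \<in> branch i - {origin} \<longrightarrow>
               time_deriv \<phi> t x + H i (branch_deriv i \<phi> t x) \<le> 0) \<and>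
            (x = origin \<longrightarrow>
               time_deriv \<phi> t x + F (gradient_at_origin \<phi> t) \<le> 0 \<or>
               (\<exists>i. time_deriv \<phi> t x + H i (branch_deriv i \<phi> t x) \<le> 0))))"

definition relaxed_supersolution ::
    "real \<Rightarrow> ('n::finite \<Rightarrow> real \<Rightarrow> real) \<Rightarrow> (real ^ 'n \<Rightarrow> real) \<Rightarrow>
     (real \<times> 'n junction \<Rightarrow> real) \<Rightarrow> bool" where
  "relaxed_supersolution T H F u \<longleftrightarrow>
     (\<forall>\<phi>. C1_test T \<phi> \<longrightarrow>
       (\<forall>t\<in>{0<..<T}. \<forall>x.
          touches_below ({0<..<T} \<times> UNIV) \<phi> (lsc_env ({0..<T} \<times> UNIV) u) (t, x) \<longrightarrow>
            (\<forall>i. x \<in> branch i - {origin} \<longrightarrow>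
               time_deriv \<phi> t x + H i (branch_deriv i \<phi> t x) \<ge> 0) \<and>
            (x = origin \<longrightarrow>
               time_deriv \<phi> t x + F (gradient_at_origin \<phi> t) \<ge> 0 \<or>
               (\<exists>i. time_deriv \<phi> t x + H i (branch_deriv i \<phi> t x) \<ge> 0))))"

definition initial_condition ::
    "real \<Rightarrow> (('n::finite) junction \<Rightarrow> real) \<Rightarrow> (real \<times> 'n junction \<Rightarrow> real) \<Rightarrow> bool" where
  "initial_condition T u0 u \<longleftrightarrow>
     (\<forall>x. usc_env ({0..<T} \<times> UNIV) u (0, x) \<le> ereal (u0 x) \<and>
          lsc_env ({0..<T} \<times> UNIV) u (0, x) \<ge> ereal (u0 x))"

definition relaxed_solution ::
    "('n::finite \<Rightarrow> real \<Rightarrow> real) \<Rightarrow> (real ^ 'n \<Rightarrow> real) \<Rightarrow> ('n junction \<Rightarrow> real) \<Rightarrow>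
     (real \<times> 'n junction \<Rightarrow> real) \<Rightarrow> bool" where
  "relaxed_solution H F u0 u \<longleftrightarrow>
     (\<forall>T>0. relaxed_subsolution T H F u \<and> relaxed_supersolution T H F u \<and> initial_condition T u0 u)"

definition quasi_convex :: "(real \<Rightarrow> real) \<Rightarrow> bool" where
  "quasi_convex h \<longleftrightarrow> (\<forall>c. convex {p. h p \<le> c})"

definition coercive :: "(real \<Rightarrow> real) \<Rightarrow> bool" where
  "coercive h \<longleftrightarrow> filterlim h at_top at_infinity"

definition nonincreasing_in_each_variable :: "(real ^ 'n \<Rightarrow> real) \<Rightarrow> bool" where
  "nonincreasing_in_each_variable F \<longleftrightarrow>
     (\<forall>i p. antimono (\<lambda>s. F (\<chi> j. if j = i then s else p $ j)))"

end

theory Submission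
  imports Defs
begin

text \<open>
  Everything rests on one-dimensional arguments with quadratic test
  functions, in which coercivity and quasi-convexity replace a vertex test function and any
  representation formula.

  Uniqueness is a comparison principle for a subsolution \<open>v\<close> and a supersolution \<open>w\<close>.  At a maximum
  point of \<open>v(t,x) - w(s,x) - (t - s)\<^sup>2/(2\<epsilon>) - \<dots>\<close> only time has been doubled.  Bounding the coupling term
  by a quadratic in \<open>t\<close> plus a quadratic in \<open>s\<close> makes the two variables independent, so that the supremum of \<open>v\<close>
  over \<open>t\<close> and the infimum of \<open>w\<close> over \<open>s\<close>, each corrected by its quadratic, are functions \<open>V \<le> W\<close> of the space
  variable alone which touch at the maximum point.  The slopes of test functions touching \<open>V\<close> from above lie,
  up to a small error, in the bounded interval \<open>{H \<le> -\<lambda>}\<close>; those of test functions touching \<open>W\<close> from below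
  avoid a neighbourhood of this interval, where \<open>H < -a\<close>, because \<open>a < \<lambda>\<close>.  As \<open>W\<close> starts above
  \<open>V\<close>, its slopes are to the right of the interval: there is one slope \<open>r\<close>, a little to the
  right of the interval, such that \<open>V \<le> r y\<close> and \<open>W \<ge> r y - O(y\<^sup>2)\<close> (lemma \<open>twin_branch\<close>).  At the vertex
  the vector of these slopes is a test gradient for \<open>v\<close> and for \<open>w\<close> at once.  No
  Hamiltonian of a branch can satisfy its inequality there, so \<open>F(r) \<le> -\<lambda> < -a \<le> F(r)\<close>.  Inside a branch the
  two sides together give \<open>w\<close> a test slope in the forbidden interval
  (\<open>no_doubled_maximum\<close>, \<open>comparison\<close>).

  Existence for Lipschitz \<open>u\<^sub>0\<close> is Perron's method among the subsolutions that lie below \<open>u\<^sub>0 + C t\<close> and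
  decrease in time at rate at most \<open>C + 1\<close>.  Coercivity makes them uniformly Lipschitz in space, and
  time shifts make their supremum Lipschitz in time.  The supremum is thus continuous, it
  is a subsolution by stability (\<open>quadratic_subsolution_stable\<close>), and it is a supersolution because it could
  otherwise be raised by a small paraboloid (\<open>bump\<close>).

  General initial data are uniform limits of Lipschitz ones.  By comparison the corresponding solutions form a
  uniform Cauchy sequence, and every other solution stays close to them.  All comparisons made
  have on one side a function that is Lipschitz in time, which bounds the time derivatives at the doubled maximum
  uniformly in \<open>\<epsilon>\<close>.
\<close>

section \<open>One-dimensional slopes\<close>

text \<open>
  First-order part of a second-order superjet: a parabola of slope \<open>q\<close> touches \<open>V\<close> from above at \<open>y\<close>.  Lower slopes of
  \<open>V\<close> are the negatives of the upper slopes of \<open>-V\<close>.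
\<close>

definition upper_slope :: "(real \<Rightarrow> real) \<Rightarrow> real \<Rightarrow> real \<Rightarrow> bool" where
  "upper_slope V y q \<longleftrightarrow>
     (\<exists>M. \<exists>e>0. \<forall>y'. \<bar>y' - y\<bar> < e \<longrightarrow> V y' \<le> V y + q * (y' - y) + M * (y' - y)\<^sup>2)"

definition upper_slope2 :: "(real \<Rightarrow> real \<Rightarrow> real) \<Rightarrow> real \<Rightarrow> real \<Rightarrow> real \<Rightarrow> real \<Rightarrow> bool" where
  "upper_slope2 A t y a q \<longleftrightarrow>
     (\<exists>M. \<exists>e>0. \<forall>t' y'. \<bar>t' - t\<bar> < e \<longrightarrow> \<bar>y' - y\<bar> < e \<longrightarrow>
        A t' y' \<le> A t y + a * (t' - t) + q * (y' - y) + M * ((t' - t)\<^sup>2 + (y' - y)\<^sup>2))"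

lemma upper_slopeI:
  assumes "e > 0"
    and "\<And>y'. \<bar>y' - y\<bar> < e \<Longrightarrow> V y' \<le> V y + q * (y' - y) + M * (y' - y)\<^sup>2"
  shows "upper_slope V y q"
  using assms unfolding upper_slope_def by blast

lemma upper_slope2I:
  assumes "e > 0"
    and "\<And>t' y'. \<bar>t' - t\<bar> < e \<Longrightarrow> \<bar>y' - y\<bar> < e \<Longrightarrow>
       A t' y' \<le> A t y + a * (t' - t) + q * (y' - y) + M * ((t' - t)\<^sup>2 + (y' - y)\<^sup>2)"
  shows "upper_slope2 A t y a q"
  using assms unfolding upper_slope2_def by blast

lemma upper_slope2E:
  assumes "upper_slope2 A t y a q"
  obtains M e where "e > 0" "M \<ge> 0"
    "\<And>t' y'. \<bar>t' - t\<bar> < e \<Longrightarrow> \<bar>y' - y\<bar> < e \<Longrightarrow>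
       A t' y' \<le> A t y + a * (t' - t) + q * (y' - y) + M * ((t' - t)\<^sup>2 + (y' - y)\<^sup>2)"
proof -
  obtain M e where e: "e > 0" and M: "\<And>t' y'. \<bar>t' - t\<bar> < e \<Longrightarrow> \<bar>y' - y\<bar> < e \<Longrightarrow>
       A t' y' \<le> A t y + a * (t' - t) + q * (y' - y) + M * ((t' - t)\<^sup>2 + (y' - y)\<^sup>2)"
    using assms unfolding upper_slope2_def by blast
  have "M * ((t' - t)\<^sup>2 + (y' - y)\<^sup>2) \<le> \<bar>M\<bar> * ((t' - t)\<^sup>2 + (y' - y)\<^sup>2)" for t' y'
    by (intro mult_right_mono) auto
  with M have "A t' y' \<le> A t y + a * (t' - t) + q * (y' - y) + \<bar>M\<bar> * ((t' - t)\<^sup>2 + (y' - y)\<^sup>2)"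
    if "\<bar>t' - t\<bar> < e" "\<bar>y' - y\<bar> < e" for t' y'
    using that by (meson add_left_mono order_trans)
  then show ?thesis using that[of e "\<bar>M\<bar>"] e by simp
qed

lemma upper_slope2_add:
  assumes "upper_slope2 A t y a q" "upper_slope2 B t y b p"
  shows "upper_slope2 (\<lambda>t y. A t y + B t y) t y (a + b) (q + p)"
proof -
  obtain M e where 1: "e > 0" "\<And>t' y'. \<bar>t' - t\<bar> < e \<Longrightarrow> \<bar>y' - y\<bar> < e \<Longrightarrow>
       A t' y' \<le> A t y + a * (t' - t) + q * (y' - y) + M * ((t' - t)\<^sup>2 + (y' - y)\<^sup>2)"
    using assms(1) unfolding upper_slope2_def by blast
  obtain M' e' where 2: "e' > 0" "\<And>t' y'. \<bar>t' - t\<bar> < e' \<Longrightarrow> \<bar>y' - y\<bar> < e' \<Longrightarrow>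
       B t' y' \<le> B t y + b * (t' - t) + p * (y' - y) + M' * ((t' - t)\<^sup>2 + (y' - y)\<^sup>2)"
    using assms(2) unfolding upper_slope2_def by blast
  show ?thesis
  proof (rule upper_slope2I[where e = "min e e'" and M = "M + M'"])
    fix t' y' assume "\<bar>t' - t\<bar> < min e e'" "\<bar>y' - y\<bar> < min e e'"
    then show "A t' y' + B t' y' \<le> A t y + B t y + (a + b) * (t' - t) + (q + p) * (y' - y)
        + (M + M') * ((t' - t)\<^sup>2 + (y' - y)\<^sup>2)"
      using 1(2)[of t' y'] 2(2)[of t' y'] by (simp add: distrib_right)
  qed (use 1 2 in auto)
qed

lemma upper_slope2_affine:
  assumes "upper_slope2 (\<lambda>t y. f (t0 + t) (r0 + \<sigma> * y)) t y a q" and \<sigma>: "\<bar>\<sigma>\<bar> = 1"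
  shows "upper_slope2 f (t0 + t) (r0 + \<sigma> * y) a (\<sigma> * q)"
proof -
  obtain M e where 1: "e > 0" "\<And>t' y'. \<bar>t' - t\<bar> < e \<Longrightarrow> \<bar>y' - y\<bar> < e \<Longrightarrow>
       f (t0 + t') (r0 + \<sigma> * y') \<le> f (t0 + t) (r0 + \<sigma> * y) + a * (t' - t) + q * (y' - y)
         + M * ((t' - t)\<^sup>2 + (y' - y)\<^sup>2)"
    using assms(1) unfolding upper_slope2_def by blast
  have \<sigma>2: "\<sigma> * \<sigma> = 1" using \<sigma> by (metis abs_mult_self mult_1)
  show ?thesis
  proof (rule upper_slope2I[where e = e and M = M])
    fix t' y' assume t': "\<bar>t' - (t0 + t)\<bar> < e" and y': "\<bar>y' - (r0 + \<sigma> * y)\<bar> < e"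
    define z where "z = \<sigma> * (y' - r0)"
    have z: "y' = r0 + \<sigma> * z" unfolding z_def using \<sigma>2 by (simp add: algebra_simps flip: mult.assoc)
    have zy: "y' - (r0 + \<sigma> * y) = \<sigma> * (z - y)" by (simp add: z algebra_simps)
    then have "\<bar>z - y\<bar> < e" using y' \<sigma> by (simp add: abs_mult)
    moreover have "(y' - (r0 + \<sigma> * y))\<^sup>2 = (z - y)\<^sup>2"
      unfolding zy power_mult_distrib using \<sigma>2 by (simp add: power2_eq_square)
    moreover have "\<sigma> * q * (y' - (r0 + \<sigma> * y)) = q * (z - y)"
      unfolding zy using \<sigma>2 by (simp add: algebra_simps) (simp flip: mult.assoc)
    ultimately show "f t' y' \<le> f (t0 + t) (r0 + \<sigma> * y) + a * (t' - (t0 + t)) +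
        \<sigma> * q * (y' - (r0 + \<sigma> * y)) + M * ((t' - (t0 + t))\<^sup>2 + (y' - (r0 + \<sigma> * y))\<^sup>2)"
      using 1(2)[of "t' - t0" z] t' by (simp add: z algebra_simps)
  qed (use 1 in auto)
qed

text \<open>
  A derivative bound read off from upper slopes.  If the increment were too small, then
  \<open>V(y) - \<alpha> y - k/(y - c)\<close> with a small \<open>k > 0\<close> would have an interior maximum: the singular term excludes
  \<open>c\<close>, the small increment excludes \<open>d\<close>.  There \<open>V\<close> has an upper slope below \<open>\<alpha>\<close>.
\<close>

lemma slope_lower:
  assumes "c < d" "continuous_on {c..d} V"
    and sl: "\<And>y q. c < y \<Longrightarrow> y < d \<Longrightarrow> upper_slope V y q \<Longrightarrow> q > \<alpha>"
  shows "\<alpha> * (d - c) \<le> V d - V c"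
proof (rule ccontr)
  assume neg: "\<not> ?thesis"
  define f where "f y = V y - \<alpha> * y" for y
  have fdc: "f d < f c" using neg by (simp add: f_def algebra_simps)
  have cf: "continuous_on {c..d} f" unfolding f_def by (intro continuous_intros assms)
  then obtain \<delta> where \<delta>: "\<delta> > 0" "\<And>y. y \<in> {c..d} \<Longrightarrow> dist y c < \<delta> \<Longrightarrow> dist (f y) (f c) < f c - f d"
    using fdc \<open>c < d\<close> unfolding continuous_on_iff by (metis atLeastAtMost_iff diff_gt_0_iff_gt less_eq_real_def)
  define y1 where "y1 = c + min (\<delta>/2) ((d - c)/2)"
  have y1: "c < y1" "y1 < d" using \<delta>(1) \<open>c < d\<close> by (auto simp: y1_def min_def field_simps)
  have "dist y1 c < \<delta>" using \<delta>(1) \<open>c < d\<close> by (simp add: y1_def dist_real_def)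
  then have fy1: "f y1 > f d" using \<delta>(2)[of y1] y1 by (auto simp: dist_real_def)
  \<comment> \<open>The singular term takes away only half of \<open>f y1 - f d\<close> at \<open>y1\<close>.\<close>
  define k where "k = (f y1 - f d) * (y1 - c) / 2"
  have k: "k > 0" using fy1 y1 by (simp add: k_def)
  define G where "G y = f y - k / (y - c)" for y
  have Gy1: "G y1 > G d"
  proof -
    have "k / (y1 - c) = (f y1 - f d) / 2" using y1(1) unfolding k_def by (simp only: divide_divide_eq_left) (simp add: field_simps)
    moreover have "k / (d - c) > 0" using k \<open>c < d\<close> by simp
    moreover have "f y1 - D > f d - E" if "D = (f y1 - f d) / 2" "E > 0" for D E
      using that fy1 by argo
    ultimately show ?thesis unfolding G_def by blast
  qed
  obtain z where z: "z \<in> {c..d}" "\<And>y. y \<in> {c..d} \<Longrightarrow> f y \<le> f z"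
    using continuous_attains_sup[OF compact_Icc _ cf] \<open>c < d\<close> by auto
  define c' where "c' = c + min ((y1 - c)/2) (k / (\<bar>f z - G y1\<bar> + 1))"
  have c': "c < c'" "c' < y1" using y1 k by (auto simp: c'_def min_def field_simps)
  have Gc': "G c' < G y1"
  proof -
    have "c' - c \<le> k / (\<bar>f z - G y1\<bar> + 1)" by (simp add: c'_def)
    then have "k / (c' - c) \<ge> \<bar>f z - G y1\<bar> + 1"
      using c' by (simp add: field_simps)
    moreover have "f c' \<le> f z" using z c' y1 by auto
    ultimately show ?thesis unfolding G_def[of c'] by linarith
  qed
  have "continuous_on {c'..d} G" unfolding G_def
    by (intro continuous_intros continuous_on_subset[OF cf]) (use c' in auto)
  then obtain y where y: "y \<in> {c'..d}" "\<And>x. x \<in> {c'..d} \<Longrightarrow> G x \<le> G y"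
    using continuous_attains_sup[OF compact_Icc, of c' d G] c' y1 by auto
  have "G y \<ge> G y1" using y(2)[of y1] c' y1 by auto
  with Gy1 Gc' have "y \<noteq> d" "y \<noteq> c'" by auto
  with y have yy: "c' < y" "y < d" by auto
  have "upper_slope V y (\<alpha> - k / (y - c)\<^sup>2)"
  proof (rule upper_slopeI[where e = "min (y - c') (d - y)" and M = "k / ((c' - c) * (y - c)\<^sup>2)"])
    fix x assume "\<bar>x - y\<bar> < min (y - c') (d - y)"
    then have x: "c' < x" "x < d" by auto
    have "G x \<le> G y" using y(2)[of x] x by simp
    then have 1: "V x \<le> V y + \<alpha> * (x - y) + k * (1 / (x - c) - 1 / (y - c))"
      by (simp add: G_def f_def algebra_simps)
    have "1 / (x - c) - 1 / (y - c) = - (x - y) / (y - c)\<^sup>2 + (x - y)\<^sup>2 / ((x - c) * (y - c)\<^sup>2)"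
      using x yy c' by (simp add: divide_simps) (simp add: algebra_simps power2_eq_square)
    also have "\<dots> \<le> - (x - y) / (y - c)\<^sup>2 + (x - y)\<^sup>2 / ((c' - c) * (y - c)\<^sup>2)"
      using x yy c' by (intro add_left_mono divide_left_mono mult_right_mono mult_pos_pos) auto
    finally have "k * (1 / (x - c) - 1 / (y - c)) \<le>
        k * (- (x - y) / (y - c)\<^sup>2 + (x - y)\<^sup>2 / ((c' - c) * (y - c)\<^sup>2))"
      using k by (intro mult_left_mono) auto
    also have "\<dots> = - (k / (y - c)\<^sup>2) * (x - y) + k / ((c' - c) * (y - c)\<^sup>2) * (x - y)\<^sup>2"
      by (simp add: distrib_left) (metis minus_diff_eq minus_divide_left mult_minus_right)
    finally show "V x \<le> V y + (\<alpha> - k / (y - c)\<^sup>2) * (x - y) + k / ((c' - c) * (y - c)\<^sup>2) * (x - y)\<^sup>2"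
      using 1 by (simp add: left_diff_distrib)
  qed (use yy in auto)
  then have "\<alpha> - k / (y - c)\<^sup>2 > \<alpha>" using sl[of y] yy c' by simp
  moreover have "k / (y - c)\<^sup>2 \<ge> 0" using k by simp
  ultimately show False by linarith
qed

lemma slope_upper:
  assumes "c < d" "continuous_on {c..d} V"
    and sl: "\<And>y q. c < y \<Longrightarrow> y < d \<Longrightarrow> upper_slope V y q \<Longrightarrow> q < \<beta>"
  shows "V d - V c \<le> \<beta> * (d - c)"
proof -
  have "continuous_on {c..d} (\<lambda>y. V (c + d - y))"
    by (rule continuous_on_compose2[OF assms(2)]) (auto intro!: continuous_intros)
  then have "(- \<beta>) * (d - c) \<le> V (c + d - d) - V (c + d - c)"
  proof (rule slope_lower[OF assms(1)])
    fix y q assume y: "c < y" "y < d" and "upper_slope (\<lambda>y. V (c + d - y)) y q"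
    then obtain M e where e: "e > 0"
      "\<And>y'. \<bar>y' - y\<bar> < e \<Longrightarrow> V (c + d - y') \<le> V (c + d - y) + q * (y' - y) + M * (y' - y)\<^sup>2"
      unfolding upper_slope_def by blast
    have "upper_slope V (c + d - y) (- q)"
    proof (rule upper_slopeI[where M = M, OF e(1)])
      fix x assume "\<bar>x - (c + d - y)\<bar> < e"
      then show "V x \<le> V (c + d - y) + - q * (x - (c + d - y)) + M * (x - (c + d - y))\<^sup>2"
        using e(2)[of "c + d - x"] by (simp add: abs_minus_commute algebra_simps power2_eq_square)
    qed
    then show "- \<beta> < q" using sl[of "c + d - y" "- q"] y by simp
  qed
  then show ?thesis by simp
qed

text \<open>
  If \<open>W\<close> starts above a line of slope \<open>\<alpha>\<close> and no lower slope lies in \<open>[\<alpha> - \<delta>, r]\<close>, then \<open>W\<close> starts with slope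
  at least \<open>r\<close>.  The test function is \<open>(\<alpha> - \<delta>) y + L y/(1 + k y)\<close> with \<open>L = r - \<alpha> + \<delta>\<close>.  Its slope decreases
  from \<open>r\<close> to \<open>\<alpha> - \<delta>\<close> and therefore stays in the forbidden interval, and for large \<open>k\<close> the decrease is so fast that the
  test function is below the line of slope \<open>\<alpha>\<close> at \<open>\<rho>\<close>.  So \<open>W\<close> minus the test function has no negative minimum.
\<close>

lemma lower_slope_gap:
  assumes "\<rho> > 0" "\<delta> > 0" "\<alpha> \<le> r" and cW: "continuous_on {0..\<rho>} W" and "W 0 = 0"
    and W: "\<And>y. 0 \<le> y \<Longrightarrow> y \<le> \<rho> \<Longrightarrow> \<alpha> * y \<le> W y"
    and sl: "\<And>y q. 0 < y \<Longrightarrow> y < \<rho> \<Longrightarrow> upper_slope (\<lambda>y. - W y) y (- q) \<Longrightarrow> \<not> (\<alpha> - \<delta> \<le> q \<and> q \<le> r)"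
  shows "\<exists>k\<ge>0. \<forall>y\<in>{0..\<rho>}. r * y - k * y\<^sup>2 \<le> W y"
proof -
  define L where "L = r - \<alpha> + \<delta>"
  have L: "L > 0" using assms by (simp add: L_def)
  define k where "k = 2 * L / (\<delta> * \<rho>)"
  have k: "k > 0" "L / k = \<delta> * \<rho> / 2" using L assms by (auto simp: k_def)
  define g where "g y = (\<alpha> - \<delta>) * y + L * (y / (1 + k * y))" for y
  have pos: "1 + k * y > 0" if "y \<ge> 0" for y using that k by (simp add: add_pos_nonneg)
  have cg: "continuous_on {0..\<rho>} (\<lambda>y. W y - g y)"
    unfolding g_def by (intro continuous_intros cW) (use pos in force)
  obtain y where y: "y \<in> {0..\<rho>}" "\<And>x. x \<in> {0..\<rho>} \<Longrightarrow> W y - g y \<le> W x - g x"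
    using continuous_attains_inf[OF compact_Icc _ cg] \<open>\<rho> > 0\<close> by auto
  have "W y \<ge> g y"
  proof (rule ccontr)
    assume neg: "\<not> ?thesis"
    have "y \<noteq> 0" using neg \<open>W 0 = 0\<close> by (auto simp: g_def)
    moreover have "y \<noteq> \<rho>"
    proof
      assume "y = \<rho>"
      have "L * (\<rho> / (1 + k * \<rho>)) \<le> L * (\<rho> / (k * \<rho>))"
        using L k(1) \<open>\<rho> > 0\<close> by (intro mult_left_mono divide_left_mono mult_pos_pos add_pos_pos) auto
      also have "\<dots> = \<delta> * \<rho> / 2" using k \<open>\<rho> > 0\<close> by simp
      finally have "g \<rho> \<le> (\<alpha> - \<delta>) * \<rho> + \<delta> * \<rho> / 2" by (simp add: g_def)
      also have "\<dots> \<le> \<alpha> * \<rho>" using \<open>\<delta> > 0\<close> \<open>\<rho> > 0\<close> by (simp add: algebra_simps)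
      also have "\<dots> \<le> W \<rho>" using W[of \<rho>] \<open>\<rho> > 0\<close> by simp
      finally show False using neg \<open>y = \<rho>\<close> by simp
    qed
    ultimately have yy: "0 < y" "y < \<rho>" using y(1) by auto
    define q where "q = \<alpha> - \<delta> + L / (1 + k * y)\<^sup>2"
    have "upper_slope (\<lambda>y. - W y) y (- q)"
    proof (rule upper_slopeI[where e = "min y (\<rho> - y)" and M = "L * k"])
      fix x assume "\<bar>x - y\<bar> < min y (\<rho> - y)"
      then have x: "0 < x" "x < \<rho>" by auto
      have py: "1 + k * y \<ge> 1" and px: "1 + k * x \<ge> 1" using yy x k by auto
      then have p2: "1 \<le> (1 + k * x) * (1 + k * y)\<^sup>2"
        using mult_mono[of 1 "1 + k * x" 1 "(1 + k * y)\<^sup>2"] one_le_power[of "1 + k * y" 2] by simp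
      have ne: "1 + k * x \<noteq> 0" "1 + k * y \<noteq> 0" using px py by linarith+
      have "x / (1 + k * x) - y / (1 + k * y) - (x - y) / (1 + k * y)\<^sup>2
          = - (k * (x - y)\<^sup>2 / ((1 + k * x) * (1 + k * y)\<^sup>2))"
        using ne by (simp add: divide_simps) (simp add: algebra_simps power2_eq_square)
      moreover have "k * (x - y)\<^sup>2 / ((1 + k * x) * (1 + k * y)\<^sup>2) \<le> k * (x - y)\<^sup>2 / 1"
        using p2 k by (intro divide_left_mono) auto
      ultimately have "x / (1 + k * x) - y / (1 + k * y) - (x - y) / (1 + k * y)\<^sup>2 \<ge> - (k * (x - y)\<^sup>2)"
        by simp
      then have "L * (x / (1 + k * x) - y / (1 + k * y) - (x - y) / (1 + k * y)\<^sup>2) \<ge> L * - (k * (x - y)\<^sup>2)"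
        using L by (intro mult_left_mono) auto
      then have "g x - g y \<ge> q * (x - y) - L * k * (x - y)\<^sup>2"
        unfolding g_def q_def by (simp add: algebra_simps)
      then show "- W x \<le> - W y + - q * (x - y) + L * k * (x - y)\<^sup>2"
        using y(2)[of x] x by simp
    qed (use yy in auto)
    moreover have "L / (1 + k * y)\<^sup>2 \<le> L / 1" "L / (1 + k * y)\<^sup>2 > 0"
      using L k(1) yy pos[of y] one_le_power[of "1 + k * y" 2]
      by (auto simp: divide_le_eq intro!: divide_pos_pos)
    then have "\<alpha> - \<delta> \<le> q \<and> q \<le> r" by (simp add: q_def L_def)
    ultimately show False using sl[OF yy] by blast
  qed
  then have Wg: "g x \<le> W x" if "x \<in> {0..\<rho>}" for x using y(2)[OF that] by simp
  show ?thesis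
  proof (intro exI[of _ "L * k"] conjI ballI)
    fix x assume x: "x \<in> {0..\<rho>}"
    have "x / (1 + k * x) - (x - k * x\<^sup>2) = k\<^sup>2 * x ^ 3 / (1 + k * x)"
      using pos[of x] x by (simp add: divide_simps) (simp add: algebra_simps power2_eq_square power3_eq_cube)
    also have "\<dots> \<ge> 0" using pos[of x] x by simp
    finally have "L * (x / (1 + k * x)) \<ge> L * (x - k * x\<^sup>2)"
      using L by (intro mult_left_mono) auto
    then have "g x \<ge> r * x - L * k * x\<^sup>2" by (simp add: g_def L_def algebra_simps)
    then show "r * x - L * k * x\<^sup>2 \<le> W x" using Wg[OF x] by simp
  qed (use L k in auto)
qed

text \<open>
  Removing time: the penalised supremum over \<open>t\<close> is a function of space, and each of its upper slopes is a space
  slope of \<open>A\<close> at a point whose time slope is that of the penalty.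
\<close>

lemma time_sup:
  assumes "\<tau>1 > 0" "\<tau>1 < \<tau>"
    and cA: "continuous_on ({-\<tau>..\<tau>} \<times> {c..d}) (\<lambda>(t, y). A t y)"
    and far: "\<And>t y. c \<le> y \<Longrightarrow> y \<le> d \<Longrightarrow> \<bar>t\<bar> \<le> \<tau> \<Longrightarrow> \<tau>1 \<le> \<bar>t\<bar> \<Longrightarrow> A t y - N * t\<^sup>2 < A 0 y"
    and sl: "\<And>t y q. \<bar>t\<bar> < \<tau>1 \<Longrightarrow> c < y \<Longrightarrow> y < d \<Longrightarrow> upper_slope2 A t y (2 * N * t) q \<Longrightarrow> q \<in> S"
  obtains V where "continuous_on {c..d} V"
    and "\<And>y. c \<le> y \<Longrightarrow> y \<le> d \<Longrightarrow> \<exists>t. \<bar>t\<bar> < \<tau>1 \<and> V y = A t y - N * t\<^sup>2"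
    and "\<And>t y. c \<le> y \<Longrightarrow> y \<le> d \<Longrightarrow> \<bar>t\<bar> \<le> \<tau> \<Longrightarrow> A t y \<le> V y + N * t\<^sup>2"
    and "\<And>y q. c < y \<Longrightarrow> y < d \<Longrightarrow> upper_slope V y q \<Longrightarrow> q \<in> S"
proof -
  have ex: "\<exists>t\<in>{-\<tau>..\<tau>}. \<forall>t'\<in>{-\<tau>..\<tau>}. A t' y - N * t'\<^sup>2 \<le> A t y - N * t\<^sup>2"
    if "y \<in> {c..d}" for y
  proof -
    have "continuous_on {-\<tau>..\<tau>} (\<lambda>t. (\<lambda>(t, y). A t y) (t, y))"
      by (rule continuous_on_compose2[OF cA], intro continuous_intros) (use that in auto)
    then have "continuous_on {-\<tau>..\<tau>} (\<lambda>t. A t y - N * t\<^sup>2)"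
      by (simp add: continuous_on_diff continuous_on_mult continuous_on_power)
    then show ?thesis using continuous_attains_sup[OF compact_Icc, of "-\<tau>" \<tau>] assms(1,2) by auto
  qed
  then obtain m where m: "\<And>y. y \<in> {c..d} \<Longrightarrow> m y \<in> {-\<tau>..\<tau>}"
    "\<And>y t. y \<in> {c..d} \<Longrightarrow> t \<in> {-\<tau>..\<tau>} \<Longrightarrow> A t y - N * t\<^sup>2 \<le> A (m y) y - N * (m y)\<^sup>2"
    by metis
  define V where "V y = A (m y) y - N * (m y)\<^sup>2" for y
  have V: "A t y \<le> V y + N * t\<^sup>2" if "y \<in> {c..d}" "t \<in> {-\<tau>..\<tau>}" for y t
    using m(2)[OF that] by (simp add: V_def)
  have m1: "\<bar>m y\<bar> < \<tau>1" if "y \<in> {c..d}" for y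
  proof (rule ccontr)
    assume "\<not> ?thesis"
    then have "A (m y) y - N * (m y)\<^sup>2 < A 0 y" using far[of y "m y"] m(1)[OF that] that by auto
    then show False using m(2)[OF that, of 0] assms(1,2) by auto
  qed
  show ?thesis
  proof (rule that[of V])
    have uc: "uniformly_continuous_on ({-\<tau>..\<tau>} \<times> {c..d}) (\<lambda>(t, y). A t y)"
      by (rule compact_uniformly_continuous[OF cA]) (simp add: compact_Times)
    show "continuous_on {c..d} V"
      unfolding continuous_on_iff
    proof (intro ballI allI impI)
      fix y \<epsilon> :: real assume y: "y \<in> {c..d}" "\<epsilon> > 0"
      obtain \<delta> where \<delta>: "\<delta> > 0" "\<And>z z'. z \<in> {-\<tau>..\<tau>} \<times> {c..d} \<Longrightarrow> z' \<in> {-\<tau>..\<tau>} \<times> {c..d} \<Longrightarrow> dist z' z < \<delta> \<Longrightarrow>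
          dist ((\<lambda>(t, y). A t y) z') ((\<lambda>(t, y). A t y) z) < \<epsilon>"
        using uc \<open>\<epsilon> > 0\<close> unfolding uniformly_continuous_on_def by blast
      show "\<exists>\<delta>>0. \<forall>x\<in>{c..d}. dist x y < \<delta> \<longrightarrow> dist (V x) (V y) < \<epsilon>"
      proof (intro exI[of _ \<delta>] conjI ballI impI \<delta>(1))
        fix x assume x: "x \<in> {c..d}" "dist x y < \<delta>"
        have *: "\<bar>A t x - A t y\<bar> < \<epsilon>" if "t \<in> {-\<tau>..\<tau>}" for t
          using \<delta>(2)[of "(t, y)" "(t, x)"] x y that by (simp add: dist_Pair_Pair dist_real_def)
        have "V x \<le> A (m x) y + \<epsilon> - N * (m x)\<^sup>2 - (\<epsilon> - \<bar>A (m x) x - A (m x) y\<bar>)" unfolding V_def by linarith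
        then have "V x - V y < \<epsilon>" using V[OF y(1) m(1)[OF x(1)]] *[OF m(1)[OF x(1)]] by linarith
        moreover have "V y \<le> A (m y) x + \<epsilon> - N * (m y)\<^sup>2 - (\<epsilon> - \<bar>A (m y) x - A (m y) y\<bar>)" unfolding V_def by linarith
        then have "V y - V x < \<epsilon>" using V[OF x(1) m(1)[OF y(1)]] *[OF m(1)[OF y(1)]] by linarith
        ultimately show "dist (V x) (V y) < \<epsilon>" by (simp add: dist_real_def)
      qed
    qed
    show "\<exists>t. \<bar>t\<bar> < \<tau>1 \<and> V y = A t y - N * t\<^sup>2" if "c \<le> y" "y \<le> d" for y
      using m1[of y] that by (auto simp: V_def)
    show "A t y \<le> V y + N * t\<^sup>2" if "c \<le> y" "y \<le> d" "\<bar>t\<bar> \<le> \<tau>" for t y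
      by (rule V) (use that in auto)
    show "q \<in> S" if y: "c < y" "y < d" "upper_slope V y q" for y q
    proof -
      obtain M e where e: "e > 0" "\<And>y'. \<bar>y' - y\<bar> < e \<Longrightarrow> V y' \<le> V y + q * (y' - y) + M * (y' - y)\<^sup>2"
        using y(3) unfolding upper_slope_def by blast
      have t: "\<bar>m y\<bar> < \<tau>1" using m1[of y] y by auto
      define e' where "e' = min (min e (\<tau> - \<tau>1)) (min (y - c) (d - y))"
      have "upper_slope2 A (m y) y (2 * N * m y) q"
      proof (rule upper_slope2I[where e = e' and M = "max \<bar>N\<bar> \<bar>M\<bar>"])
        show "e' > 0" using e y assms(2) by (auto simp: e'_def)
        fix t' y' assume t': "\<bar>t' - m y\<bar> < e'" and y': "\<bar>y' - y\<bar> < e'"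
        have "y' \<in> {c..d}" "\<bar>y' - y\<bar> < e" using y' by (auto simp: e'_def)
        moreover have "t' \<in> {-\<tau>..\<tau>}" using t' t by (auto simp: e'_def)
        ultimately have 1: "A t' y' \<le> V y + q * (y' - y) + M * (y' - y)\<^sup>2 + N * t'\<^sup>2"
          using V[of y' t'] e(2)[of y'] by linarith
        have 2: "N * t'\<^sup>2 - N * (m y)\<^sup>2 = 2 * N * m y * (t' - m y) + N * (t' - m y)\<^sup>2"
          by (simp add: algebra_simps power2_eq_square)
        have "N * (t' - m y)\<^sup>2 \<le> max \<bar>N\<bar> \<bar>M\<bar> * (t' - m y)\<^sup>2" "M * (y' - y)\<^sup>2 \<le> max \<bar>N\<bar> \<bar>M\<bar> * (y' - y)\<^sup>2"
          by (auto intro!: mult_right_mono)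
        with 1 2 show "A t' y' \<le> A (m y) y + 2 * N * m y * (t' - m y) + q * (y' - y) +
              max \<bar>N\<bar> \<bar>M\<bar> * ((t' - m y)\<^sup>2 + (y' - y)\<^sup>2)"
          unfolding V_def distrib_left by linarith
      qed
      then show ?thesis using sl t y by blast
    qed
  qed
qed

section \<open>Decoupling time at a doubled maximum\<close>

text \<open>
  If the penalised maximum over time is attained only at \<open>0\<close> when \<open>y = 0\<close>, then by uniform continuity it is
  attained near \<open>0\<close> for small \<open>y\<close>; the time slopes that occur are then small.
\<close>

lemma time_localized:
  fixes A :: "real \<Rightarrow> real \<Rightarrow> real"
  assumes "\<tau>1 > 0" "\<rho> > 0"
    and cA: "continuous_on ({-\<tau>..\<tau>} \<times> {0..\<rho>}) (\<lambda>(t, y). A t y)"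
    and A0: "\<And>t. \<bar>t\<bar> \<le> \<tau> \<Longrightarrow> A t 0 \<le> K * t\<^sup>2" "A 0 0 = 0"
  shows "\<exists>\<rho>'>0. \<rho>' \<le> \<rho> \<and> (\<forall>t y. 0 \<le> y \<longrightarrow> y \<le> \<rho>' \<longrightarrow> \<bar>t\<bar> \<le> \<tau> \<longrightarrow> \<tau>1 \<le> \<bar>t\<bar> \<longrightarrow>
           A t y - (K + 1) * t\<^sup>2 < A 0 y)"
proof -
  have uc: "uniformly_continuous_on ({-\<tau>..\<tau>} \<times> {0..\<rho>}) (\<lambda>(t, y). A t y)"
    by (rule compact_uniformly_continuous[OF cA]) (simp add: compact_Times)
  define \<epsilon> where "\<epsilon> = \<tau>1\<^sup>2 / 2"
  have \<epsilon>: "\<epsilon> > 0" using assms(1) by (simp add: \<epsilon>_def)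
  then obtain \<delta> where \<delta>: "\<delta> > 0" "\<And>z z'. z \<in> {-\<tau>..\<tau>} \<times> {0..\<rho>} \<Longrightarrow> z' \<in> {-\<tau>..\<tau>} \<times> {0..\<rho>} \<Longrightarrow> dist z' z < \<delta> \<Longrightarrow>
          dist ((\<lambda>(t, y). A t y) z') ((\<lambda>(t, y). A t y) z) < \<epsilon>"
    using uc unfolding uniformly_continuous_on_def by blast
  show ?thesis
  proof (intro exI[of _ "min \<rho> (\<delta>/2)"] conjI allI impI)
    fix t y assume y: "0 \<le> y" "y \<le> min \<rho> (\<delta>/2)" and t: "\<bar>t\<bar> \<le> \<tau>" "\<tau>1 \<le> \<bar>t\<bar>"
    have *: "\<bar>A s y - A s 0\<bar> < \<epsilon>" if "\<bar>s\<bar> \<le> \<tau>" for s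
      using \<delta>(2)[of "(s, 0)" "(s, y)"] \<delta>(1) y that assms(2) by (simp add: dist_Pair_Pair dist_real_def abs_le_iff)
    have "A t y < K * t\<^sup>2 + \<epsilon>" using *[OF t(1)] A0(1)[OF t(1)] by linarith
    moreover have "A 0 y > - \<epsilon>" using *[of 0] A0(2) t by linarith
    moreover have "t\<^sup>2 \<ge> \<tau>1\<^sup>2" using t(2) assms(1) by (simp add: abs_le_square_iff[symmetric])
    ultimately show "A t y - (K + 1) * t\<^sup>2 < A 0 y" by (simp add: \<epsilon>_def algebra_simps)
  qed (use assms \<delta> in auto)
qed

text \<open>
  The heart of the comparison argument, on one branch near the maximum point \<open>(0, 0)\<close>.  Eliminating time from
  \<open>A\<close> and \<open>B\<close> gives \<open>V \<le> W\<close> with \<open>V(0) = W(0) = 0\<close>.  The slopes of \<open>V\<close> give \<open>\<alpha> y \<le> V(y) \<le> \<beta> y\<close>, so \<open>W\<close>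
  starts above the line of slope \<open>\<alpha>\<close>, and the gap in its slopes pushes it above the line of slope \<open>\<beta>\<close>.
  In the applications the slopes of \<open>A\<close> lie in a slight enlargement of a sub-level set of a Hamiltonian.
  The first conclusion detects the case of an empty sub-level set, which is represented by \<open>\<alpha> > \<beta>\<close>.
\<close>

lemma twin_branch:
  assumes pos: "\<tau> > 0" "\<rho> > 0" "\<delta> > 0" "\<omega> > 0" "K \<ge> 0"
    and cA: "continuous_on ({-\<tau>..\<tau>} \<times> {0..\<rho>}) (\<lambda>(t, y). A t y)" and "A 0 0 = 0"
    and cB: "continuous_on ({-\<tau>..\<tau>} \<times> {0..\<rho>}) (\<lambda>(t, y). B t y)" and "B 0 0 = 0"
    and le: "\<And>t s y. \<bar>t\<bar> \<le> \<tau> \<Longrightarrow> \<bar>s\<bar> \<le> \<tau> \<Longrightarrow> 0 \<le> y \<Longrightarrow> y \<le> \<rho> \<Longrightarrow> A t y - K * t\<^sup>2 \<le> B s y + K * s\<^sup>2"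
    and slA: "\<And>t y a q. \<bar>t\<bar> < \<tau> \<Longrightarrow> 0 < y \<Longrightarrow> y < \<rho> \<Longrightarrow> \<bar>a\<bar> \<le> \<omega> \<Longrightarrow> upper_slope2 A t y a q \<Longrightarrow> \<alpha> < q \<and> q < \<beta>"
    and slB: "\<And>t y a q. \<bar>t\<bar> < \<tau> \<Longrightarrow> 0 < y \<Longrightarrow> y < \<rho> \<Longrightarrow> \<bar>a\<bar> \<le> \<omega> \<Longrightarrow>
        upper_slope2 (\<lambda>t y. - B t y) t y (- a) (- q) \<Longrightarrow> \<not> (\<alpha> - \<delta> \<le> q \<and> q \<le> \<beta>)"
  shows "\<alpha> \<le> \<beta>"
    and "\<exists>k\<ge>0. \<exists>\<rho>'>0. \<rho>' \<le> \<rho> \<and> (\<forall>t y. \<bar>t\<bar> \<le> \<tau> \<longrightarrow> 0 \<le> y \<longrightarrow> y \<le> \<rho>' \<longrightarrow>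
           A t y \<le> (K + 1) * t\<^sup>2 + \<beta> * y \<and> - (K + 1) * t\<^sup>2 + \<beta> * y - k * y\<^sup>2 \<le> B t y)"
proof -
  define N where "N = K + 1"
  have N: "N > 0" using pos by (simp add: N_def)
  define \<tau>1 where "\<tau>1 = min (\<tau>/2) (\<omega> / (2 * N))"
  have \<tau>1: "\<tau>1 > 0" "\<tau>1 < \<tau>" "\<tau>1 \<le> \<omega> / (2 * N)" using pos N by (auto simp: \<tau>1_def min_def)
  have \<omega>: "\<bar>2 * N * t\<bar> \<le> \<omega>" if "\<bar>t\<bar> < \<tau>1" for t
  proof -
    have "2 * N * \<bar>t\<bar> \<le> 2 * N * (\<omega> / (2 * N))" using that \<tau>1(3) N by (intro mult_left_mono) auto
    then show ?thesis using N by (simp add: abs_mult)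
  qed
  have A0: "A t 0 \<le> K * t\<^sup>2" if "\<bar>t\<bar> \<le> \<tau>" for t
    using le[of t 0 0] that pos \<open>B 0 0 = 0\<close> by simp
  have B0: "- B t 0 \<le> K * t\<^sup>2" if "\<bar>t\<bar> \<le> \<tau>" for t
    using le[of 0 t 0] that pos \<open>A 0 0 = 0\<close> by simp
  have cB': "continuous_on ({-\<tau>..\<tau>} \<times> {0..\<rho>}) (\<lambda>(t, y). - B t y)"
    using continuous_on_minus[OF cB] by (simp add: case_prod_unfold)
  obtain \<rho>1 where \<rho>1: "\<rho>1 > 0" "\<rho>1 \<le> \<rho>" "\<And>t y. 0 \<le> y \<Longrightarrow> y \<le> \<rho>1 \<Longrightarrow> \<bar>t\<bar> \<le> \<tau> \<Longrightarrow> \<tau>1 \<le> \<bar>t\<bar> \<Longrightarrow> A t y - N * t\<^sup>2 < A 0 y"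
    using time_localized[OF \<tau>1(1) pos(2) cA A0 \<open>A 0 0 = 0\<close>] unfolding N_def by blast
  obtain \<rho>2 where \<rho>2: "\<rho>2 > 0" "\<rho>2 \<le> \<rho>" "\<And>t y. 0 \<le> y \<Longrightarrow> y \<le> \<rho>2 \<Longrightarrow> \<bar>t\<bar> \<le> \<tau> \<Longrightarrow> \<tau>1 \<le> \<bar>t\<bar> \<Longrightarrow> - B t y - N * t\<^sup>2 < - B 0 y"
    using time_localized[OF \<tau>1(1) pos(2) cB' B0] \<open>B 0 0 = 0\<close> unfolding N_def by auto
  define r where "r = min \<rho>1 \<rho>2"
  have r: "r > 0" "r \<le> \<rho>" "r \<le> \<rho>1" "r \<le> \<rho>2" using \<rho>1 \<rho>2 by (auto simp: r_def)
  have sub: "{-\<tau>..\<tau>} \<times> {0..r} \<subseteq> {-\<tau>..\<tau>} \<times> {0..\<rho>}" using r by auto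
  obtain V where V: "continuous_on {0..r} V"
    "\<And>y. 0 \<le> y \<Longrightarrow> y \<le> r \<Longrightarrow> \<exists>t. \<bar>t\<bar> < \<tau>1 \<and> V y = A t y - N * t\<^sup>2"
    "\<And>t y. 0 \<le> y \<Longrightarrow> y \<le> r \<Longrightarrow> \<bar>t\<bar> \<le> \<tau> \<Longrightarrow> A t y \<le> V y + N * t\<^sup>2"
    "\<And>y q. 0 < y \<Longrightarrow> y < r \<Longrightarrow> upper_slope V y q \<Longrightarrow> q \<in> {\<alpha><..<\<beta>}"
  proof (rule time_sup[OF \<tau>1(1,2) continuous_on_subset[OF cA sub], of N "{\<alpha><..<\<beta>}"])
    show "A t y - N * t\<^sup>2 < A 0 y" if "0 \<le> y" "y \<le> r" "\<bar>t\<bar> \<le> \<tau>" "\<tau>1 \<le> \<bar>t\<bar>" for t y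
      using \<rho>1(3) that r by simp
    show "q \<in> {\<alpha><..<\<beta>}" if "\<bar>t\<bar> < \<tau>1" "0 < y" "y < r" "upper_slope2 A t y (2 * N * t) q" for t y q
      using slA[OF _ that(2) _ \<omega>[OF that(1)] that(4)] that r \<tau>1 by auto
  qed blast
  obtain U where U: "continuous_on {0..r} U"
    "\<And>y. 0 \<le> y \<Longrightarrow> y \<le> r \<Longrightarrow> \<exists>t. \<bar>t\<bar> < \<tau>1 \<and> U y = - B t y - N * t\<^sup>2"
    "\<And>t y. 0 \<le> y \<Longrightarrow> y \<le> r \<Longrightarrow> \<bar>t\<bar> \<le> \<tau> \<Longrightarrow> - B t y \<le> U y + N * t\<^sup>2"
    "\<And>y q. 0 < y \<Longrightarrow> y < r \<Longrightarrow> upper_slope U y q \<Longrightarrow> q \<in> {q. \<not> (\<alpha> - \<delta> \<le> - q \<and> - q \<le> \<beta>)}"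
  proof (rule time_sup[OF \<tau>1(1,2) continuous_on_subset[OF cB' sub], of N "{q. \<not> (\<alpha> - \<delta> \<le> - q \<and> - q \<le> \<beta>)}"])
    show "- B t y - N * t\<^sup>2 < - B 0 y" if "0 \<le> y" "y \<le> r" "\<bar>t\<bar> \<le> \<tau>" "\<tau>1 \<le> \<bar>t\<bar>" for t y
      using \<rho>2(3) that r by simp
    show "q \<in> {q. \<not> (\<alpha> - \<delta> \<le> - q \<and> - q \<le> \<beta>)}"
      if "\<bar>t\<bar> < \<tau>1" "0 < y" "y < r" "upper_slope2 (\<lambda>t y. - B t y) t y (2 * N * t) q" for t y q
      using slB[of t y "- (2 * N * t)" "- q"] \<omega>[OF that(1)] that r \<tau>1 by auto
  qed blast
  have VU: "V y \<le> - U y" if y: "0 \<le> y" "y \<le> r" for y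
  proof -
    obtain t s where ts: "\<bar>t\<bar> < \<tau>1" "V y = A t y - N * t\<^sup>2" "\<bar>s\<bar> < \<tau>1" "U y = - B s y - N * s\<^sup>2"
      using V(2)[OF y] U(2)[OF y] by blast
    then have "A t y - K * t\<^sup>2 \<le> B s y + K * s\<^sup>2" using le[of t s y] y r \<tau>1 by auto
    then show ?thesis using ts by (simp add: N_def algebra_simps) (smt (verit) zero_le_power2)
  qed
  have V0: "V 0 = 0"
  proof -
    obtain t where t: "\<bar>t\<bar> < \<tau>1" "V 0 = A t 0 - N * t\<^sup>2" using V(2)[of 0] r by auto
    then have "V 0 \<le> - t\<^sup>2" using A0[of t] \<tau>1 by (simp add: N_def algebra_simps)
    then have "V 0 \<le> 0" by (smt (verit) zero_le_power2)
    moreover have "0 \<le> V 0" using V(3)[of 0 0] r pos \<open>A 0 0 = 0\<close> by auto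
    ultimately show ?thesis by simp
  qed
  have U0: "U 0 = 0"
  proof -
    obtain t where t: "\<bar>t\<bar> < \<tau>1" "U 0 = - B t 0 - N * t\<^sup>2" using U(2)[of 0] r by auto
    then have "U 0 \<le> - t\<^sup>2" using B0[of t] \<tau>1 by (simp add: N_def algebra_simps)
    then have "U 0 \<le> 0" by (smt (verit) zero_le_power2)
    moreover have "0 \<le> U 0" using U(3)[of 0 0] r pos \<open>B 0 0 = 0\<close> by auto
    ultimately show ?thesis by simp
  qed
  have Vlow: "\<alpha> * y \<le> V y" and Vup: "V y \<le> \<beta> * y" if y: "0 \<le> y" "y \<le> r" for y
  proof -
    have "\<alpha> * y \<le> V y \<and> V y \<le> \<beta> * y"
    proof (cases "y = 0")
      case False
      have c: "continuous_on {0..y} V" using continuous_on_subset[OF V(1)] y by auto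
      have "\<alpha> * (y - 0) \<le> V y - V 0"
        by (rule slope_lower[OF _ c]) (use V(4) y False in auto)
      moreover have "V y - V 0 \<le> \<beta> * (y - 0)"
        by (rule slope_upper[OF _ c]) (use V(4) y False in auto)
      ultimately show ?thesis using V0 by simp
    qed (use V0 in simp)
    then show "\<alpha> * y \<le> V y" "V y \<le> \<beta> * y" by auto
  qed
  have "\<alpha> * r \<le> \<beta> * r" using Vlow[of r] Vup[of r] r by linarith
  then show ab: "\<alpha> \<le> \<beta>" using r by simp
  have "\<exists>k\<ge>0. \<forall>y\<in>{0..r}. \<beta> * y - k * y\<^sup>2 \<le> - U y"
  proof (rule lower_slope_gap[OF r(1) pos(3) ab])
    show "continuous_on {0..r} (\<lambda>y. - U y)" using U(1) by (intro continuous_intros)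
    show "\<alpha> * y \<le> - U y" if "0 \<le> y" "y \<le> r" for y using VU[OF that] Vlow[OF that] by linarith
    show "\<not> (\<alpha> - \<delta> \<le> q \<and> q \<le> \<beta>)" if "0 < y" "y < r" "upper_slope (\<lambda>y. - (- U y)) y (- q)" for y q
      using U(4)[of y "- q"] that by simp
  qed (simp add: U0)
  then obtain k where k: "k \<ge> 0" "\<And>y. y \<in> {0..r} \<Longrightarrow> \<beta> * y - k * y\<^sup>2 \<le> - U y" by blast
  show "\<exists>k\<ge>0. \<exists>\<rho>'>0. \<rho>' \<le> \<rho> \<and> (\<forall>t y. \<bar>t\<bar> \<le> \<tau> \<longrightarrow> 0 \<le> y \<longrightarrow> y \<le> \<rho>' \<longrightarrow>
           A t y \<le> (K + 1) * t\<^sup>2 + \<beta> * y \<and> - (K + 1) * t\<^sup>2 + \<beta> * y - k * y\<^sup>2 \<le> B t y)"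
  proof (rule exI[of _ k], intro conjI exI[of _ r] allI impI)
    fix t y assume t: "\<bar>t\<bar> \<le> \<tau>" and y: "0 \<le> y" "y \<le> r"
    show "A t y \<le> (K + 1) * t\<^sup>2 + \<beta> * y" using V(3)[OF y t] Vup[OF y] by (simp add: N_def)
    show "- (K + 1) * t\<^sup>2 + \<beta> * y - k * y\<^sup>2 \<le> B t y"
      using U(3)[OF y t] k(2)[of y] y by (simp add: N_def algebra_simps)
  qed (use k r in auto)
qed

text \<open>
  By quasi-convexity and coercivity a sub-level set is a compact interval; uniform continuity
  gives a margin \<open>\<delta>\<close> around it that serves all levels \<open>c \<le> C\<close>.
\<close>

lemma sublevel_interval:
  fixes h :: "real \<Rightarrow> real"
  assumes ch: "continuous_on UNIV h" and qc: "quasi_convex h" and co: "coercive h" and "\<gamma> > 0"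
  shows "\<exists>\<delta>>0. \<forall>c\<le>C. \<exists>\<alpha> \<beta>. (\<forall>p. h p \<le> c \<longrightarrow> \<alpha> \<le> p \<and> p \<le> \<beta>) \<and>
           (\<forall>p. \<alpha> - 3 * \<delta> \<le> p \<longrightarrow> p \<le> \<beta> + 3 * \<delta> \<longrightarrow> h p < c + \<gamma>)"
proof -
  have "eventually (\<lambda>p. h p > C) at_infinity"
    using co unfolding coercive_def filterlim_at_top_dense by blast
  then obtain R where R: "\<And>p. h p \<le> C \<Longrightarrow> \<bar>p\<bar> < R"
    unfolding eventually_at_infinity by (metis linorder_not_le real_norm_def)
  have "uniformly_continuous_on {-R-1..R+1} h"
    by (rule compact_uniformly_continuous) (auto intro: continuous_on_subset[OF ch])
  then obtain d where d: "d > 0" "\<And>p p'. p \<in> {-R-1..R+1} \<Longrightarrow> p' \<in> {-R-1..R+1} \<Longrightarrow> dist p' p < d \<Longrightarrow> dist (h p') (h p) < \<gamma>"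
    unfolding uniformly_continuous_on_def using \<open>\<gamma> > 0\<close> by metis
  define \<delta> where "\<delta> = min 1 d / 4"
  have \<delta>: "\<delta> > 0" "3 * \<delta> < 1" "3 * \<delta> < d" using d by (auto simp: \<delta>_def min_def)
  show ?thesis
  proof (rule exI[of _ \<delta>], intro conjI allI impI \<delta>(1))
    fix c assume "c \<le> C"
    show "\<exists>\<alpha> \<beta>. (\<forall>p. h p \<le> c \<longrightarrow> \<alpha> \<le> p \<and> p \<le> \<beta>) \<and>
           (\<forall>p. \<alpha> - 3 * \<delta> \<le> p \<longrightarrow> p \<le> \<beta> + 3 * \<delta> \<longrightarrow> h p < c + \<gamma>)"
    proof (cases "\<exists>p. h p \<le> c")
      case False
      \<comment> \<open>An empty sub-level set is described by an interval that remains empty when enlarged by \<open>3 \<delta>\<close>.\<close>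
      then show ?thesis using \<delta>(1) by (intro exI[of _ "7 * \<delta>"] exI[of _ 0]) auto
    next
      case True
      define L where "L = {p. h p \<le> c}"
      have "L \<noteq> {}" using True by (simp add: L_def)
      have LR: "\<bar>p\<bar> < R" if "p \<in> L" for p using R[of p] that \<open>c \<le> C\<close> by (simp add: L_def)
      have bdd: "bdd_below L" "bdd_above L" using LR
        by (auto intro!: bdd_belowI[of _ "-R"] bdd_aboveI[of _ R]) force+
      have "closed L" unfolding L_def by (intro closed_Collect_le ch continuous_intros)
      then have in1: "Inf L \<in> L" "Sup L \<in> L"
        using closed_contains_Inf closed_contains_Sup \<open>L \<noteq> {}\<close> bdd by auto
      have "convex L" using qc unfolding quasi_convex_def L_def by blast
      then have seg: "p \<in> L" if "Inf L \<le> p" "p \<le> Sup L" for p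
        using in1 that unfolding is_interval_convex_1[symmetric] is_interval_1 by blast
      show ?thesis
      proof (rule exI[of _ "Inf L"], rule exI[of _ "Sup L"], intro conjI allI impI)
        fix p assume "h p \<le> c"
        then show "Inf L \<le> p" "p \<le> Sup L"
          using bdd by (auto simp: L_def intro!: cInf_lower cSup_upper)
      next
        fix p assume p: "Inf L - 3 * \<delta> \<le> p" "p \<le> Sup L + 3 * \<delta>"
        define p' where "p' = max (Inf L) (min p (Sup L))"
        have "Inf L \<le> Sup L" using bdd in1(1) by (simp add: cSup_upper)
        then have p': "p' \<in> L" "\<bar>p - p'\<bar> \<le> 3 * \<delta>" using p \<delta> by (auto intro!: seg simp: p'_def)
        then have "dist (h p) (h p') < \<gamma>" using LR[OF p'(1)] \<delta> by (intro d(2)) (auto simp: dist_real_def)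
        then show "h p < c + \<gamma>" using p'(1) by (simp add: L_def dist_real_def)
      qed
    qed
  qed
qed

text \<open>
  Application of \<open>twin_branch\<close> to a pair of solutions on one branch, \<open>lam\<close> and \<open>a\<close> being the time
  derivatives of the test functions.  The penalisation \<open>b\<close> is counted on the side of \<open>v\<close>, where it shifts slopes by at
  most \<open>\<delta>\<close>.
\<close>

lemma twin_solutions:
  assumes pos: "\<tau> > 0" "\<rho> > 0" "\<delta> > 0" "\<omega> > 0" "K \<ge> 0"
    and cv: "continuous_on ({-\<tau>..\<tau>} \<times> {0..\<rho>}) (\<lambda>(t, y). v t y)"
    and cw: "continuous_on ({-\<tau>..\<tau>} \<times> {0..\<rho>}) (\<lambda>(t, y). w t y)"
    and cb: "continuous_on {0..\<rho>} b" and "b 0 = 0"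
    and slb: "\<And>y. 0 < y \<Longrightarrow> y < \<rho> \<Longrightarrow> \<exists>p. \<bar>p\<bar> \<le> \<delta> \<and> upper_slope b y p"
    and le: "\<And>t s y. \<bar>t\<bar> \<le> \<tau> \<Longrightarrow> \<bar>s\<bar> \<le> \<tau> \<Longrightarrow> 0 \<le> y \<Longrightarrow> y \<le> \<rho> \<Longrightarrow>
       v t y - w s y - b y \<le> v 0 0 - w 0 0 + lam * t - a * s + K * (t\<^sup>2 + s\<^sup>2)"
    and sv: "\<And>t y a q. \<bar>t\<bar> < \<tau> \<Longrightarrow> 0 < y \<Longrightarrow> y < \<rho> \<Longrightarrow> upper_slope2 v t y a q \<Longrightarrow> a + h q \<le> 0"
    and sw: "\<And>t y a q. \<bar>t\<bar> < \<tau> \<Longrightarrow> 0 < y \<Longrightarrow> y < \<rho> \<Longrightarrow> upper_slope2 (\<lambda>t y. - w t y) t y (- a) (- q) \<Longrightarrow> a + h q \<ge> 0"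
    and h1: "\<And>p. h p \<le> c \<Longrightarrow> \<alpha> \<le> p \<and> p \<le> \<beta>"
    and h2: "\<And>p. \<alpha> - 3 * \<delta> \<le> p \<Longrightarrow> p \<le> \<beta> + 3 * \<delta> \<Longrightarrow> h p < c + \<gamma>"
    and gap: "- lam + \<omega> \<le> c" "c + \<gamma> \<le> - a - \<omega>"
  shows "\<alpha> - 2 * \<delta> \<le> \<beta> + 2 * \<delta>"
    and "\<exists>k\<ge>0. \<exists>\<rho>'>0. \<rho>' \<le> \<rho> \<and> (\<forall>t y. \<bar>t\<bar> \<le> \<tau> \<longrightarrow> 0 \<le> y \<longrightarrow> y \<le> \<rho>' \<longrightarrow>
           v t y \<le> v 0 0 + lam * t + b y + (K + 1) * t\<^sup>2 + (\<beta> + 2 * \<delta>) * y \<and>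
           w 0 0 + a * t - (K + 1) * t\<^sup>2 + (\<beta> + 2 * \<delta>) * y - k * y\<^sup>2 \<le> w t y)"
proof -
  define A where "A t y = v t y - v 0 0 - lam * t - b y" for t y
  define B where "B t y = w t y - w 0 0 - a * t" for t y
  have cb': "continuous_on ({-\<tau>..\<tau>} \<times> {0..\<rho>}) (\<lambda>(t::real, y). b y)"
    unfolding case_prod_unfold by (rule continuous_on_compose2[OF cb]) (auto intro!: continuous_intros)
  have cA: "continuous_on ({-\<tau>..\<tau>} \<times> {0..\<rho>}) (\<lambda>(t, y). A t y)"
    using cv cb' unfolding A_def case_prod_unfold by (intro continuous_intros)
  have cB: "continuous_on ({-\<tau>..\<tau>} \<times> {0..\<rho>}) (\<lambda>(t, y). B t y)"
    using cw unfolding B_def case_prod_unfold by (intro continuous_intros)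
  have AB0: "A 0 0 = 0" "B 0 0 = 0" using \<open>b 0 = 0\<close> by (auto simp: A_def B_def)
  have AB: "A t y - K * t\<^sup>2 \<le> B s y + K * s\<^sup>2" if "\<bar>t\<bar> \<le> \<tau>" "\<bar>s\<bar> \<le> \<tau>" "0 \<le> y" "y \<le> \<rho>" for t s y
    using le[OF that] by (simp add: A_def B_def algebra_simps)
  have slA: "\<alpha> - 2 * \<delta> < q \<and> q < \<beta> + 2 * \<delta>"
    if A: "\<bar>t\<bar> < \<tau>" "0 < y" "y < \<rho>" "\<bar>a'\<bar> \<le> \<omega>" "upper_slope2 A t y a' q" for t y a' q
  proof -
    obtain p M e where p: "\<bar>p\<bar> \<le> \<delta>" "e > 0"
      "\<And>y'. \<bar>y' - y\<bar> < e \<Longrightarrow> b y' \<le> b y + p * (y' - y) + M * (y' - y)\<^sup>2"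
      using slb[OF A(2,3)] unfolding upper_slope_def by blast
    have "upper_slope2 (\<lambda>t y. v 0 0 + lam * t + b y) t y lam p"
    proof (rule upper_slope2I[where e = e and M = "\<bar>M\<bar>"])
      fix t' y' assume "\<bar>y' - y\<bar> < e"
      have "M * (y' - y)\<^sup>2 \<le> \<bar>M\<bar> * (y' - y)\<^sup>2" "0 \<le> \<bar>M\<bar> * (t' - t)\<^sup>2" by (auto intro: mult_right_mono)
      then show "v 0 0 + lam * t' + b y' \<le> v 0 0 + lam * t + b y + lam * (t' - t) + p * (y' - y)
          + \<bar>M\<bar> * ((t' - t)\<^sup>2 + (y' - y)\<^sup>2)"
        using p(3)[OF \<open>\<bar>y' - y\<bar> < e\<close>] unfolding distrib_left right_diff_distrib by linarith
    qed (rule p(2))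
    from upper_slope2_add[OF that(5) this] have "upper_slope2 v t y (a' + lam) (q + p)"
      by (simp add: A_def)
    then have "h (q + p) \<le> c" using sv[OF that(1-3)] that(4) gap by (smt (verit))
    then show ?thesis using h1[of "q + p"] p(1) pos(3) by auto
  qed
  have slB: "\<not> (\<alpha> - 2 * \<delta> - \<delta> \<le> q \<and> q \<le> \<beta> + 2 * \<delta>)"
    if "\<bar>t\<bar> < \<tau>" "0 < y" "y < \<rho>" "\<bar>a'\<bar> \<le> \<omega>" "upper_slope2 (\<lambda>t y. - B t y) t y (- a') (- q)" for t y a' q
  proof
    assume q: "\<alpha> - 2 * \<delta> - \<delta> \<le> q \<and> q \<le> \<beta> + 2 * \<delta>"
    have "upper_slope2 (\<lambda>t y. - w 0 0 - a * t) t y (- a) 0"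
      by (rule upper_slope2I[where e = 1 and M = 0]) (auto simp: algebra_simps)
    from upper_slope2_add[OF that(5) this] have "upper_slope2 (\<lambda>t y. - w t y) t y (- (a' + a)) (- q)"
      by (simp add: B_def)
    then have "a' + a + h q \<ge> 0" using sw[OF that(1-3)] by blast
    moreover have "h q < c + \<gamma>" using h2[of q] q pos(3) by auto
    ultimately show False using gap that(4) by auto
  qed
  show "\<alpha> - 2 * \<delta> \<le> \<beta> + 2 * \<delta>"
    by (rule twin_branch(1)[OF pos cA AB0(1) cB AB0(2)]) (fact AB, fact slA, fact slB)
  have T: "\<exists>k\<ge>0. \<exists>\<rho>'>0. \<rho>' \<le> \<rho> \<and> (\<forall>t y. \<bar>t\<bar> \<le> \<tau> \<longrightarrow> 0 \<le> y \<longrightarrow> y \<le> \<rho>' \<longrightarrow>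
           A t y \<le> (K + 1) * t\<^sup>2 + (\<beta> + 2 * \<delta>) * y \<and>
           - (K + 1) * t\<^sup>2 + (\<beta> + 2 * \<delta>) * y - k * y\<^sup>2 \<le> B t y)"
    by (rule twin_branch(2)[OF pos cA AB0(1) cB AB0(2)]) (fact AB, fact slA, fact slB)
  show "\<exists>k\<ge>0. \<exists>\<rho>'>0. \<rho>' \<le> \<rho> \<and> (\<forall>t y. \<bar>t\<bar> \<le> \<tau> \<longrightarrow> 0 \<le> y \<longrightarrow> y \<le> \<rho>' \<longrightarrow>
           v t y \<le> v 0 0 + lam * t + b y + (K + 1) * t\<^sup>2 + (\<beta> + 2 * \<delta>) * y \<and>
           w 0 0 + a * t - (K + 1) * t\<^sup>2 + (\<beta> + 2 * \<delta>) * y - k * y\<^sup>2 \<le> w t y)"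
    using T unfolding A_def B_def by (simp add: algebra_simps)
qed

section \<open>Sub- and supersolutions tested by quadratic functions\<close>

text \<open>
  Analogue of \<open>upper_slope2\<close> at the origin, with one slope for each branch.
\<close>

definition vertex_slope :: "(real \<times> ('n::finite) junction \<Rightarrow> real) \<Rightarrow> real \<Rightarrow> real \<Rightarrow> real ^ 'n \<Rightarrow> bool" where
  "vertex_slope u t a q \<longleftrightarrow>
     (\<exists>M. \<exists>e>0. \<forall>i t' r. \<bar>t' - t\<bar> < e \<longrightarrow> 0 \<le> r \<longrightarrow> r < e \<longrightarrow>
        u (t', branch_pt i r) \<le> u (t, origin) + a * (t' - t) + (q $ i) * r + M * ((t' - t)\<^sup>2 + r\<^sup>2))"

text \<open>
  The relaxed inequalities on \<open>(0, \<infinity>)\<close>, tested by quadratic functions only.  For a continuous function this is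
  equivalent to being a relaxed subsolution for every \<open>T\<close>
  (\<open>relaxed_imp_quadratic_subsolution\<close> and \<open>quadratic_subsolution_imp_relaxed\<close>); unlike \<open>C\<^sup>1\<close> test functions, the quadratic ones
  require no extension to the whole junction and are stable under shifts in time.
\<close>

definition quadratic_subsolution :: "('n::finite \<Rightarrow> real \<Rightarrow> real) \<Rightarrow> (real ^ 'n \<Rightarrow> real) \<Rightarrow> (real \<times> 'n junction \<Rightarrow> real) \<Rightarrow> bool" where
  "quadratic_subsolution H F u \<longleftrightarrow>
     (\<forall>i t r a q. 0 < t \<longrightarrow> 0 < r \<longrightarrow> upper_slope2 (\<lambda>t r. u (t, branch_pt i r)) t r a q \<longrightarrow> a + H i q \<le> 0) \<and>
     (\<forall>t a q. 0 < t \<longrightarrow> vertex_slope u t a q \<longrightarrow> a + F q \<le> 0 \<or> (\<exists>i. a + H i (q $ i) \<le> 0))"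

text \<open>
  Reduction to subsolutions by \<open>w \<mapsto> -w\<close>, so that stability and the passage to \<open>C\<^sup>1\<close> test functions are proved once: they
  hold for arbitrary continuous Hamiltonians, hence for the reflected ones.
\<close>

definition quadratic_supersolution :: "('n::finite \<Rightarrow> real \<Rightarrow> real) \<Rightarrow> (real ^ 'n \<Rightarrow> real) \<Rightarrow> (real \<times> 'n junction \<Rightarrow> real) \<Rightarrow> bool" where
  "quadratic_supersolution H F w \<longleftrightarrow> quadratic_subsolution (\<lambda>i p. - H i (- p)) (\<lambda>q. - F (- q)) (\<lambda>z. - w z)"

lemma vertex_slopeI:
  assumes "e > 0" and "\<And>i t' r. \<bar>t' - t\<bar> < e \<Longrightarrow> 0 \<le> r \<Longrightarrow> r < e \<Longrightarrow>
        u (t', branch_pt i r) \<le> u (t, origin) + a * (t' - t) + (q $ i) * r + M * ((t' - t)\<^sup>2 + r\<^sup>2)"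
  shows "vertex_slope u t a q"
  using assms unfolding vertex_slope_def by blast

lemma continuous_on_branch_pt: "continuous_on {0..} (branch_pt i)"
  unfolding continuous_on_iff by (auto simp: dist_branch_pt dist_real_def)

lemma continuous_on_branch:
  assumes "continuous_on ({0..} \<times> UNIV) (u :: real \<times> ('n::finite) junction \<Rightarrow> real)"
  shows "continuous_on ({0..} \<times> {0..}) (\<lambda>(t, r). u (t, branch_pt i r))"
  unfolding case_prod_unfold
  by (rule continuous_on_compose2[OF assms])
     (auto intro!: continuous_intros continuous_on_compose2[OF continuous_on_branch_pt])

lemma continuous_on_branch_affine:
  assumes u: "continuous_on ({0..} \<times> UNIV) (u :: real \<times> ('n::finite) junction \<Rightarrow> real)"
    and "\<And>t. t \<in> I \<Longrightarrow> 0 \<le> t0 + t" "\<And>y. y \<in> Y \<Longrightarrow> 0 \<le> r0 + \<sigma> * y"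
  shows "continuous_on (I \<times> Y) (\<lambda>(t, y). u (t0 + t, branch_pt i (r0 + \<sigma> * y)))"
proof -
  have "continuous_on (I \<times> Y) (\<lambda>z. (\<lambda>(t, r). u (t, branch_pt i r)) (t0 + fst z, r0 + \<sigma> * snd z))"
    by (rule continuous_on_compose2[OF continuous_on_branch[OF u, of i]])
       (use assms(2,3) in \<open>auto intro!: continuous_intros\<close>)
  then show ?thesis by (simp add: case_prod_unfold)
qed

lemma sqrt_quadratic_bound:
  assumes "c > 0"
  shows "sqrt (c + y\<^sup>2) \<le> sqrt (c + x\<^sup>2) + x / sqrt (c + x\<^sup>2) * (y - x) + 1 / (2 * sqrt c) * (y - x)\<^sup>2"
proof -
  define s where "s = sqrt (c + x\<^sup>2)"
  have s: "s > 0" "s\<^sup>2 = c + x\<^sup>2" using assms by (auto simp: s_def add_pos_nonneg)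
  have sc: "sqrt c \<le> s" by (simp add: s_def)
  have "sqrt (c + y\<^sup>2) * s \<le> (c + y\<^sup>2 + s\<^sup>2) / 2"
  proof -
    have "0 \<le> (sqrt (c + y\<^sup>2) - s)\<^sup>2" by simp
    then show ?thesis using assms by (simp add: power2_diff)
  qed
  then have "sqrt (c + y\<^sup>2) \<le> (c + y\<^sup>2 + s\<^sup>2) / 2 / s"
    using s(1) by (subst pos_le_divide_eq) auto
  also have "(c + y\<^sup>2 + s\<^sup>2) / 2 = s\<^sup>2 + x * (y - x) + (y - x)\<^sup>2 / 2"
    using s(2) by (simp add: power2_eq_square field_simps)
  also have "(s\<^sup>2 + x * (y - x) + (y - x)\<^sup>2 / 2) / s = s + x / s * (y - x) + 1 / (2 * s) * (y - x)\<^sup>2"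
    using s(1) by (simp add: add_divide_distrib power2_eq_square)
  also have "1 / (2 * s) * (y - x)\<^sup>2 \<le> 1 / (2 * sqrt c) * (y - x)\<^sup>2"
    using sc assms by (intro mult_right_mono divide_left_mono) (auto intro!: mult_pos_pos s)
  finally show ?thesis unfolding s_def by simp
qed

lemma abs_div_sqrt_le_1: "c > 0 \<Longrightarrow> \<bar>x / sqrt (c + x\<^sup>2)\<bar> \<le> 1"
proof -
  assume "c > 0"
  then have "\<bar>x\<bar> \<le> sqrt (c + x\<^sup>2)" by (intro real_le_rsqrt) simp
  moreover have "sqrt (c + x\<^sup>2) > 0" using \<open>c > 0\<close> by (simp add: add_pos_nonneg)
  ultimately show ?thesis by (simp add: abs_divide)
qed

text \<open>
  Penalisation at infinity: it grows linearly with slope at most \<open>1\<close>, and its slope at the origin is \<open>0\<close>, so it does not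
  disturb the junction condition.
\<close>

definition penalty :: "real \<Rightarrow> real" where "penalty r = sqrt (1 + r\<^sup>2)"

lemma penalty_slope:
  assumes "0 \<le> \<theta>" "\<theta> \<le> \<delta>" "\<bar>\<sigma>\<bar> = 1"
  shows "\<exists>p. \<bar>p\<bar> \<le> \<delta> \<and> upper_slope (\<lambda>y. \<theta> * (penalty (r0 + \<sigma> * y) - c)) y p"
proof -
  define x where "x = r0 + \<sigma> * y"
  have \<sigma>2: "(\<sigma> * z)\<^sup>2 = z\<^sup>2" for z using assms(3) by (metis abs_1 abs_mult mult_1 power2_abs)
  define p where "p = \<theta> * (x / sqrt (1 + x\<^sup>2) * \<sigma>)"
  have "\<bar>p\<bar> = \<theta> * \<bar>x / sqrt (1 + x\<^sup>2)\<bar>" using assms by (simp add: p_def abs_mult)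
  also have "\<dots> \<le> \<theta> * 1" by (rule mult_left_mono[OF abs_div_sqrt_le_1]) (use assms in auto)
  finally have "\<bar>p\<bar> \<le> \<delta>" using assms by simp
  moreover have "upper_slope (\<lambda>y. \<theta> * (penalty (r0 + \<sigma> * y) - c)) y p"
  proof (rule upper_slopeI[where e = 1 and M = "\<theta> * (1/2)"])
    fix y'
    have e: "(r0 + \<sigma> * y') - x = \<sigma> * (y' - y)" by (simp add: x_def algebra_simps)
    have "penalty (r0 + \<sigma> * y') \<le> penalty x + x / sqrt (1 + x\<^sup>2) * (\<sigma> * (y' - y)) + 1/2 * (y' - y)\<^sup>2"
      using sqrt_quadratic_bound[of 1 "r0 + \<sigma> * y'" x] unfolding e \<sigma>2 penalty_def by simp
    then have "\<theta> * (penalty (r0 + \<sigma> * y') - c) \<le> \<theta> * (penalty x + x / sqrt (1 + x\<^sup>2) * (\<sigma> * (y' - y)) + 1/2 * (y' - y)\<^sup>2 - c)"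
      using assms(1) by (intro mult_left_mono) auto
    then show "\<theta> * (penalty (r0 + \<sigma> * y') - c) \<le> \<theta> * (penalty (r0 + \<sigma> * y) - c) + p * (y' - y) + \<theta> * (1/2) * (y' - y)\<^sup>2"
      by (simp add: p_def x_def algebra_simps)
  qed simp
  ultimately show ?thesis by blast
qed

lemma quadratic_subsolution_interior:
  assumes "quadratic_subsolution H F u" "0 < t" "0 < r" "upper_slope2 (\<lambda>t r. u (t, branch_pt i r)) t r a q"
  shows "a + H i q \<le> 0"
  using assms unfolding quadratic_subsolution_def by blast

lemma quadratic_subsolution_vertex:
  assumes "quadratic_subsolution H F u" "0 < t" "vertex_slope u t a q"
  shows "a + F q \<le> 0 \<or> (\<exists>i. a + H i (q $ i) \<le> 0)"
  using assms unfolding quadratic_subsolution_def by blast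

text \<open>
  A maximum with doubled time is impossible.  At the origin \<open>twin_solutions\<close> gives on each branch a common slope
  \<open>r\<^sub>i = \<beta>\<^sub>i + 2 \<delta>\<close> with \<open>-lam < H\<^sub>i(r\<^sub>i) < -a\<close>; the relaxed conditions for \<open>v\<close> and \<open>w\<close> then both reduce to the one with
  \<open>F\<close>, and they contradict each other.  Inside a branch it is applied to the right and to the left half-line,
  and \<open>w\<close> is touched from below with the forbidden slope \<open>\<alpha> - 2 \<delta>\<close>.
\<close>

lemma no_doubled_maximum:
  fixes v w :: "real \<times> ('n::finite) junction \<Rightarrow> real"
  assumes cv: "continuous_on ({0..} \<times> UNIV) v" and cw: "continuous_on ({0..} \<times> UNIV) w"
    and sv: "quadratic_subsolution H F v" and sw: "quadratic_supersolution H F w"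
    and pos: "0 < \<tau>" "\<tau> < t0" "\<tau> < s0" "0 < \<eta>" "a + \<eta> \<le> lam" "0 \<le> K" "0 < \<theta>" "\<theta> \<le> \<delta>"
    and mx: "\<And>t s x. \<bar>t\<bar> \<le> \<tau> \<Longrightarrow> \<bar>s\<bar> \<le> \<tau> \<Longrightarrow>
        v (t0 + t, x) - w (s0 + s, x) - \<theta> * (penalty (radius x) - penalty (radius x0))
          \<le> v (t0, x0) - w (s0, x0) + lam * t - a * s + K * (t\<^sup>2 + s\<^sup>2)"
    and iv: "\<And>i. \<exists>\<alpha> \<beta>. (\<forall>p. H i p \<le> - lam + \<eta>/4 \<longrightarrow> \<alpha> \<le> p \<and> p \<le> \<beta>) \<and>
        (\<forall>p. \<alpha> - 3 * \<delta> \<le> p \<longrightarrow> p \<le> \<beta> + 3 * \<delta> \<longrightarrow> H i p < - lam + \<eta>/4 + \<eta>/2)"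
  shows False
proof -
  obtain i0 r0 where x0: "0 \<le> r0" "x0 = branch_pt i0 r0" by (rule junction_cases)
  obtain \<alpha> \<beta> where ab1: "\<And>i p. H i p \<le> - lam + \<eta>/4 \<Longrightarrow> \<alpha> i \<le> p \<and> p \<le> \<beta> i"
    and ab2: "\<And>i p. \<alpha> i - 3 * \<delta> \<le> p \<Longrightarrow> p \<le> \<beta> i + 3 * \<delta> \<Longrightarrow> H i p < - lam + \<eta>/4 + \<eta>/2"
    using iv by metis
  have \<delta>: "\<delta> > 0" using pos by simp
  have twin: "\<alpha>' - 2 * \<delta> \<le> \<beta>' + 2 * \<delta> \<and>
     (\<exists>k\<ge>0. \<exists>\<rho>'>0. \<rho>' \<le> \<rho> \<and> (\<forall>t y. \<bar>t\<bar> \<le> \<tau> \<longrightarrow> 0 \<le> y \<longrightarrow> y \<le> \<rho>' \<longrightarrow>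
           v (t0 + t, branch_pt i (r0 + \<sigma> * y)) \<le> v (t0, x0) + lam * t + \<theta> * (penalty (r0 + \<sigma> * y) - penalty r0)
              + (K + 1) * t\<^sup>2 + (\<beta>' + 2 * \<delta>) * y \<and>
           w (s0, x0) + a * t - (K + 1) * t\<^sup>2 + (\<beta>' + 2 * \<delta>) * y - k * y\<^sup>2 \<le> w (s0 + t, branch_pt i (r0 + \<sigma> * y))))"
    if \<sigma>: "\<bar>\<sigma>\<bar> = 1" and \<rho>: "\<rho> > 0" and nn: "\<And>y. 0 < y \<Longrightarrow> y \<le> \<rho> \<Longrightarrow> 0 < r0 + \<sigma> * y"
      and x0i: "x0 = branch_pt i r0"
      and b1: "\<And>p. H i (\<sigma> * p) \<le> - lam + \<eta>/4 \<Longrightarrow> \<alpha>' \<le> p \<and> p \<le> \<beta>'"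
      and b2: "\<And>p. \<alpha>' - 3 * \<delta> \<le> p \<Longrightarrow> p \<le> \<beta>' + 3 * \<delta> \<Longrightarrow> H i (\<sigma> * p) < - lam + \<eta>/4 + \<eta>/2"
    for \<sigma> \<rho> i \<alpha>' \<beta>'
  proof -
    have nn0: "0 \<le> r0 + \<sigma> * y" if "y \<in> {0..\<rho>}" for y
      using nn[of y] that x0(1) by (cases "y = 0") auto
    have rad: "radius x0 = r0" using x0 by (simp add: radius_branch_pt)
    have ttp: "0 < t0 + t" "0 < s0 + t" if "\<bar>t\<bar> < \<tau>" for t using that pos by auto
    define V where "V t y = v (t0 + t, branch_pt i (r0 + \<sigma> * y))" for t y
    define W where "W t y = w (s0 + t, branch_pt i (r0 + \<sigma> * y))" for t y
    define b where "b y = \<theta> * (penalty (r0 + \<sigma> * y) - penalty r0)" for y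
    have V0: "V 0 0 = v (t0, x0)" "W 0 0 = w (s0, x0)" using x0i by (auto simp: V_def W_def)
    have cV: "continuous_on ({-\<tau>..\<tau>} \<times> {0..\<rho>}) (\<lambda>(t, y). V t y)"
      unfolding V_def by (rule continuous_on_branch_affine[OF cv]) (use pos nn0 in auto)
    have cW: "continuous_on ({-\<tau>..\<tau>} \<times> {0..\<rho>}) (\<lambda>(t, y). W t y)"
      unfolding W_def by (rule continuous_on_branch_affine[OF cw]) (use pos nn0 in auto)
    have cb: "continuous_on {0..\<rho>} b" unfolding b_def penalty_def by (intro continuous_intros)
    have b0: "b 0 = 0" by (simp add: b_def)
    have slb: "\<exists>p. \<bar>p\<bar> \<le> \<delta> \<and> upper_slope b y p" for y
      unfolding b_def by (rule penalty_slope) (use pos \<sigma> in auto)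
    have le: "V t y - W s y - b y \<le> V 0 0 - W 0 0 + lam * t - a * s + K * (t\<^sup>2 + s\<^sup>2)"
      if "\<bar>t\<bar> \<le> \<tau>" "\<bar>s\<bar> \<le> \<tau>" "0 \<le> y" "y \<le> \<rho>" for t s y
      using mx[OF that(1,2), of "branch_pt i (r0 + \<sigma> * y)"] nn0[of y] that
      by (simp add: V_def W_def b_def radius_branch_pt rad x0i[symmetric])
    have s1: "a' + H i (\<sigma> * q) \<le> 0"
      if "\<bar>t\<bar> < \<tau>" "0 < y" "y < \<rho>" "upper_slope2 V t y a' q" for t y a' q
    proof (rule quadratic_subsolution_interior[OF sv])
      show "upper_slope2 (\<lambda>t r. v (t, branch_pt i r)) (t0 + t) (r0 + \<sigma> * y) a' (\<sigma> * q)"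
        by (rule upper_slope2_affine[OF _ \<sigma>]) (use that(4) in \<open>simp add: V_def[abs_def]\<close>)
    qed (use that ttp nn in auto)
    have s2: "a' + H i (\<sigma> * q) \<ge> 0"
      if "\<bar>t\<bar> < \<tau>" "0 < y" "y < \<rho>" "upper_slope2 (\<lambda>t y. - W t y) t y (- a') (- q)" for t y a' q
    proof -
      have "- a' + - H i (- (\<sigma> * - q)) \<le> 0"
      proof (rule quadratic_subsolution_interior[OF sw[unfolded quadratic_supersolution_def]])
        show "upper_slope2 (\<lambda>t r. - w (t, branch_pt i r)) (s0 + t) (r0 + \<sigma> * y) (- a') (\<sigma> * - q)"
          by (rule upper_slope2_affine[OF _ \<sigma>]) (use that(4) in \<open>simp add: W_def[abs_def]\<close>)
      qed (use that ttp nn in auto)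
      then show ?thesis by simp
    qed
    have om: "\<eta>/4 > 0" using pos by simp
    have g1: "- lam + \<eta>/4 \<le> - lam + \<eta>/4" by simp
    have g2: "- lam + \<eta>/4 + \<eta>/2 \<le> - a - \<eta>/4" using pos(4,5) by (simp add: field_simps)
    have "\<alpha>' - 2 * \<delta> \<le> \<beta>' + 2 * \<delta>"
      by (rule twin_solutions(1)[OF pos(1) \<rho> \<delta> om pos(6) cV cW cb b0, where h = "\<lambda>p. H i (\<sigma> * p)"
            and lam = lam and a = a and c = "- lam + \<eta>/4" and \<gamma> = "\<eta>/2"])
        (rule slb, fact le, fact s1, fact s2, fact b1, fact b2, fact g1, fact g2)
    moreover have "\<exists>k\<ge>0. \<exists>\<rho>'>0. \<rho>' \<le> \<rho> \<and> (\<forall>t y. \<bar>t\<bar> \<le> \<tau> \<longrightarrow> 0 \<le> y \<longrightarrow> y \<le> \<rho>' \<longrightarrow>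
           V t y \<le> V 0 0 + lam * t + b y + (K + 1) * t\<^sup>2 + (\<beta>' + 2 * \<delta>) * y \<and>
           W 0 0 + a * t - (K + 1) * t\<^sup>2 + (\<beta>' + 2 * \<delta>) * y - k * y\<^sup>2 \<le> W t y)"
      by (rule twin_solutions(2)[OF pos(1) \<rho> \<delta> om pos(6) cV cW cb b0, where h = "\<lambda>p. H i (\<sigma> * p)"
            and lam = lam and a = a and c = "- lam + \<eta>/4" and \<gamma> = "\<eta>/2"])
        (rule slb, fact le, fact s1, fact s2, fact b1, fact b2, fact g1, fact g2)
    ultimately show ?thesis unfolding V0 unfolding V_def W_def b_def by blast
  qed
  show False
  proof (cases "r0 = 0")
    case True
    then have x0o: "x0 = origin" using x0 branch_pt_0 by metis
    have "\<forall>i. \<alpha> i - 2 * \<delta> \<le> \<beta> i + 2 * \<delta> \<and>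
     (\<exists>k\<ge>0. \<exists>\<rho>'>0. \<rho>' \<le> 1 \<and> (\<forall>t y. \<bar>t\<bar> \<le> \<tau> \<longrightarrow> 0 \<le> y \<longrightarrow> y \<le> \<rho>' \<longrightarrow>
           v (t0 + t, branch_pt i (r0 + 1 * y)) \<le> v (t0, x0) + lam * t + \<theta> * (penalty (r0 + 1 * y) - penalty r0)
              + (K + 1) * t\<^sup>2 + (\<beta> i + 2 * \<delta>) * y \<and>
           w (s0, x0) + a * t - (K + 1) * t\<^sup>2 + (\<beta> i + 2 * \<delta>) * y - k * y\<^sup>2 \<le> w (s0 + t, branch_pt i (r0 + 1 * y))))"
      by (intro allI twin) (use ab1 ab2 True x0o in \<open>auto simp: branch_pt_0\<close>)
    then obtain k \<rho> where k: "\<And>i. k i \<ge> 0" "\<And>i. \<rho> i > 0" and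
      ab: "\<And>i. \<alpha> i - 2 * \<delta> \<le> \<beta> i + 2 * \<delta>" and
      V: "\<And>i t y. \<bar>t\<bar> \<le> \<tau> \<Longrightarrow> 0 \<le> y \<Longrightarrow> y \<le> \<rho> i \<Longrightarrow> v (t0 + t, branch_pt i y) \<le> v (t0, origin) + lam * t
          + \<theta> * (penalty y - 1) + (K + 1) * t\<^sup>2 + (\<beta> i + 2 * \<delta>) * y" and
      W: "\<And>i t y. \<bar>t\<bar> \<le> \<tau> \<Longrightarrow> 0 \<le> y \<Longrightarrow> y \<le> \<rho> i \<Longrightarrow> w (s0, origin) + a * t - (K + 1) * t\<^sup>2
          + (\<beta> i + 2 * \<delta>) * y - k i * y\<^sup>2 \<le> w (s0 + t, branch_pt i y)"
      unfolding True x0o by (simp add: penalty_def) metis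
    define r where "r = (\<chi> i. \<beta> i + 2 * \<delta>)"
    define e where "e = min \<tau> (Min (range \<rho>))"
    have e: "e > 0" "e \<le> \<tau>" "\<And>i. e \<le> \<rho> i" using k(2) pos by (auto simp: e_def min.coboundedI2)
    have "vertex_slope v t0 lam r"
    proof (rule vertex_slopeI[where e = e and M = "K + 1 + \<theta>"])
      fix i t y assume t: "\<bar>t - t0\<bar> < e" and y: "0 \<le> y" "y < e"
      have "penalty y \<le> 1 + y\<^sup>2 / 2" using sqrt_quadratic_bound[of 1 y 0] by (simp add: penalty_def)
      then have "penalty y - 1 \<le> y\<^sup>2" using zero_le_power2[of y] by linarith
      then have "\<theta> * (penalty y - 1) \<le> \<theta> * y\<^sup>2" using pos by (intro mult_left_mono) auto
      moreover have "0 \<le> \<theta> * (t - t0)\<^sup>2" "0 \<le> (K + 1) * y\<^sup>2" using pos by auto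
      ultimately show "v (t, branch_pt i y) \<le> v (t0, origin) + lam * (t - t0) + r $ i * y + (K + 1 + \<theta>) * ((t - t0)\<^sup>2 + y\<^sup>2)"
        using V[of "t - t0" y i] t y e(2) e(3)[of i] unfolding r_def by (simp add: algebra_simps)
    qed (rule e)
    then have Fv: "lam + F r \<le> 0 \<or> (\<exists>i. lam + H i (r $ i) \<le> 0)"
      by (intro quadratic_subsolution_vertex[OF sv]) (use pos in auto)
    have Hr: "- lam < H i (r $ i)" "H i (r $ i) < - a" for i
    proof -
      have "\<not> H i (r $ i) \<le> - lam + \<eta>/4" using ab1[of i "r $ i"] \<delta> by (auto simp: r_def)
      then show "- lam < H i (r $ i)" using pos by simp
      have "H i (r $ i) < - lam + \<eta>/4 + \<eta>/2" using ab[of i] \<delta> by (intro ab2) (auto simp: r_def)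
      then show "H i (r $ i) < - a" using pos by simp
    qed
    have Fr: "lam + F r \<le> 0"
    proof -
      have "\<not> lam + H i (r $ i) \<le> 0" for i using Hr(1)[of i] by linarith
      then show ?thesis using Fv by blast
    qed
    have "vertex_slope (\<lambda>z. - w z) s0 (- a) (- r)"
    proof (rule vertex_slopeI[where e = e and M = "K + 1 + sum k UNIV"])
      fix i t y assume t: "\<bar>t - s0\<bar> < e" and y: "0 \<le> y" "y < e"
      have "k i \<le> sum k UNIV" using k(1) by (intro member_le_sum) auto
      then have "k i * y\<^sup>2 \<le> sum k UNIV * y\<^sup>2" by (intro mult_right_mono) auto
      moreover have "0 \<le> sum k UNIV * (t - s0)\<^sup>2" "0 \<le> (K + 1) * y\<^sup>2" using pos k(1) by (auto intro!: mult_nonneg_nonneg sum_nonneg)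
      ultimately show "- w (t, branch_pt i y) \<le> - w (s0, origin) + - a * (t - s0) + (- r) $ i * y + (K + 1 + sum k UNIV) * ((t - s0)\<^sup>2 + y\<^sup>2)"
        using W[of "t - s0" y i] t y e(2) e(3)[of i] unfolding r_def by (simp add: algebra_simps)
    qed (rule e)
    then have "- a + - F (- (- r)) \<le> 0 \<or> (\<exists>i. - a + - H i (- ((- r) $ i)) \<le> 0)"
      by (intro quadratic_subsolution_vertex[OF sw[unfolded quadratic_supersolution_def]]) (use pos in auto)
    moreover have "\<not> - a + - H i (- ((- r) $ i)) \<le> 0" for i using Hr(2)[of i] by simp
    ultimately have "- a \<le> F r" by auto
    then show False using Fr pos by simp
  next
    case False
    then have r0: "r0 > 0" using x0 by simp
    let ?i = i0
    have R: "\<alpha> ?i - 2 * \<delta> \<le> \<beta> ?i + 2 * \<delta> \<and>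
     (\<exists>k\<ge>0. \<exists>\<rho>'>0. \<rho>' \<le> r0/2 \<and> (\<forall>t y. \<bar>t\<bar> \<le> \<tau> \<longrightarrow> 0 \<le> y \<longrightarrow> y \<le> \<rho>' \<longrightarrow>
           v (t0 + t, branch_pt ?i (r0 + 1 * y)) \<le> v (t0, x0) + lam * t + \<theta> * (penalty (r0 + 1 * y) - penalty r0)
              + (K + 1) * t\<^sup>2 + (\<beta> ?i + 2 * \<delta>) * y \<and>
           w (s0, x0) + a * t - (K + 1) * t\<^sup>2 + (\<beta> ?i + 2 * \<delta>) * y - k * y\<^sup>2 \<le> w (s0 + t, branch_pt ?i (r0 + 1 * y))))"
      by (rule twin) (use ab1 ab2 r0 x0 in auto)
    have L: "- \<beta> ?i - 2 * \<delta> \<le> - \<alpha> ?i + 2 * \<delta> \<and>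
     (\<exists>k\<ge>0. \<exists>\<rho>'>0. \<rho>' \<le> r0/2 \<and> (\<forall>t y. \<bar>t\<bar> \<le> \<tau> \<longrightarrow> 0 \<le> y \<longrightarrow> y \<le> \<rho>' \<longrightarrow>
           v (t0 + t, branch_pt ?i (r0 + (-1) * y)) \<le> v (t0, x0) + lam * t + \<theta> * (penalty (r0 + (-1) * y) - penalty r0)
              + (K + 1) * t\<^sup>2 + (- \<alpha> ?i + 2 * \<delta>) * y \<and>
           w (s0, x0) + a * t - (K + 1) * t\<^sup>2 + (- \<alpha> ?i + 2 * \<delta>) * y - k * y\<^sup>2 \<le> w (s0 + t, branch_pt ?i (r0 + (-1) * y))))"
    proof (rule twin)
      show "- \<beta> ?i \<le> p \<and> p \<le> - \<alpha> ?i" if "H ?i (- 1 * p) \<le> - lam + \<eta>/4" for p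
        using ab1[OF that] by auto
      show "H ?i (- 1 * p) < - lam + \<eta>/4 + \<eta>/2" if "- \<beta> ?i - 3 * \<delta> \<le> p" "p \<le> - \<alpha> ?i + 3 * \<delta>" for p
        using ab2[of ?i "- p"] that by auto
    qed (use r0 x0 in auto)
    obtain k1 \<rho>1 where 1: "k1 \<ge> 0" "\<rho>1 > 0" "\<And>t y. \<bar>t\<bar> \<le> \<tau> \<Longrightarrow> 0 \<le> y \<Longrightarrow> y \<le> \<rho>1 \<Longrightarrow>
        w (s0, x0) + a * t - (K + 1) * t\<^sup>2 + (\<beta> ?i + 2 * \<delta>) * y - k1 * y\<^sup>2 \<le> w (s0 + t, branch_pt ?i (r0 + y))"
      using R by auto
    obtain k2 \<rho>2 where 2: "k2 \<ge> 0" "\<rho>2 > 0" "\<And>t y. \<bar>t\<bar> \<le> \<tau> \<Longrightarrow> 0 \<le> y \<Longrightarrow> y \<le> \<rho>2 \<Longrightarrow>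
        w (s0, x0) + a * t - (K + 1) * t\<^sup>2 + (- \<alpha> ?i + 2 * \<delta>) * y - k2 * y\<^sup>2 \<le> w (s0 + t, branch_pt ?i (r0 - y))"
      using L by auto
    \<comment> \<open>Any slope between \<open>\<alpha> - 2\<delta>\<close> and \<open>\<beta> + 2\<delta>\<close> serves on both sides.\<close>
    define p where "p = \<alpha> ?i - 2 * \<delta>"
    have p: "p \<le> \<beta> ?i + 2 * \<delta>" using R by (simp add: p_def)
    define M where "M = K + 1 + k1 + k2"
    have "upper_slope2 (\<lambda>t r. - w (t, branch_pt ?i r)) s0 r0 (- a) (- p)"
    proof (rule upper_slope2I[where e = "min \<tau> (min \<rho>1 \<rho>2)" and M = M])
      fix t y assume t: "\<bar>t - s0\<bar> < min \<tau> (min \<rho>1 \<rho>2)" and y: "\<bar>y - r0\<bar> < min \<tau> (min \<rho>1 \<rho>2)"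
      have M: "k1 * z\<^sup>2 \<le> M * z\<^sup>2" "k2 * z\<^sup>2 \<le> M * z\<^sup>2" "(K + 1) * z\<^sup>2 \<le> M * z\<^sup>2" for z
        unfolding M_def using 1 2 pos by (auto intro!: mult_right_mono)
      show "- w (t, branch_pt ?i y) \<le> - w (s0, branch_pt ?i r0) + - a * (t - s0) + - p * (y - r0) + M * ((t - s0)\<^sup>2 + (y - r0)\<^sup>2)"
      proof (cases "y \<ge> r0")
        case True
        have "p * (y - r0) \<le> (\<beta> ?i + 2 * \<delta>) * (y - r0)" using p True by (intro mult_right_mono) auto
        then show ?thesis using 1(3)[of "t - s0" "y - r0"] t y True M(1)[of "y - r0"] M(3)[of "t - s0"] x0
          by (simp add: distrib_left)
      next
        case False
        have "p * (y - r0) = (- \<alpha> ?i + 2 * \<delta>) * (r0 - y)" by (simp add: p_def algebra_simps)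
        moreover have "w (s0, branch_pt ?i r0) + a * (t - s0) - (K + 1) * (t - s0)\<^sup>2
            + (- \<alpha> ?i + 2 * \<delta>) * (r0 - y) - k2 * (y - r0)\<^sup>2 \<le> w (t, branch_pt ?i y)"
          using 2(3)[of "t - s0" "r0 - y"] t y False x0 by (simp add: power2_commute[of r0 y])
        ultimately show ?thesis using M(2)[of "y - r0"] M(3)[of "t - s0"] unfolding distrib_left by linarith
      qed
    qed (use pos 1 2 in auto)
    then have "- a + - H ?i (- (- p)) \<le> 0"
      by (intro quadratic_subsolution_interior[OF sw[unfolded quadratic_supersolution_def], where i = ?i]) (use pos r0 in auto)
    moreover have "H ?i p < - lam + \<eta>/4 + \<eta>/2" using p \<delta> by (intro ab2) (auto simp: p_def)
    ultimately show False using pos by simp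
  qed
qed

section \<open>The comparison principle\<close>

lemma radius_Lipschitz: "\<bar>radius x - radius y\<bar> \<le> dist x (y :: ('n::finite) junction)"
proof -
  obtain i r where x: "0 \<le> r" "x = branch_pt i r" by (rule junction_cases)
  obtain j s where y: "0 \<le> s" "y = branch_pt j s" by (rule junction_cases)
  show ?thesis using x y by (auto simp: dist_branch_pt radius_branch_pt)
qed

lemma continuous_on_radius [continuous_intros]:
  assumes "continuous_on S f"
  shows "continuous_on S (\<lambda>z. radius (f z :: ('n::finite) junction))"
proof -
  have "continuous_on UNIV (radius :: 'n junction \<Rightarrow> real)"
    unfolding continuous_on_iff by (metis dist_real_def le_less_trans radius_Lipschitz)
  then show ?thesis by (rule continuous_on_compose2[OF _ assms]) auto
qed

lemma compact_radius_le: "compact {x :: ('n::finite) junction. radius x \<le> R}"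
proof -
  have "{x :: 'n junction. radius x \<le> R} = (\<Union>i. branch_pt i ` {0..R})"
  proof (intro set_eqI iffI)
    fix x :: "'n junction" assume x: "x \<in> {x. radius x \<le> R}"
    obtain i r where r: "0 \<le> r" "x = branch_pt i r" by (rule junction_cases)
    then have "x \<in> branch_pt i ` {0..R}" using x by (auto simp: radius_branch_pt)
    then show "x \<in> (\<Union>i. branch_pt i ` {0..R})" by blast
  qed (auto simp: radius_branch_pt)
  moreover have "compact (branch_pt i ` {0..R} :: 'n junction set)" for i
    by (intro compact_continuous_image continuous_on_subset[OF continuous_on_branch_pt]) auto
  ultimately show ?thesis by (simp add: compact_UN)
qed

lemma reciprocal_quadratic_bound:
  fixes p t :: real
  assumes "\<sigma> > 0" "2 * \<sigma> \<le> p" "\<bar>t\<bar> \<le> \<sigma>"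
  shows "1 / (p - t) \<le> 1 / p + 1 / p\<^sup>2 * t + 1 / \<sigma> ^ 3 * t\<^sup>2"
proof -
  have pos: "p > 0" "p - t > 0" "p - t \<ge> \<sigma>" using assms by auto
  have "1 / (p - t) - 1 / p - 1 / p\<^sup>2 * t = 1 / ((p - t) * p\<^sup>2) * t\<^sup>2"
    using pos by (simp add: divide_simps) (simp add: power2_eq_square algebra_simps)
  also have "\<dots> \<le> 1 / \<sigma> ^ 3 * t\<^sup>2"
  proof (intro mult_right_mono divide_left_mono)
    have "\<sigma>\<^sup>2 \<le> p\<^sup>2" using assms by (intro power_mono) auto
    then have "\<sigma> * \<sigma>\<^sup>2 \<le> (p - t) * p\<^sup>2" using pos assms by (intro mult_mono) auto
    then show "\<sigma> ^ 3 \<le> (p - t) * p\<^sup>2" by (simp add: power3_eq_cube power2_eq_square)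
  qed (use pos assms in auto)
  finally show ?thesis by simp
qed

lemma uniform_sublevel_interval:
  fixes H :: "'n::finite \<Rightarrow> real \<Rightarrow> real"
  assumes "\<And>i. continuous_on UNIV (H i)" "\<And>i. quasi_convex (H i)" "\<And>i. coercive (H i)" "\<gamma> > 0"
  shows "\<exists>\<delta>>0. \<forall>i. \<forall>c\<le>C. \<exists>\<alpha> \<beta>. (\<forall>p. H i p \<le> c \<longrightarrow> \<alpha> \<le> p \<and> p \<le> \<beta>) \<and>
           (\<forall>p. \<alpha> - 3 * \<delta> \<le> p \<longrightarrow> p \<le> \<beta> + 3 * \<delta> \<longrightarrow> H i p < c + \<gamma>)"
proof -
  have "\<forall>i. \<exists>\<delta>>0. \<forall>c\<le>C. \<exists>\<alpha> \<beta>. (\<forall>p. H i p \<le> c \<longrightarrow> \<alpha> \<le> p \<and> p \<le> \<beta>) \<and>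
           (\<forall>p. \<alpha> - 3 * \<delta> \<le> p \<longrightarrow> p \<le> \<beta> + 3 * \<delta> \<longrightarrow> H i p < c + \<gamma>)"
    by (intro allI sublevel_interval assms)
  then obtain d where d: "\<And>i. d i > 0" "\<And>i c. c \<le> C \<Longrightarrow> \<exists>\<alpha> \<beta>. (\<forall>p. H i p \<le> c \<longrightarrow> \<alpha> \<le> p \<and> p \<le> \<beta>) \<and>
           (\<forall>p. \<alpha> - 3 * d i \<le> p \<longrightarrow> p \<le> \<beta> + 3 * d i \<longrightarrow> H i p < c + \<gamma>)"
    by metis
  define \<delta> where "\<delta> = Min (range d)"
  have \<delta>: "\<delta> > 0" "\<And>i. \<delta> \<le> d i" using d(1) by (auto simp: \<delta>_def)
  show ?thesis
  proof (rule exI[of _ \<delta>], intro conjI allI impI \<delta>(1))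
    fix i c assume "c \<le> C"
    then obtain \<alpha> \<beta> where "\<And>p. H i p \<le> c \<Longrightarrow> \<alpha> \<le> p \<and> p \<le> \<beta>"
      "\<And>p. \<alpha> - 3 * d i \<le> p \<Longrightarrow> p \<le> \<beta> + 3 * d i \<Longrightarrow> H i p < c + \<gamma>"
      using d(2) by metis
    then show "\<exists>\<alpha> \<beta>. (\<forall>p. H i p \<le> c \<longrightarrow> \<alpha> \<le> p \<and> p \<le> \<beta>) \<and>
           (\<forall>p. \<alpha> - 3 * \<delta> \<le> p \<longrightarrow> p \<le> \<beta> + 3 * \<delta> \<longrightarrow> H i p < c + \<gamma>)"
      using \<delta>(2)[of i] by (intro exI[of _ \<alpha>] exI[of _ \<beta>]) auto
  qed
qed

text \<open>
  The time penalty \<open>\<mu>/(T - t)\<close> has a derivative bounded below, which separates the two time derivatives by \<open>\<eta>\<close>, and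
  keeps the maximum away from the final time.  The Lipschitz bound in time yields \<open>\<bar>t\<^sub>0 - s\<^sub>0\<bar> \<le> 2 \<epsilon> \<Lambda>\<close> and
  \<open>\<bar>a\<bar> \<le> 2 \<Lambda>\<close> for every \<open>\<epsilon>\<close>, so the weight \<open>\<theta>\<close> of the penalisation at infinity can be fixed before \<open>\<epsilon>\<close>.  Then the
  maximum points stay in a fixed compact set, where the initial inequality persists uniformly for short times.
\<close>

theorem comparison:
  fixes v w :: "real \<times> ('n::finite) junction \<Rightarrow> real" and H :: "'n \<Rightarrow> real \<Rightarrow> real"
  assumes H: "\<And>i. continuous_on UNIV (H i)" "\<And>i. quasi_convex (H i)" "\<And>i. coercive (H i)"
    and cv: "continuous_on ({0..} \<times> UNIV) v" and cw: "continuous_on ({0..} \<times> UNIV) w"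
    and sv: "quadratic_subsolution H F v" and sw: "quadratic_supersolution H F w"
    and init: "\<And>x. v (0, x) \<le> w (0, x)"
    and bnd: "\<And>T. \<exists>C. \<forall>t\<in>{0..T}. \<forall>s\<in>{0..T}. \<forall>x. v (t, x) - w (s, x) \<le> C"
    and L: "L \<ge> 0" "(\<forall>t\<ge>0. \<forall>s\<ge>0. \<forall>x. \<bar>v (t, x) - v (s, x)\<bar> \<le> L * \<bar>t - s\<bar>) \<or>
                    (\<forall>t\<ge>0. \<forall>s\<ge>0. \<forall>x. \<bar>w (t, x) - w (s, x)\<bar> \<le> L * \<bar>t - s\<bar>)"
    and "t1 \<ge> 0"
  shows "v (t1, x1) \<le> w (t1, x1)"
proof (rule ccontr)
  assume "\<not> ?thesis"
  define m where "m = v (t1, x1) - w (t1, x1)"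
  have m: "m > 0" using \<open>\<not> v (t1, x1) \<le> w (t1, x1)\<close> by (simp add: m_def)
  have t1: "t1 > 0" using m init[of x1] \<open>t1 \<ge> 0\<close> by (cases "t1 = 0") (auto simp: m_def)
  define T where "T = t1 + 1"
  obtain C0 where C0: "\<And>t s x. t \<in> {0..T} \<Longrightarrow> s \<in> {0..T} \<Longrightarrow> v (t, x) - w (s, x) \<le> C0"
    using bnd[of T] by blast
  define C where "C = max 0 C0"
  have C: "C \<ge> 0" by (simp add: C_def)
  have C2: "v (t, x) - w (s, x) \<le> C" if "t \<in> {0..T}" "s \<in> {0..T}" for t s x
    using C0[OF that, of x] by (simp add: C_def)
  define \<mu> where "\<mu> = m / 4"
  have \<mu>: "\<mu> > 0" using m by (simp add: \<mu>_def)
  define \<kappa> where "\<kappa> t = \<mu> / (T - t)" for t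
  \<comment> \<open>The penalty \<open>\<kappa>\<close> exceeds \<open>C\<close> on \<open>[T - 2\<sigma>, T)\<close>, so the maximum lies before \<open>T - 2\<sigma>\<close>.\<close>
  define \<sigma> where "\<sigma> = min (1/4) (\<mu> / (4 * (C + 1)))"
  have \<sigma>: "\<sigma> > 0" "\<sigma> \<le> 1/4" "\<sigma> \<le> \<mu> / (4 * (C + 1))" using \<mu> C unfolding \<sigma>_def by (simp, linarith, linarith)
  have \<sigma>C: "2 * \<sigma> * C < \<mu>"
  proof -
    have "\<sigma> * (4 * (C + 1)) \<le> \<mu>" using \<sigma>(3) C by (simp add: pos_le_divide_eq)
    moreover have "2 * \<sigma> * C \<le> \<sigma> * (4 * (C + 1)) - 4 * \<sigma>" using \<sigma>(1) C by (simp add: algebra_simps)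
    ultimately show ?thesis using \<sigma>(1) by linarith
  qed
  define I where "I = {0..T - \<sigma>}"
  have IT: "t \<in> {0..T}" "T - t \<ge> \<sigma>" if "t \<in> I" for t using that \<sigma> by (auto simp: I_def)
  have t1I: "t1 \<in> I" using t1 \<sigma> by (auto simp: I_def T_def)
  define \<eta> where "\<eta> = \<mu> / T\<^sup>2"
  have T: "T > 1" using t1 by (simp add: T_def)
  have \<eta>: "\<eta> > 0" using \<mu> T by (simp add: \<eta>_def)
  define D where "D = \<mu> / \<sigma>\<^sup>2"
  have D: "D > 0" using \<mu> \<sigma> by (simp add: D_def)
  have \<kappa>_lip: "\<bar>\<kappa> t - \<kappa> s\<bar> \<le> D * \<bar>t - s\<bar>" if "t \<in> I" "s \<in> I" for t s
  proof -
    have ne: "T - t > 0" "T - s > 0" "T - t \<ge> \<sigma>" "T - s \<ge> \<sigma>" using IT[OF that(1)] IT[OF that(2)] \<sigma> by auto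
    have "\<kappa> t - \<kappa> s = \<mu> * (t - s) / ((T - t) * (T - s))"
      using ne by (simp add: \<kappa>_def divide_simps) (simp add: algebra_simps)
    then have "\<bar>\<kappa> t - \<kappa> s\<bar> = \<mu> * \<bar>t - s\<bar> / ((T - t) * (T - s))"
      using ne \<mu> by (simp add: abs_mult)
    also have "\<dots> \<le> \<mu> * \<bar>t - s\<bar> / (\<sigma> * \<sigma>)"
      using ne \<mu> \<sigma> by (intro divide_left_mono mult_mono mult_pos_pos) auto
    finally show ?thesis by (simp add: D_def power2_eq_square)
  qed
  have \<kappa>1: "\<kappa> t1 = m / 4" by (simp add: \<kappa>_def T_def \<mu>_def)
  have \<kappa>0: "\<kappa> t > 0" if "t \<in> I" for t using IT(2)[OF that] \<mu> \<sigma> by (simp add: \<kappa>_def)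
  define \<Lambda> where "\<Lambda> = L + D"
  have \<Lambda>: "\<Lambda> > 0" using L D by (simp add: \<Lambda>_def)
  obtain \<delta> where \<delta>: "\<delta> > 0" and iv: "\<And>i c. c \<le> 2 * \<Lambda> + \<eta> \<Longrightarrow> \<exists>\<alpha> \<beta>. (\<forall>p. H i p \<le> c \<longrightarrow> \<alpha> \<le> p \<and> p \<le> \<beta>) \<and>
           (\<forall>p. \<alpha> - 3 * \<delta> \<le> p \<longrightarrow> p \<le> \<beta> + 3 * \<delta> \<longrightarrow> H i p < c + \<eta>/2)"
    using uniform_sublevel_interval[where H = H and \<gamma> = "\<eta>/2" and C = "2 * \<Lambda> + \<eta>"] H \<eta> by (metis half_gt_zero)
  have pen1: "penalty r \<ge> 1" "penalty r \<ge> \<bar>r\<bar>" for r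
    by (auto simp: penalty_def intro!: real_le_rsqrt)
  \<comment> \<open>Slopes are shifted by at most \<open>\<delta>\<close>, and the value \<open>m\<close> at \<open>(t1, x1)\<close> is reduced by at most \<open>m/8\<close>.\<close>
  define \<theta> where "\<theta> = min \<delta> (m / (8 * penalty (radius x1)))"
  have \<theta>: "\<theta> > 0" "\<theta> \<le> \<delta>" "\<theta> * penalty (radius x1) \<le> m / 8"
  proof -
    have p: "penalty (radius x1) > 0" using pen1(1)[of "radius x1"] by linarith
    show "\<theta> > 0" "\<theta> \<le> \<delta>" using \<delta> m p by (auto simp: \<theta>_def)
    have "\<theta> * penalty (radius x1) \<le> m / (8 * penalty (radius x1)) * penalty (radius x1)"
      using p by (intro mult_right_mono) (auto simp: \<theta>_def)
    then show "\<theta> * penalty (radius x1) \<le> m / 8" using p by simp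
  qed
  \<comment> \<open>Beyond radius \<open>R\<close> the penalty outweighs the bound \<open>C\<close>.\<close>
  define R where "R = max (radius x1) (C / \<theta>)"
  define B where "B = {x :: 'n junction. radius x \<le> R}"
  have cB: "compact B" unfolding B_def by (rule compact_radius_le)
  have x1B: "x1 \<in> B" by (simp add: B_def R_def)
  have sub1: "({0..1} \<times> B) \<subseteq> {0..} \<times> UNIV" by auto
  have m4: "m / 4 > 0" using m by simp
  have "uniformly_continuous_on ({0..1} \<times> B) (\<lambda>z. v z - w z)"
    by (intro compact_uniformly_continuous continuous_on_diff continuous_on_subset[OF cv sub1]
        continuous_on_subset[OF cw sub1] compact_Times cB compact_Icc)
  then obtain d0 where d0: "d0 > 0" "\<And>z z'. z \<in> {0..1} \<times> B \<Longrightarrow> z' \<in> {0..1} \<times> B \<Longrightarrow> dist z' z < d0 \<Longrightarrow>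
      dist (v z' - w z') (v z - w z) < m / 4"
    using m4 unfolding uniformly_continuous_on_def by blast
  have near0: "v (t, x) - w (t, x) < m / 4" if "0 \<le> t" "t < d0" "t \<le> 1" "x \<in> B" for t x
  proof -
    have "\<bar>v (t, x) - w (t, x) - (v (0, x) - w (0, x))\<bar> < m / 4"
      using d0(2)[of "(0, x)" "(t, x)"] that by (auto simp: dist_Pair_Pair dist_real_def)
    then show ?thesis using init[of x] by linarith
  qed
  define d where "d = min (d0 / 2) (min (\<sigma> / 2) (m / (8 * (L + 1))))"
  have d: "d > 0" "d < d0" "d < \<sigma>" "L * d \<le> m / 8"
  proof -
    show "d > 0" using d0(1) \<sigma> m L(1) by (simp add: d_def)
    have "d \<le> d0 / 2" "d \<le> \<sigma> / 2" unfolding d_def by (linarith, linarith)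
    then show "d < d0" "d < \<sigma>" using d0(1) \<sigma>(1) by auto
    have "L * d \<le> (L + 1) * (m / (8 * (L + 1)))"
      using L(1) \<open>d > 0\<close> by (intro mult_mono) (auto simp: d_def)
    moreover have "x * (m / (8 * x)) = m / 8" if "x \<noteq> 0" for x :: real using that by simp
    from this[of "L + 1"] have "(L + 1) * (m / (8 * (L + 1))) = m / 8" using L(1) by linarith
    ultimately show "L * d \<le> m / 8" by linarith
  qed
  \<comment> \<open>\<open>\<epsilon>\<close> is chosen last; the time distance of the maximum point will be at most \<open>2 \<epsilon> \<Lambda> = d\<close>.\<close>
  define \<epsilon> where "\<epsilon> = d / (2 * \<Lambda>)"
  have \<epsilon>: "\<epsilon> > 0" "2 * \<epsilon> * \<Lambda> = d" using d \<Lambda> by (auto simp: \<epsilon>_def)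
  define \<Phi> where "\<Phi> t s x = v (t, x) - w (s, x) - (t - s)\<^sup>2 / (2 * \<epsilon>) - \<kappa> t - \<theta> * penalty (radius x)" for t s x
  have "continuous_on (I \<times> I \<times> B) (\<lambda>z. \<Phi> (fst z) (fst (snd z)) (snd (snd z)))"
  proof -
    have "continuous_on (I \<times> I \<times> B) (\<lambda>z. v (fst z, snd (snd z)))"
      by (rule continuous_on_compose2[OF cv]) (auto intro!: continuous_intros simp: I_def)
    moreover have "continuous_on (I \<times> I \<times> B) (\<lambda>z. w (fst (snd z), snd (snd z)))"
      by (rule continuous_on_compose2[OF cw]) (auto intro!: continuous_intros simp: I_def)
    moreover have "continuous_on (I \<times> I \<times> B) (\<lambda>z. \<kappa> (fst z))"
      unfolding \<kappa>_def using IT(2) \<sigma>(1) by (intro continuous_intros) force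
    ultimately show ?thesis unfolding \<Phi>_def penalty_def
      by (intro continuous_intros) (use \<epsilon> in auto)
  qed
  moreover have "compact (I \<times> I \<times> B)" by (auto simp: I_def intro!: compact_Times cB)
  moreover have "I \<times> I \<times> B \<noteq> {}" using t1I x1B by auto
  ultimately obtain z where z: "z \<in> I \<times> I \<times> B"
    "\<And>z'. z' \<in> I \<times> I \<times> B \<Longrightarrow> \<Phi> (fst z') (fst (snd z')) (snd (snd z')) \<le> \<Phi> (fst z) (fst (snd z)) (snd (snd z))"
    using continuous_attains_sup by (metis (no_types, lifting))
  obtain t0 s0 x0 where "z = (t0, s0, x0)" by (cases z)
  with z have t0: "t0 \<in> I" and s0: "s0 \<in> I" and x0: "x0 \<in> B"
    and mxB: "\<And>t s x. t \<in> I \<Longrightarrow> s \<in> I \<Longrightarrow> x \<in> B \<Longrightarrow> \<Phi> t s x \<le> \<Phi> t0 s0 x0" by auto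
  have \<Phi>1: "\<Phi> t1 t1 x1 \<ge> m / 2" using \<theta>(3) \<kappa>1 m by (simp add: \<Phi>_def m_def)
  then have big: "\<Phi> t0 s0 x0 \<ge> m / 2" using mxB[OF t1I t1I x1B] by linarith
  have mx: "\<Phi> t s x \<le> \<Phi> t0 s0 x0" if "t \<in> I" "s \<in> I" for t s x
  proof (cases "x \<in> B")
    case False
    then have "radius x > C / \<theta>" by (auto simp: B_def R_def)
    then have "C < \<theta> * radius x" using \<theta> by (simp add: field_simps)
    also have "\<dots> \<le> \<theta> * penalty (radius x)" using \<theta> pen1(2)[of "radius x"] by (intro mult_left_mono) auto
    finally have "\<Phi> t s x < 0"
      using C2[OF IT(1)[OF that(1)] IT(1)[OF that(2)], of x] \<kappa>0[OF that(1)] \<epsilon>(1) unfolding \<Phi>_def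
      by (smt (verit) divide_nonneg_pos zero_le_power2)
    then show ?thesis using big m by linarith
  qed (use mxB that in auto)
  have pen0: "\<theta> * penalty (radius x0) \<ge> 0" using \<theta> pen1(1)[of "radius x0"] by simp
  have \<kappa>t0: "\<kappa> t0 < C" 
    using big C2[OF IT(1)[OF t0] IT(1)[OF s0], of x0] pen0 m \<epsilon>(1) unfolding \<Phi>_def
    by (smt (verit) divide_nonneg_pos zero_le_power2 field_sum_of_halves)
  have t0T: "T - t0 > 2 * \<sigma>"
  proof (rule ccontr)
    assume "\<not> ?thesis"
    moreover have p: "T - t0 > 0" using IT(2)[OF t0] \<sigma> by simp
    ultimately have "C * (T - t0) \<le> C * (2 * \<sigma>)" using C by (intro mult_left_mono) auto
    moreover have "\<mu> < C * (T - t0)" using \<kappa>t0 p by (simp add: \<kappa>_def pos_divide_less_eq)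
    ultimately show False using \<sigma>C by (simp add: algebra_simps)
  qed
  \<comment> \<open>Compare the maximum with the same point with equal times, moving the time in which the function is Lipschitz.\<close>
  have quad: "(t0 - s0)\<^sup>2 / (2 * \<epsilon>) \<le> \<Lambda> * \<bar>t0 - s0\<bar>"
    using L(2)
  proof
    assume "\<forall>t\<ge>0. \<forall>s\<ge>0. \<forall>x. \<bar>v (t, x) - v (s, x)\<bar> \<le> L * \<bar>t - s\<bar>"
    then have "\<bar>v (t0, x0) - v (s0, x0)\<bar> \<le> L * \<bar>t0 - s0\<bar>" using t0 s0 by (simp add: I_def)
    moreover have "\<Phi> s0 s0 x0 \<le> \<Phi> t0 s0 x0" by (rule mx[OF s0 s0])
    ultimately show ?thesis using \<kappa>_lip[OF t0 s0] by (simp add: \<Phi>_def \<Lambda>_def distrib_right)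
  next
    assume "\<forall>t\<ge>0. \<forall>s\<ge>0. \<forall>x. \<bar>w (t, x) - w (s, x)\<bar> \<le> L * \<bar>t - s\<bar>"
    then have "\<bar>w (t0, x0) - w (s0, x0)\<bar> \<le> L * \<bar>t0 - s0\<bar>" using t0 s0 by (simp add: I_def)
    moreover have "\<Phi> t0 t0 x0 \<le> \<Phi> t0 s0 x0" by (rule mx[OF t0 t0])
    moreover have "0 \<le> D * \<bar>t0 - s0\<bar>" using D by simp
    ultimately show ?thesis by (simp add: \<Phi>_def \<Lambda>_def distrib_right)
  qed
  have close: "\<bar>t0 - s0\<bar> \<le> d"
  proof (cases "t0 = s0")
    case False
    have "(t0 - s0)\<^sup>2 \<le> \<Lambda> * \<bar>t0 - s0\<bar> * (2 * \<epsilon>)"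
      using quad \<epsilon>(1) by (subst (asm) pos_divide_le_eq) auto
    also have "\<dots> = d * \<bar>t0 - s0\<bar>" unfolding \<epsilon>(2)[symmetric] by (simp add: mult_ac)
    finally have "\<bar>t0 - s0\<bar> * \<bar>t0 - s0\<bar> \<le> d * \<bar>t0 - s0\<bar>" by (simp add: power2_eq_square)
    then show ?thesis by (rule mult_right_le_imp_le) (use False in simp)
  qed (use d in auto)
  define a where "a = (t0 - s0) / \<epsilon>"
  have a: "\<bar>a\<bar> \<le> 2 * \<Lambda>"
  proof -
    have "\<bar>a\<bar> = \<bar>t0 - s0\<bar> / \<epsilon>" using \<epsilon>(1) by (simp add: a_def)
    also have "\<dots> \<le> d / \<epsilon>" using close \<epsilon>(1) by (intro divide_right_mono) auto
    also have "\<dots> = 2 * \<Lambda>" using \<epsilon> by (auto simp: field_simps)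
    finally show ?thesis .
  qed
  have diff_big: "v (t0, x0) - w (s0, x0) \<ge> m / 2"
    using big pen0 \<kappa>0[OF t0] \<epsilon>(1) unfolding \<Phi>_def by (smt (verit) divide_nonneg_pos zero_le_power2)
  have not0: "t0 > 0 \<and> s0 > 0"
  proof (rule ccontr)
    assume "\<not> ?thesis"
    then have "t0 = 0 \<or> s0 = 0" using t0 s0 by (auto simp: I_def)
    then have ts: "0 \<le> t0" "t0 < d0" "t0 \<le> 1" "0 \<le> s0" "s0 < d0" "s0 \<le> 1"
      using close d \<sigma> t0 s0 by (auto simp: I_def)
    have Ld: "L * \<bar>t0 - s0\<bar> \<le> m / 8" using mult_left_mono[OF close L(1)] d(4) by linarith
    from L(2) show False
    proof
      assume "\<forall>t\<ge>0. \<forall>s\<ge>0. \<forall>x. \<bar>v (t, x) - v (s, x)\<bar> \<le> L * \<bar>t - s\<bar>"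
      then have "\<bar>v (t0, x0) - v (s0, x0)\<bar> \<le> L * \<bar>t0 - s0\<bar>" using ts by simp
      then show False using near0[OF ts(4,5,6) x0] Ld diff_big m by linarith
    next
      assume "\<forall>t\<ge>0. \<forall>s\<ge>0. \<forall>x. \<bar>w (t, x) - w (s, x)\<bar> \<le> L * \<bar>t - s\<bar>"
      then have "\<bar>w (t0, x0) - w (s0, x0)\<bar> \<le> L * \<bar>t0 - s0\<bar>" using ts by simp
      then show False using near0[OF ts(1,2,3) x0] Ld diff_big m by linarith
    qed
  qed
  define p where "p = T - t0"
  have p: "p > 2 * \<sigma>" "p \<le> T" using t0T t0 by (auto simp: p_def I_def)
  define lam where "lam = a + \<mu> / p\<^sup>2"
  have lam: "a + \<eta> \<le> lam"
  proof -
    have "p\<^sup>2 \<le> T\<^sup>2" using p \<sigma> by (intro power_mono) auto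
    then show ?thesis using \<mu> p \<sigma> unfolding lam_def \<eta>_def
      by (intro add_left_mono divide_left_mono) (auto intro!: mult_pos_pos)
  qed
  define \<tau> where "\<tau> = min (min t0 s0) (\<sigma> - d) / 2"
  have \<tau>: "\<tau> > 0" "\<tau> < t0" "\<tau> < s0" "\<tau> < \<sigma> - d" using not0 d by (auto simp: \<tau>_def min_def)
  define K where "K = 1 / \<epsilon> + \<mu> / \<sigma> ^ 3"
  have K: "K \<ge> 0" using \<epsilon> \<mu> \<sigma> by (simp add: K_def)
  show False
  proof (rule no_doubled_maximum[OF cv cw sv sw \<tau>(1-3) \<eta> lam K \<theta>(1,2)])
    fix t s :: real and x :: "'n junction" assume t: "\<bar>t\<bar> \<le> \<tau>" and s: "\<bar>s\<bar> \<le> \<tau>"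
    have tI: "t0 + t \<in> I" "s0 + s \<in> I" using t s \<tau> not0 t0T close \<sigma> d by (auto simp: I_def)
    have "\<Phi> (t0 + t) (s0 + s) x \<le> \<Phi> t0 s0 x0" by (rule mx[OF tI])
    moreover have "\<kappa> (t0 + t) \<le> \<kappa> t0 + \<mu> / p\<^sup>2 * t + \<mu> / \<sigma> ^ 3 * t\<^sup>2"
    proof -
      have "1 / (p - t) \<le> 1 / p + 1 / p\<^sup>2 * t + 1 / \<sigma> ^ 3 * t\<^sup>2"
        using p t \<tau> d \<sigma> by (intro reciprocal_quadratic_bound) auto
      then have "\<mu> * (1 / (p - t)) \<le> \<mu> * (1 / p + 1 / p\<^sup>2 * t + 1 / \<sigma> ^ 3 * t\<^sup>2)"
        using \<mu> by (intro mult_left_mono) auto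
      then show ?thesis by (simp add: \<kappa>_def p_def algebra_simps)
    qed
    moreover have "(t0 + t - (s0 + s))\<^sup>2 / (2 * \<epsilon>) \<le> (t0 - s0)\<^sup>2 / (2 * \<epsilon>) + a * t - a * s + 1 / \<epsilon> * (t\<^sup>2 + s\<^sup>2)"
    proof -
      have "(t0 + t - (s0 + s))\<^sup>2 / (2 * \<epsilon>) = ((t0 - s0)\<^sup>2 + 2 * (t0 - s0) * (t - s) + (t - s)\<^sup>2) / (2 * \<epsilon>)"
        by (simp add: power2_eq_square algebra_simps)
      also have "\<dots> \<le> ((t0 - s0)\<^sup>2 + 2 * (t0 - s0) * (t - s) + 2 * (t\<^sup>2 + s\<^sup>2)) / (2 * \<epsilon>)"
      proof (intro divide_right_mono add_left_mono)
        have "0 \<le> (t + s)\<^sup>2" by simp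
        then show "(t - s)\<^sup>2 \<le> 2 * (t\<^sup>2 + s\<^sup>2)" by (simp add: power2_eq_square algebra_simps)
      qed (use \<epsilon> in auto)
      also have "\<dots> = (t0 - s0)\<^sup>2 / (2 * \<epsilon>) + a * t - a * s + 1 / \<epsilon> * (t\<^sup>2 + s\<^sup>2)"
        using \<epsilon>(1) by (simp add: a_def field_simps)
      finally show ?thesis .
    qed
    moreover have "0 \<le> \<mu> / \<sigma> ^ 3 * s\<^sup>2" using \<mu> \<sigma> by simp
    ultimately show "v (t0 + t, x) - w (s0 + s, x) - \<theta> * (penalty (radius x) - penalty (radius x0))
        \<le> v (t0, x0) - w (s0, x0) + lam * t - a * s + K * (t\<^sup>2 + s\<^sup>2)"
      unfolding \<Phi>_def K_def lam_def right_diff_distrib distrib_right distrib_left by linarith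
  next
    fix i
    have "- lam + \<eta>/4 \<le> 2 * \<Lambda> + \<eta>" using a lam \<eta> by linarith
    from iv[OF this, of i] show "\<exists>\<alpha> \<beta>. (\<forall>p. H i p \<le> - lam + \<eta>/4 \<longrightarrow> \<alpha> \<le> p \<and> p \<le> \<beta>) \<and>
        (\<forall>p. \<alpha> - 3 * \<delta> \<le> p \<longrightarrow> p \<le> \<beta> + 3 * \<delta> \<longrightarrow> H i p < - lam + \<eta>/4 + \<eta>/2)" .
  qed
qed

section \<open>Contact points and stability\<close>

text \<open>
  A derivative together with a one-sided quadratic remainder: contact with \<open>g\<close> from below then yields
  a quadratic test function of slope \<open>g'\<close>.
\<close>

definition semiconcave_on :: "real set \<Rightarrow> (real \<Rightarrow> real) \<Rightarrow> (real \<Rightarrow> real) \<Rightarrow> bool" where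
  "semiconcave_on S g g' \<longleftrightarrow> (\<exists>M\<ge>0. \<forall>x\<in>S. \<forall>y\<in>S. g y \<le> g x + g' x * (y - x) + M * (y - x)\<^sup>2)"

lemma semiconcave_onI:
  "M \<ge> 0 \<Longrightarrow> (\<And>x y. x \<in> S \<Longrightarrow> y \<in> S \<Longrightarrow> g y \<le> g x + g' x * (y - x) + M * (y - x)\<^sup>2) \<Longrightarrow> semiconcave_on S g g'"
  unfolding semiconcave_on_def by blast

lemma semiconcave_quadratic:
  assumes "M \<ge> 0"
  shows "semiconcave_on S (\<lambda>y. a * (y - x0) + M * (y - x0)\<^sup>2) (\<lambda>y. a + 2 * M * (y - x0))"
  by (rule semiconcave_onI[OF assms]) (simp add: power2_eq_square algebra_simps)

lemma semiconcave_sqrt: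
  assumes "b \<ge> 0" "\<delta> > 0"
  shows "semiconcave_on S (\<lambda>y. a * (y - x0) + b * sqrt (\<delta>\<^sup>2 + (y - x0)\<^sup>2))
           (\<lambda>y. a + b * ((y - x0) / sqrt (\<delta>\<^sup>2 + (y - x0)\<^sup>2)))"
proof (rule semiconcave_onI[of "b * (1 / (2 * \<delta>))"])
  fix x y
  have "sqrt (\<delta>\<^sup>2 + (y - x0)\<^sup>2) \<le> sqrt (\<delta>\<^sup>2 + (x - x0)\<^sup>2) + (x - x0) / sqrt (\<delta>\<^sup>2 + (x - x0)\<^sup>2) * (y - x)
      + 1 / (2 * \<delta>) * (y - x)\<^sup>2"
    using sqrt_quadratic_bound[of "\<delta>\<^sup>2" "y - x0" "x - x0"] assms by simp
  from mult_left_mono[OF this assms(1)]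
  have "b * sqrt (\<delta>\<^sup>2 + (y - x0)\<^sup>2) \<le> b * (sqrt (\<delta>\<^sup>2 + (x - x0)\<^sup>2)
      + (x - x0) / sqrt (\<delta>\<^sup>2 + (x - x0)\<^sup>2) * (y - x) + 1 / (2 * \<delta>) * (y - x)\<^sup>2)" .
  moreover have "a * (y - x0) = a * (x - x0) + a * (y - x)" by (simp add: algebra_simps)
  ultimately show "a * (y - x0) + b * sqrt (\<delta>\<^sup>2 + (y - x0)\<^sup>2) \<le> a * (x - x0) + b * sqrt (\<delta>\<^sup>2 + (x - x0)\<^sup>2)
     + (a + b * ((x - x0) / sqrt (\<delta>\<^sup>2 + (x - x0)\<^sup>2))) * (y - x) + b * (1 / (2 * \<delta>)) * (y - x)\<^sup>2"
    unfolding distrib_left distrib_right mult.assoc by linarith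
qed (use assms in auto)

text \<open>
  A strict inequality on the boundary of a box forces an interior contact point, where the inequality of the subsolution
  holds with the derivatives of the test functions.
\<close>

lemma contact_interior:
  fixes z :: "real \<times> ('n::finite) junction \<Rightarrow> real"
  assumes cz: "continuous_on ({0..} \<times> UNIV) z" and sz: "quadratic_subsolution H F z"
    and pos: "0 < \<rho>" "\<rho> < t0" "\<rho> < r0"
    and f: "semiconcave_on {t0-\<rho>..t0+\<rho>} f f'" "continuous_on {t0-\<rho>..t0+\<rho>} f"
    and g: "semiconcave_on {r0-\<rho>..r0+\<rho>} g g'" "continuous_on {r0-\<rho>..r0+\<rho>} g"
    and bd: "\<And>t r. \<bar>t - t0\<bar> \<le> \<rho> \<Longrightarrow> \<bar>r - r0\<bar> \<le> \<rho> \<Longrightarrow> \<bar>t - t0\<bar> = \<rho> \<or> \<bar>r - r0\<bar> = \<rho> \<Longrightarrow>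
        z (t, branch_pt i r) - f t - g r < z (t0, branch_pt i r0) - f t0 - g r0"
  shows "\<exists>t r. \<bar>t - t0\<bar> < \<rho> \<and> \<bar>r - r0\<bar> < \<rho> \<and> f' t + H i (g' r) \<le> 0"
proof -
  let ?I = "{t0-\<rho>..t0+\<rho>}" and ?J = "{r0-\<rho>..r0+\<rho>}"
  have "continuous_on (?I \<times> ?J) (\<lambda>(t, r). z (t, branch_pt i r))"
    by (rule continuous_on_subset[OF continuous_on_branch[OF cz]]) (use pos in auto)
  moreover have "continuous_on (?I \<times> ?J) (\<lambda>w. f (fst w))" "continuous_on (?I \<times> ?J) (\<lambda>w. g (snd w))"
    by (rule continuous_on_compose2[OF f(2)], auto intro!: continuous_intros)
       (rule continuous_on_compose2[OF g(2)], auto intro!: continuous_intros)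
  ultimately have "continuous_on (?I \<times> ?J) (\<lambda>w. z (fst w, branch_pt i (snd w)) - f (fst w) - g (snd w))"
    by (intro continuous_on_diff) (auto simp: case_prod_unfold)
  moreover have "compact (?I \<times> ?J)" "?I \<times> ?J \<noteq> {}" using pos by (auto simp: compact_Times)
  ultimately obtain w where w: "w \<in> ?I \<times> ?J" "\<And>w'. w' \<in> ?I \<times> ?J \<Longrightarrow>
     z (fst w', branch_pt i (snd w')) - f (fst w') - g (snd w') \<le> z (fst w, branch_pt i (snd w)) - f (fst w) - g (snd w)"
    using continuous_attains_sup by (metis (no_types, lifting))
  obtain t r where wtr: "w = (t, r)" by (cases w)
  have mx: "z (t', branch_pt i r') - f t' - g r' \<le> z (t, branch_pt i r) - f t - g r" if "t' \<in> ?I" "r' \<in> ?J" for t' r'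
    using w(2)[of "(t', r')"] that by (simp add: wtr)
  have tr: "\<bar>t - t0\<bar> \<le> \<rho>" "\<bar>r - r0\<bar> \<le> \<rho>" using w(1) by (auto simp: wtr)
  have "\<not> (\<bar>t - t0\<bar> = \<rho> \<or> \<bar>r - r0\<bar> = \<rho>)"
    using bd[OF tr] mx[of t0 r0] pos by auto
  with tr have tr': "\<bar>t - t0\<bar> < \<rho>" "\<bar>r - r0\<bar> < \<rho>" by auto
  obtain M1 where M1: "M1 \<ge> 0" "\<And>x y. x \<in> ?I \<Longrightarrow> y \<in> ?I \<Longrightarrow> f y \<le> f x + f' x * (y - x) + M1 * (y - x)\<^sup>2"
    using f(1) unfolding semiconcave_on_def by blast
  obtain M2 where M2: "M2 \<ge> 0" "\<And>x y. x \<in> ?J \<Longrightarrow> y \<in> ?J \<Longrightarrow> g y \<le> g x + g' x * (y - x) + M2 * (y - x)\<^sup>2"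
    using g(1) unfolding semiconcave_on_def by blast
  have "upper_slope2 (\<lambda>t r. z (t, branch_pt i r)) t r (f' t) (g' r)"
  proof (rule upper_slope2I[where e = "min (\<rho> - \<bar>t - t0\<bar>) (\<rho> - \<bar>r - r0\<bar>)" and M = "M1 + M2"])
    fix t' r' assume a: "\<bar>t' - t\<bar> < min (\<rho> - \<bar>t - t0\<bar>) (\<rho> - \<bar>r - r0\<bar>)" "\<bar>r' - r\<bar> < min (\<rho> - \<bar>t - t0\<bar>) (\<rho> - \<bar>r - r0\<bar>)"
    have "t' \<in> ?I" "r' \<in> ?J" "t \<in> ?I" "r \<in> ?J"
      unfolding atLeastAtMost_iff using a tr by (intro conjI; linarith)+
    then have "z (t', branch_pt i r') \<le> z (t, branch_pt i r) + f' t * (t' - t) + M1 * (t' - t)\<^sup>2 + g' r * (r' - r) + M2 * (r' - r)\<^sup>2"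
      using mx[of t' r'] M1(2)[of t t'] M2(2)[of r r'] by linarith
    moreover have "0 \<le> M1 * (r' - r)\<^sup>2" "0 \<le> M2 * (t' - t)\<^sup>2" using M1 M2 by auto
    ultimately show "z (t', branch_pt i r') \<le> z (t, branch_pt i r) + f' t * (t' - t) + g' r * (r' - r)
        + (M1 + M2) * ((t' - t)\<^sup>2 + (r' - r)\<^sup>2)"
      unfolding distrib_left distrib_right by linarith
  qed (use tr' in auto)
  then have "f' t + H i (g' r) \<le> 0" by (intro quadratic_subsolution_interior[OF sz]) (use tr' pos in auto)
  then show ?thesis using tr' by blast
qed

text \<open>
  The contact point may be the origin or lie inside any branch, whence the alternative.
\<close>

lemma contact_vertex:
  fixes z :: "real \<times> ('n::finite) junction \<Rightarrow> real"
  assumes cz: "continuous_on ({0..} \<times> UNIV) z" and sz: "quadratic_subsolution H F z"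
    and pos: "0 < \<rho>" "\<rho> < t0"
    and f: "semiconcave_on {t0-\<rho>..t0+\<rho>} f f'" "continuous_on {t0-\<rho>..t0+\<rho>} f"
    and g: "\<And>i. semiconcave_on {0..\<rho>} (g i) (g' i)" "\<And>i. continuous_on {0..\<rho>} (g i)" "\<And>i. g i 0 = 0"
    and bd: "\<And>i t r. \<bar>t - t0\<bar> \<le> \<rho> \<Longrightarrow> 0 \<le> r \<Longrightarrow> r \<le> \<rho> \<Longrightarrow> \<bar>t - t0\<bar> = \<rho> \<or> r = \<rho> \<Longrightarrow>
        z (t, branch_pt i r) - f t - g i r < z (t0, origin) - f t0"
  shows "\<exists>t. \<bar>t - t0\<bar> < \<rho> \<and> ((\<exists>i r. 0 \<le> r \<and> r < \<rho> \<and> f' t + H i (g' i r) \<le> 0) \<or> f' t + F (\<chi> i. g' i 0) \<le> 0)"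
proof -
  let ?I = "{t0-\<rho>..t0+\<rho>}" and ?J = "{0..\<rho>}"
  have ex: "\<exists>w\<in>?I \<times> ?J. \<forall>w'\<in>?I \<times> ?J. z (fst w', branch_pt i (snd w')) - f (fst w') - g i (snd w')
       \<le> z (fst w, branch_pt i (snd w)) - f (fst w) - g i (snd w)" for i
  proof (rule continuous_attains_sup)
    have "continuous_on (?I \<times> ?J) (\<lambda>(t, r). z (t, branch_pt i r))"
      by (rule continuous_on_subset[OF continuous_on_branch[OF cz]]) (use pos in auto)
    moreover have "continuous_on (?I \<times> ?J) (\<lambda>w. f (fst w))" "continuous_on (?I \<times> ?J) (\<lambda>w. g i (snd w))"
      by (rule continuous_on_compose2[OF f(2)], auto intro!: continuous_intros)
         (rule continuous_on_compose2[OF g(2)], auto intro!: continuous_intros)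
    ultimately show "continuous_on (?I \<times> ?J) (\<lambda>w. z (fst w, branch_pt i (snd w)) - f (fst w) - g i (snd w))"
      by (intro continuous_on_diff) (auto simp: case_prod_unfold)
  qed (use pos in \<open>auto simp: compact_Times\<close>)
  then obtain W where W: "\<And>i. W i \<in> ?I \<times> ?J" "\<And>i w'. w' \<in> ?I \<times> ?J \<Longrightarrow> z (fst w', branch_pt i (snd w')) - f (fst w') - g i (snd w')
       \<le> z (fst (W i), branch_pt i (snd (W i))) - f (fst (W i)) - g i (snd (W i))"
    by metis
  define val where "val i = z (fst (W i), branch_pt i (snd (W i))) - f (fst (W i)) - g i (snd (W i))" for i
  obtain j where "val j = Max (range val)"
    by (metis (mono_tags) Max_in UNIV_not_empty finite finite_imageI image_iff image_is_empty)
  then have j: "\<And>i. val i \<le> val j" by simp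
  obtain t r where wtr: "W j = (t, r)" by (cases "W j")
  have mx: "z (t', branch_pt i r') - f t' - g i r' \<le> z (t, branch_pt j r) - f t - g j r" if "t' \<in> ?I" "r' \<in> ?J" for i t' r'
    using W(2)[of "(t', r')" i] that j[of i] by (simp add: val_def wtr)
  have tr: "\<bar>t - t0\<bar> \<le> \<rho>" "0 \<le> r" "r \<le> \<rho>" using W(1)[of j] by (auto simp: wtr)
  have "\<not> (\<bar>t - t0\<bar> = \<rho> \<or> r = \<rho>)"
    using bd[OF tr, of j] mx[of t0 0 j] pos g(3) by (auto simp: branch_pt_0)
  with tr have tr': "\<bar>t - t0\<bar> < \<rho>" "r < \<rho>" by auto
  obtain M1 where M1: "M1 \<ge> 0" "\<And>x y. x \<in> ?I \<Longrightarrow> y \<in> ?I \<Longrightarrow> f y \<le> f x + f' x * (y - x) + M1 * (y - x)\<^sup>2"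
    using f(1) unfolding semiconcave_on_def by blast
  have "\<forall>i. \<exists>M\<ge>0. \<forall>x\<in>?J. \<forall>y\<in>?J. g i y \<le> g i x + g' i x * (y - x) + M * (y - x)\<^sup>2"
    using g(1) unfolding semiconcave_on_def by blast
  then obtain m where m: "\<And>i. m i \<ge> 0" "\<And>i x y. x \<in> ?J \<Longrightarrow> y \<in> ?J \<Longrightarrow> g i y \<le> g i x + g' i x * (y - x) + m i * (y - x)\<^sup>2"
    by metis
  define M2 where "M2 = sum m UNIV"
  have M2: "M2 \<ge> 0" using m(1) by (simp add: M2_def sum_nonneg)
  have gM: "g i y \<le> g i x + g' i x * (y - x) + M2 * (y - x)\<^sup>2" if "x \<in> ?J" "y \<in> ?J" for i x y
  proof -
    have "m i \<le> M2" unfolding M2_def using m(1) by (intro member_le_sum) auto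
    then have "m i * (y - x)\<^sup>2 \<le> M2 * (y - x)\<^sup>2" by (intro mult_right_mono) auto
    then show ?thesis using m(2)[OF that, of i] by linarith
  qed
  have est: "z (t', branch_pt i r') \<le> z (t, branch_pt j r) + f' t * (t' - t) + (g i r' - g j r) + M1 * (t' - t)\<^sup>2"
    if "t' \<in> ?I" "r' \<in> ?J" for i t' r'
    using mx[OF that, of i] M1(2)[of t t'] that tr by (simp add: abs_le_iff)
  show ?thesis
  proof (cases "r = 0")
    case False
    then have r: "r > 0" using tr by simp
    have "upper_slope2 (\<lambda>t r. z (t, branch_pt j r)) t r (f' t) (g' j r)"
    proof (rule upper_slope2I[where e = "min (\<rho> - \<bar>t - t0\<bar>) (min r (\<rho> - r))" and M = "M1 + M2"])
      fix t' r' assume a: "\<bar>t' - t\<bar> < min (\<rho> - \<bar>t - t0\<bar>) (min r (\<rho> - r))" "\<bar>r' - r\<bar> < min (\<rho> - \<bar>t - t0\<bar>) (min r (\<rho> - r))"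
      have in': "t' \<in> ?I" "r' \<in> ?J" "r \<in> ?J"
        unfolding atLeastAtMost_iff using a tr by (intro conjI; linarith)+
      have "0 \<le> M1 * (r' - r)\<^sup>2" "0 \<le> M2 * (t' - t)\<^sup>2" using M1 M2 by auto
      then show "z (t', branch_pt j r') \<le> z (t, branch_pt j r) + f' t * (t' - t) + g' j r * (r' - r)
          + (M1 + M2) * ((t' - t)\<^sup>2 + (r' - r)\<^sup>2)"
        using est[OF in'(1,2), of j] gM[OF in'(3,2), of j] unfolding distrib_left distrib_right by linarith
    qed (use tr' r in auto)
    then have "f' t + H j (g' j r) \<le> 0" by (intro quadratic_subsolution_interior[OF sz]) (use tr' pos r in auto)
    then show ?thesis using tr' tr by blast
  next
    case True
    have "vertex_slope z t (f' t) (\<chi> i. g' i 0)"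
    proof (rule vertex_slopeI[where e = "\<rho> - \<bar>t - t0\<bar>" and M = "M1 + M2"])
      fix i t' r' assume a: "\<bar>t' - t\<bar> < \<rho> - \<bar>t - t0\<bar>" "0 \<le> r'" "r' < \<rho> - \<bar>t - t0\<bar>"
      have in': "t' \<in> ?I" "r' \<in> ?J" "0 \<in> ?J"
        unfolding atLeastAtMost_iff using a tr pos by (intro conjI; linarith)+
      have "0 \<le> M1 * r'\<^sup>2" "0 \<le> M2 * (t' - t)\<^sup>2" using M1 M2 by auto
      then show "z (t', branch_pt i r') \<le> z (t, origin) + f' t * (t' - t) + (\<chi> i. g' i 0) $ i * r'
          + (M1 + M2) * ((t' - t)\<^sup>2 + r'\<^sup>2)"
        using est[OF in'(1,2), of i] gM[OF in'(3,2), of i] True g(3) unfolding distrib_left distrib_right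
        by (simp add: branch_pt_0)
    qed (use tr' in auto)
    then have "f' t + F (\<chi> i. g' i 0) \<le> 0 \<or> (\<exists>i. f' t + H i ((\<chi> i. g' i 0) $ i) \<le> 0)"
      by (intro quadratic_subsolution_vertex[OF sz]) (use tr' pos in auto)
    then show ?thesis using tr' tr True pos by auto
  qed
qed

lemma interior_pos_near:
  fixes h :: "real \<Rightarrow> real"
  assumes "continuous_on UNIV h" "a + h q > 0"
  shows "\<exists>e>0. \<forall>a' q'. \<bar>a' - a\<bar> \<le> e \<longrightarrow> \<bar>q' - q\<bar> \<le> e \<longrightarrow> a' + h q' > 0"
proof -
  define c where "c = (a + h q) / 2"
  have c: "c > 0" using assms by (simp add: c_def)
  then obtain d where d: "d > 0" "\<And>q'. dist q' q < d \<Longrightarrow> dist (h q') (h q) < c"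
    using assms(1) unfolding continuous_on_iff by (metis UNIV_I)
  show ?thesis
  proof (intro exI[of _ "min (c/2) (d/2)"] conjI allI impI)
    fix a' q' assume "\<bar>a' - a\<bar> \<le> min (c/2) (d/2)" "\<bar>q' - q\<bar> \<le> min (c/2) (d/2)"
    then have "\<bar>a' - a\<bar> \<le> c/2" "\<bar>h q' - h q\<bar> < c"
      using d(2)[of q'] d(1) by (auto simp: dist_real_def)
    then have "a' + h q' > a + h q - c/2 - c" by linarith
    moreover have "a + h q = 2 * c" by (simp add: c_def)
    ultimately show "a' + h q' > 0" using c by linarith
  qed (use c d in auto)
qed

lemma vertex_pos_near:
  fixes H :: "'n::finite \<Rightarrow> real \<Rightarrow> real" and F :: "real ^ 'n \<Rightarrow> real"
  assumes "\<And>i. continuous_on UNIV (H i)" "continuous_on UNIV F" "a + F q > 0" "\<And>i. a + H i (q $ i) > 0"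
  shows "\<exists>e>0. \<forall>a' q'. \<bar>a' - a\<bar> \<le> e \<longrightarrow> (\<forall>i. \<bar>q' $ i - q $ i\<bar> \<le> e) \<longrightarrow> a' + F q' > 0 \<and> (\<forall>i. a' + H i (q' $ i) > 0)"
proof -
  have "\<forall>i. \<exists>e>0. \<forall>a' p. \<bar>a' - a\<bar> \<le> e \<longrightarrow> \<bar>p - q $ i\<bar> \<le> e \<longrightarrow> a' + H i p > 0"
    using interior_pos_near[OF assms(1) assms(4)] by blast
  then obtain e where e: "\<And>i. e i > 0" "\<And>i a' p. \<bar>a' - a\<bar> \<le> e i \<Longrightarrow> \<bar>p - q $ i\<bar> \<le> e i \<Longrightarrow> a' + H i p > 0"
    by metis
  define c where "c = (a + F q) / 2"
  have c: "c > 0" using assms by (simp add: c_def)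
  then obtain d where d: "d > 0" "\<And>q'. dist q' q < d \<Longrightarrow> dist (F q') (F q) < c"
    using assms(2) unfolding continuous_on_iff by (metis UNIV_I)
  define N where "N = real CARD('n)"
  have N: "N \<ge> 1" unfolding N_def by (simp add: Suc_leI)
  define \<epsilon> where "\<epsilon> = min (Min (range e)) (min (c/2) (d / (2 * N)))"
  have \<epsilon>: "\<epsilon> > 0" "\<And>i. \<epsilon> \<le> e i" "\<epsilon> \<le> c/2" "\<epsilon> \<le> d / (2 * N)"
    using e(1) c d N by (auto simp: \<epsilon>_def min.coboundedI1)
  show ?thesis
  proof (intro exI[of _ \<epsilon>] conjI allI impI)
    fix a' q' assume a': "\<bar>a' - a\<bar> \<le> \<epsilon>" and q': "\<forall>i. \<bar>q' $ i - q $ i\<bar> \<le> \<epsilon>"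
    have "norm (q' - q) \<le> (\<Sum>i\<in>UNIV. \<bar>(q' - q) $ i\<bar>)" by (rule norm_le_l1_cart)
    also have "\<dots> \<le> (\<Sum>i\<in>(UNIV::'n set). \<epsilon>)" using q' by (intro sum_mono) auto
    also have "\<dots> = N * \<epsilon>" by (simp add: N_def)
    also have "\<dots> \<le> N * (d / (2 * N))" using \<epsilon> N by (intro mult_left_mono) auto
    also have "\<dots> < d" using N d by simp
    finally have "\<bar>F q' - F q\<bar> < c" using d(2)[of q'] by (simp add: dist_norm)
    then have "a' + F q' > a + F q - c/2 - c" using a' \<epsilon>(3) by linarith
    moreover have "a + F q = 2 * c" by (simp add: c_def)
    ultimately show "a' + F q' > 0" using c by linarith
    show "a' + H i (q' $ i) > 0" for i
      using e(2)[of a' i "q' $ i"] a' q' \<epsilon>(2)[of i] by (meson order_trans)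
  qed (rule \<epsilon>)
qed

text \<open>
  Stability under suprema and under uniform limits at once.  The test function is made strict by adding
  \<open>(t - t\<^sub>0)\<^sup>2 + (r - r\<^sub>0)\<^sup>2\<close>; an approximation \<open>z\<close> that is good at the base point then touches it
  nearby.  The relaxed condition is closed under such limits because \<open>a + F(q) > 0\<close> and \<open>a + H\<^sub>i(q\<^sub>i) > 0\<close> for all \<open>i\<close>
  are open conditions.
\<close>

lemma quadratic_subsolution_stable:
  fixes u :: "real \<times> ('n::finite) junction \<Rightarrow> real"
  assumes H: "\<And>i. continuous_on UNIV (H i)" and F: "continuous_on UNIV F"
    and ap: "\<And>\<epsilon> t0 x0. \<epsilon> > 0 \<Longrightarrow> t0 > 0 \<Longrightarrow> \<exists>z. continuous_on ({0..} \<times> UNIV) z \<and> quadratic_subsolution H F z \<and>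
        u (t0, x0) - \<epsilon> \<le> z (t0, x0) \<and> (\<forall>t\<ge>0. \<forall>x. z (t, x) \<le> u (t, x) + \<epsilon>)"
  shows "quadratic_subsolution H F u"
  unfolding quadratic_subsolution_def
proof (intro conjI allI impI)
  fix i t0 r0 a q assume t0: "0 < t0" and r0: "0 < r0"
    and sl: "upper_slope2 (\<lambda>t r. u (t, branch_pt i r)) t0 r0 a q"
  show "a + H i q \<le> 0"
  proof (rule ccontr)
    assume "\<not> ?thesis"
    then obtain e where e: "e > 0" "\<And>a' q'. \<bar>a' - a\<bar> \<le> e \<Longrightarrow> \<bar>q' - q\<bar> \<le> e \<Longrightarrow> a' + H i q' > 0"
      using interior_pos_near[OF H, of a i q] by (auto simp: not_le)
    obtain M d where d: "d > 0" "M \<ge> 0" "\<And>t' y'. \<bar>t' - t0\<bar> < d \<Longrightarrow> \<bar>y' - r0\<bar> < d \<Longrightarrow>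
       u (t', branch_pt i y') \<le> u (t0, branch_pt i r0) + a * (t' - t0) + q * (y' - r0) + M * ((t' - t0)\<^sup>2 + (y' - r0)\<^sup>2)"
      using upper_slope2E[OF sl] by metis
    define m where "m = min (min d (e / (2 * (M + 1)))) (min t0 r0)"
    define \<rho> where "\<rho> = m / 2"
    have m: "0 < m" "m \<le> t0" "m \<le> r0" "m \<le> d" "m \<le> e / (2 * (M + 1))"
      using e d t0 r0 by (simp_all add: m_def min_le_iff_disj)
    then have \<rho>: "0 < \<rho>" "\<rho> < t0" "\<rho> < r0" "\<rho> < d" "\<rho> \<le> e / (2 * (M + 1))"
      unfolding \<rho>_def by linarith+
    have \<rho>e: "2 * (M + 1) * \<rho> \<le> e" using \<rho>(5) d(2) by (simp add: pos_le_divide_eq mult.commute)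
    define \<epsilon> where "\<epsilon> = \<rho>\<^sup>2 / 3"
    have \<epsilon>: "\<epsilon> > 0" "\<rho>\<^sup>2 = 3 * \<epsilon>" using \<rho> by (auto simp: \<epsilon>_def)
    obtain z where cz: "continuous_on ({0..} \<times> UNIV) z" and sz: "quadratic_subsolution H F z"
      and z: "u (t0, branch_pt i r0) - \<epsilon> \<le> z (t0, branch_pt i r0)" "\<And>t x. t \<ge> 0 \<Longrightarrow> z (t, x) \<le> u (t, x) + \<epsilon>"
      using ap[OF \<epsilon>(1) t0] by metis
    have "\<exists>t r. \<bar>t - t0\<bar> < \<rho> \<and> \<bar>r - r0\<bar> < \<rho> \<and> (a + 2 * (M + 1) * (t - t0)) + H i (q + 2 * (M + 1) * (r - r0)) \<le> 0"
    proof (rule contact_interior[OF cz sz \<rho>(1-3) semiconcave_quadratic _ semiconcave_quadratic])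
      fix t r assume t: "\<bar>t - t0\<bar> \<le> \<rho>" and r: "\<bar>r - r0\<bar> \<le> \<rho>" and bd: "\<bar>t - t0\<bar> = \<rho> \<or> \<bar>r - r0\<bar> = \<rho>"
      have "\<rho>\<^sup>2 \<le> (t - t0)\<^sup>2 + (r - r0)\<^sup>2" using bd by (metis le_add_same_cancel1 le_add_same_cancel2 power2_abs zero_le_power2)
      moreover have "z (t, branch_pt i r) \<le> u (t, branch_pt i r) + \<epsilon>" using z(2)[of t] t \<rho> by auto
      moreover have "u (t, branch_pt i r) \<le> u (t0, branch_pt i r0) + a * (t - t0) + q * (r - r0) + M * ((t - t0)\<^sup>2 + (r - r0)\<^sup>2)"
        using d(3)[of t r] t r \<rho> by auto
      ultimately show "z (t, branch_pt i r) - (a * (t - t0) + (M + 1) * (t - t0)\<^sup>2) - (q * (r - r0) + (M + 1) * (r - r0)\<^sup>2)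
          < z (t0, branch_pt i r0) - (a * (t0 - t0) + (M + 1) * (t0 - t0)\<^sup>2) - (q * (r0 - r0) + (M + 1) * (r0 - r0)\<^sup>2)"
        using z(1) \<epsilon> unfolding distrib_left distrib_right by simp
    qed (use d in \<open>auto intro!: continuous_intros\<close>)
    then obtain t r where "\<bar>t - t0\<bar> < \<rho>" "\<bar>r - r0\<bar> < \<rho>" and le: "(a + 2 * (M + 1) * (t - t0)) + H i (q + 2 * (M + 1) * (r - r0)) \<le> 0" by blast
    moreover have "2 * (M + 1) * \<bar>s\<bar> \<le> e" if "\<bar>s\<bar> < \<rho>" for s
    proof -
      have "2 * (M + 1) * \<bar>s\<bar> \<le> 2 * (M + 1) * \<rho>" using that d(2) by (intro mult_left_mono) auto
      then show ?thesis using \<rho>e by linarith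
    qed
    ultimately have "2 * (M + 1) * \<bar>t - t0\<bar> \<le> e" "2 * (M + 1) * \<bar>r - r0\<bar> \<le> e" by blast+
    then have "(a + 2 * (M + 1) * (t - t0)) + H i (q + 2 * (M + 1) * (r - r0)) > 0"
      using d(2) by (intro e(2)) (auto simp: abs_mult)
    then show False using le by simp
  qed
next
  fix t0 a q assume t0: "0 < t0" and sl: "vertex_slope u t0 a q"
  show "a + F q \<le> 0 \<or> (\<exists>i. a + H i (q $ i) \<le> 0)"
  proof (rule ccontr)
    assume "\<not> ?thesis"
    then have aF: "a + F q > 0" and aH: "\<And>i. a + H i (q $ i) > 0" by (auto simp: not_le)
    have "\<exists>e>0. \<forall>a' q'. \<bar>a' - a\<bar> \<le> e \<longrightarrow> (\<forall>i. \<bar>q' $ i - q $ i\<bar> \<le> e) \<longrightarrow> a' + F q' > 0 \<and> (\<forall>i. a' + H i (q' $ i) > 0)"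
      by (intro vertex_pos_near H F aF aH)
    then obtain e where e: "e > 0" "\<And>a' q'. \<bar>a' - a\<bar> \<le> e \<Longrightarrow> (\<And>i. \<bar>q' $ i - q $ i\<bar> \<le> e) \<Longrightarrow> a' + F q' > 0 \<and> (\<forall>i. a' + H i (q' $ i) > 0)"
      by blast
    obtain M0 d where d: "d > 0" and M0: "\<And>i t' r. \<bar>t' - t0\<bar> < d \<Longrightarrow> 0 \<le> r \<Longrightarrow> r < d \<Longrightarrow>
       u (t', branch_pt i r) \<le> u (t0, origin) + a * (t' - t0) + q $ i * r + M0 * ((t' - t0)\<^sup>2 + r\<^sup>2)"
      using sl unfolding vertex_slope_def by blast
    define M where "M = \<bar>M0\<bar>"
    have M: "M \<ge> 0" "M0 \<le> M" by (auto simp: M_def)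
    have dM: "u (t', branch_pt i r) \<le> u (t0, origin) + a * (t' - t0) + q $ i * r + M * ((t' - t0)\<^sup>2 + r\<^sup>2)"
      if "\<bar>t' - t0\<bar> < d" "0 \<le> r" "r < d" for i t' r
    proof -
      have "M0 * ((t' - t0)\<^sup>2 + r\<^sup>2) \<le> M * ((t' - t0)\<^sup>2 + r\<^sup>2)" using M by (intro mult_right_mono) auto
      then show ?thesis using M0[OF that, of i] by linarith
    qed
    define m where "m = min (min d (e / (2 * (M + 1)))) t0"
    define \<rho> where "\<rho> = m / 2"
    have m: "0 < m" "m \<le> t0" "m \<le> d" "m \<le> e / (2 * (M + 1))"
      using e d t0 M by (simp_all add: m_def min_le_iff_disj)
    then have \<rho>: "0 < \<rho>" "\<rho> < t0" "\<rho> < d" "\<rho> \<le> e / (2 * (M + 1))"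
      unfolding \<rho>_def by linarith+
    have \<rho>e: "2 * (M + 1) * \<rho> \<le> e" using \<rho>(4) M(1) by (simp add: pos_le_divide_eq mult.commute)
    define \<epsilon> where "\<epsilon> = \<rho>\<^sup>2 / 3"
    have \<epsilon>: "\<epsilon> > 0" "\<rho>\<^sup>2 = 3 * \<epsilon>" using \<rho> by (auto simp: \<epsilon>_def)
    obtain z where cz: "continuous_on ({0..} \<times> UNIV) z" and sz: "quadratic_subsolution H F z"
      and z: "u (t0, origin) - \<epsilon> \<le> z (t0, origin)" "\<And>t x. t \<ge> 0 \<Longrightarrow> z (t, x) \<le> u (t, x) + \<epsilon>"
      using ap[OF \<epsilon>(1) t0] by metis
    define g where "g i r = q $ i * (r - 0) + (M + 1) * (r - 0)\<^sup>2" for i and r :: real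
    define g' where "g' i r = q $ i + 2 * (M + 1) * (r - 0)" for i and r :: real
    have "\<exists>t. \<bar>t - t0\<bar> < \<rho> \<and> ((\<exists>i r. 0 \<le> r \<and> r < \<rho> \<and> (a + 2 * (M + 1) * (t - t0)) + H i (g' i r) \<le> 0)
        \<or> (a + 2 * (M + 1) * (t - t0)) + F (\<chi> i. g' i 0) \<le> 0)"
    proof (rule contact_vertex[OF cz sz \<rho>(1,2) semiconcave_quadratic, where g = g])
      show "semiconcave_on {0..\<rho>} (g i) (g' i)" for i
        unfolding g_def[abs_def] g'_def[abs_def] using M by (intro semiconcave_quadratic) auto
      show "continuous_on {0..\<rho>} (g i)" for i unfolding g_def[abs_def] by (intro continuous_intros)
      fix i t r assume t: "\<bar>t - t0\<bar> \<le> \<rho>" and r: "0 \<le> r" "r \<le> \<rho>" and bd: "\<bar>t - t0\<bar> = \<rho> \<or> r = \<rho>"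
      have "\<rho>\<^sup>2 \<le> (t - t0)\<^sup>2 + r\<^sup>2" using bd by (metis le_add_same_cancel1 le_add_same_cancel2 power2_abs zero_le_power2)
      moreover have "z (t, branch_pt i r) \<le> u (t, branch_pt i r) + \<epsilon>" using z(2)[of t] t \<rho> by auto
      moreover have "u (t, branch_pt i r) \<le> u (t0, origin) + a * (t - t0) + q $ i * r + M * ((t - t0)\<^sup>2 + r\<^sup>2)"
        using dM[of t r i] t r \<rho> by auto
      ultimately show "z (t, branch_pt i r) - (a * (t - t0) + (M + 1) * (t - t0)\<^sup>2) - g i r
          < z (t0, origin) - (a * (t0 - t0) + (M + 1) * (t0 - t0)\<^sup>2)"
        using z(1) \<epsilon> unfolding g_def distrib_left distrib_right by simp
    qed (use M in \<open>auto intro!: continuous_intros simp: g_def\<close>)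
    then obtain t where t: "\<bar>t - t0\<bar> < \<rho>" and le: "(\<exists>i r. 0 \<le> r \<and> r < \<rho> \<and> (a + 2 * (M + 1) * (t - t0)) + H i (g' i r) \<le> 0)
        \<or> (a + 2 * (M + 1) * (t - t0)) + F (\<chi> i. g' i 0) \<le> 0" by blast
    have small: "\<bar>2 * (M + 1) * s\<bar> \<le> e" if "\<bar>s\<bar> < \<rho>" for s
    proof -
      have "2 * (M + 1) * \<bar>s\<bar> \<le> 2 * (M + 1) * \<rho>" using that M by (intro mult_left_mono) auto
      moreover have "\<bar>2 * (M + 1) * s\<bar> = 2 * (M + 1) * \<bar>s\<bar>" using M by (simp add: abs_mult)
      ultimately show ?thesis using \<rho>e by linarith
    qed
    have ta: "\<bar>(a + 2 * (M + 1) * (t - t0)) - a\<bar> \<le> e" using small[OF t] by simp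
    from le show False
    proof
      assume "\<exists>i r. 0 \<le> r \<and> r < \<rho> \<and> (a + 2 * (M + 1) * (t - t0)) + H i (g' i r) \<le> 0"
      then obtain i r where r: "0 \<le> r" "r < \<rho>" and le: "(a + 2 * (M + 1) * (t - t0)) + H i (g' i r) \<le> 0" by blast
      have "(a + 2 * (M + 1) * (t - t0)) + H i ((\<chi> i. g' i r) $ i) > 0"
        using e(2)[OF ta, of "\<chi> i. g' i r"] small[of r] r by (simp add: g'_def)
      then show False using le by simp
    next
      assume le: "(a + 2 * (M + 1) * (t - t0)) + F (\<chi> i. g' i 0) \<le> 0"
      have "(a + 2 * (M + 1) * (t - t0)) + F (\<chi> i. g' i 0) > 0"
        using e(2)[OF ta, of "\<chi> i. g' i 0"] e(1) by (simp add: g'_def)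
      then show False using le by simp
    qed
  qed
qed

section \<open>First-order jets and the relaxed solutions of the statement\<close>

text \<open>
  From quadratic test functions to first-order jets.  A remainder \<open>\<epsilon> (\<bar>t - t\<^sub>0\<bar> + \<bar>r - r\<^sub>0\<bar>)\<close> is dominated by
  \<open>2 \<epsilon>\<close> times the smooth function \<open>\<surd>(\<delta>\<^sup>2 + (t - t\<^sub>0)\<^sup>2) + \<surd>(\<delta>\<^sup>2 + (r - r\<^sub>0)\<^sup>2)\<close>, whose partial derivatives are at
  most \<open>1\<close>; with \<open>\<delta>\<close> small compared with the size of the box, the contact stays strict on its boundary.
\<close>

lemma quadratic_subsolution_ojet_interior:
  fixes u :: "real \<times> ('n::finite) junction \<Rightarrow> real"
  assumes H: "continuous_on UNIV (H i)" and cu: "continuous_on ({0..} \<times> UNIV) u" and su: "quadratic_subsolution H F u"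
    and t0: "0 < t0" and r0: "0 < r0"
    and jet: "\<And>\<epsilon>. \<epsilon> > 0 \<Longrightarrow> \<exists>\<rho>>0. \<forall>t r. \<bar>t - t0\<bar> < \<rho> \<longrightarrow> \<bar>r - r0\<bar> < \<rho> \<longrightarrow>
        u (t, branch_pt i r) \<le> u (t0, branch_pt i r0) + a * (t - t0) + q * (r - r0) + \<epsilon> * (\<bar>t - t0\<bar> + \<bar>r - r0\<bar>)"
  shows "a + H i q \<le> 0"
proof (rule ccontr)
  assume "\<not> ?thesis"
  then obtain e where e: "e > 0" "\<And>a' q'. \<bar>a' - a\<bar> \<le> e \<Longrightarrow> \<bar>q' - q\<bar> \<le> e \<Longrightarrow> a' + H i q' > 0"
    using interior_pos_near[OF H, of a q] by (auto simp: not_le)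
  define \<epsilon> where "\<epsilon> = e / 2"
  have \<epsilon>: "\<epsilon> > 0" using e by (simp add: \<epsilon>_def)
  obtain d where d: "d > 0" "\<And>t r. \<bar>t - t0\<bar> < d \<Longrightarrow> \<bar>r - r0\<bar> < d \<Longrightarrow>
        u (t, branch_pt i r) \<le> u (t0, branch_pt i r0) + a * (t - t0) + q * (r - r0) + \<epsilon> * (\<bar>t - t0\<bar> + \<bar>r - r0\<bar>)"
    using jet[OF \<epsilon>] by blast
  define \<rho> where "\<rho> = min d (min t0 r0) / 2"
  have \<rho>: "0 < \<rho>" "\<rho> < t0" "\<rho> < r0" "\<rho> < d" using d t0 r0 by (auto simp: \<rho>_def min_def)
  define \<delta> where "\<delta> = \<rho> / 8"
  have \<delta>: "\<delta> > 0" using \<rho> by (simp add: \<delta>_def)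
  define f where "f b x0 y = b * (y - x0) + e * sqrt (\<delta>\<^sup>2 + (y - x0)\<^sup>2)" for b x0 y
  define f' where "f' b x0 y = b + e * ((y - x0) / sqrt (\<delta>\<^sup>2 + (y - x0)\<^sup>2))" for b x0 y
  have sc: "semiconcave_on S (f b x0) (f' b x0)" for S b x0
    unfolding f_def[abs_def] f'_def[abs_def] using e \<delta> by (intro semiconcave_sqrt) auto
  have cf: "continuous_on S (f b x0)" for S b x0 unfolding f_def[abs_def] by (intro continuous_intros)
  have f0: "f b x0 x0 = e * \<delta>" for b x0 using \<delta> by (simp add: f_def)
  have fl: "f b x0 y \<ge> b * (y - x0) + e * \<bar>y - x0\<bar>" for b x0 y
    using e unfolding f_def by (intro add_left_mono mult_left_mono real_le_rsqrt) auto
  have f'b: "\<bar>f' b x0 y - b\<bar> \<le> e" for b x0 y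
  proof -
    have "\<bar>(y - x0) / sqrt (\<delta>\<^sup>2 + (y - x0)\<^sup>2)\<bar> \<le> 1" using \<delta> by (intro abs_div_sqrt_le_1) auto
    from mult_left_mono[OF this, of e] show ?thesis using e by (simp add: f'_def abs_mult)
  qed
  have "\<exists>t r. \<bar>t - t0\<bar> < \<rho> \<and> \<bar>r - r0\<bar> < \<rho> \<and> f' a t0 t + H i (f' q r0 r) \<le> 0"
  proof (rule contact_interior[OF cu su \<rho>(1-3) sc cf sc cf])
    fix t r assume t: "\<bar>t - t0\<bar> \<le> \<rho>" and r: "\<bar>r - r0\<bar> \<le> \<rho>" and bd: "\<bar>t - t0\<bar> = \<rho> \<or> \<bar>r - r0\<bar> = \<rho>"
    have "u (t, branch_pt i r) \<le> u (t0, branch_pt i r0) + a * (t - t0) + q * (r - r0) + \<epsilon> * (\<bar>t - t0\<bar> + \<bar>r - r0\<bar>)"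
      using d(2)[of t r] t r \<rho> by auto
    moreover have "\<epsilon> * \<rho> \<le> \<epsilon> * (\<bar>t - t0\<bar> + \<bar>r - r0\<bar>)" using bd \<epsilon> by (intro mult_left_mono) auto
    moreover have "e * (\<bar>t - t0\<bar> + \<bar>r - r0\<bar>) = 2 * (\<epsilon> * (\<bar>t - t0\<bar> + \<bar>r - r0\<bar>))" by (simp add: \<epsilon>_def)
    moreover have "e * \<delta> = \<epsilon> * \<rho> / 4" "\<epsilon> * \<rho> > 0" using \<epsilon> \<rho> by (auto simp: \<epsilon>_def \<delta>_def)
    ultimately show "u (t, branch_pt i r) - f a t0 t - f q r0 r < u (t0, branch_pt i r0) - f a t0 t0 - f q r0 r0"
      using fl[of a t t0] fl[of q r r0] unfolding f0 distrib_left by linarith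
  qed
  then obtain t r where "f' a t0 t + H i (f' q r0 r) \<le> 0" by blast
  moreover have "f' a t0 t + H i (f' q r0 r) > 0" by (rule e(2)[OF f'b f'b])
  ultimately show False by simp
qed

lemma quadratic_subsolution_ojet_vertex:
  fixes u :: "real \<times> ('n::finite) junction \<Rightarrow> real"
  assumes H: "\<And>i. continuous_on UNIV (H i)" and F: "continuous_on UNIV F"
    and cu: "continuous_on ({0..} \<times> UNIV) u" and su: "quadratic_subsolution H F u" and t0: "0 < t0"
    and jet: "\<And>\<epsilon>. \<epsilon> > 0 \<Longrightarrow> \<exists>\<rho>>0. \<forall>i t r. \<bar>t - t0\<bar> < \<rho> \<longrightarrow> 0 \<le> r \<longrightarrow> r < \<rho> \<longrightarrow>
        u (t, branch_pt i r) \<le> u (t0, origin) + a * (t - t0) + q $ i * r + \<epsilon> * (\<bar>t - t0\<bar> + r)"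
  shows "a + F q \<le> 0 \<or> (\<exists>i. a + H i (q $ i) \<le> 0)"
proof (rule ccontr)
  assume "\<not> ?thesis"
  then have aF: "a + F q > 0" and aH: "\<And>i. a + H i (q $ i) > 0" by (auto simp: not_le)
  have "\<exists>e>0. \<forall>a' q'. \<bar>a' - a\<bar> \<le> e \<longrightarrow> (\<forall>i. \<bar>q' $ i - q $ i\<bar> \<le> e) \<longrightarrow> a' + F q' > 0 \<and> (\<forall>i. a' + H i (q' $ i) > 0)"
    by (intro vertex_pos_near H F aF aH)
  then obtain e where e: "e > 0" "\<And>a' q'. \<bar>a' - a\<bar> \<le> e \<Longrightarrow> (\<And>i. \<bar>q' $ i - q $ i\<bar> \<le> e) \<Longrightarrow> a' + F q' > 0 \<and> (\<forall>i. a' + H i (q' $ i) > 0)"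
    by blast
  define \<epsilon> where "\<epsilon> = e / 2"
  have \<epsilon>: "\<epsilon> > 0" using e by (simp add: \<epsilon>_def)
  obtain d where d: "d > 0" "\<And>i t r. \<bar>t - t0\<bar> < d \<Longrightarrow> 0 \<le> r \<Longrightarrow> r < d \<Longrightarrow>
        u (t, branch_pt i r) \<le> u (t0, origin) + a * (t - t0) + q $ i * r + \<epsilon> * (\<bar>t - t0\<bar> + r)"
    using jet[OF \<epsilon>] by blast
  define \<rho> where "\<rho> = min d t0 / 2"
  have \<rho>: "0 < \<rho>" "\<rho> < t0" "\<rho> < d" using d t0 by (auto simp: \<rho>_def min_def)
  define \<delta> where "\<delta> = \<rho> / 8"
  have \<delta>: "\<delta> > 0" using \<rho> by (simp add: \<delta>_def)
  define f where "f y = a * (y - t0) + e * sqrt (\<delta>\<^sup>2 + (y - t0)\<^sup>2)" for y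
  define f' where "f' y = a + e * ((y - t0) / sqrt (\<delta>\<^sup>2 + (y - t0)\<^sup>2))" for y
  have sc: "semiconcave_on S f f'" for S
    unfolding f_def[abs_def] f'_def[abs_def] using e \<delta> by (intro semiconcave_sqrt) auto
  have cf: "continuous_on S f" for S unfolding f_def[abs_def] by (intro continuous_intros)
  have f0: "f t0 = e * \<delta>" using \<delta> by (simp add: f_def)
  have fl: "f y \<ge> a * (y - t0) + e * \<bar>y - t0\<bar>" for y
    using e unfolding f_def by (intro add_left_mono mult_left_mono real_le_rsqrt) auto
  have f'b: "\<bar>f' y - a\<bar> \<le> e" for y
  proof -
    have "\<bar>(y - t0) / sqrt (\<delta>\<^sup>2 + (y - t0)\<^sup>2)\<bar> \<le> 1" using \<delta> by (intro abs_div_sqrt_le_1) auto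
    from mult_left_mono[OF this, of e] show ?thesis using e by (simp add: f'_def abs_mult)
  qed
  have "\<exists>t. \<bar>t - t0\<bar> < \<rho> \<and> ((\<exists>i r. 0 \<le> r \<and> r < \<rho> \<and> f' t + H i (q $ i + e) \<le> 0) \<or> f' t + F (\<chi> i. q $ i + e) \<le> 0)"
  proof (rule contact_vertex[OF cu su \<rho>(1,2) sc cf, where g = "\<lambda>i r. (q $ i + e) * r"])
    show "semiconcave_on {0..\<rho>} ((*) (q $ i + e)) (\<lambda>r. q $ i + e)" for i
      by (rule semiconcave_onI[of 0]) (auto simp: algebra_simps)
    fix i t r assume t: "\<bar>t - t0\<bar> \<le> \<rho>" and r: "0 \<le> r" "r \<le> \<rho>" and bd: "\<bar>t - t0\<bar> = \<rho> \<or> r = \<rho>"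
    have "u (t, branch_pt i r) \<le> u (t0, origin) + a * (t - t0) + q $ i * r + \<epsilon> * (\<bar>t - t0\<bar> + r)"
      using d(2)[of t r i] t r \<rho> by auto
    moreover have "\<epsilon> * \<rho> \<le> \<epsilon> * (\<bar>t - t0\<bar> + r)" using bd \<epsilon> r by (intro mult_left_mono) auto
    moreover have "e * (\<bar>t - t0\<bar> + r) = 2 * (\<epsilon> * (\<bar>t - t0\<bar> + r))" by (simp add: \<epsilon>_def)
    moreover have "e * \<delta> = \<epsilon> * \<rho> / 4" "\<epsilon> * \<rho> > 0" using \<epsilon> \<rho> by (auto simp: \<epsilon>_def \<delta>_def)
    ultimately show "u (t, branch_pt i r) - f t - (q $ i + e) * r < u (t0, origin) - f t0"
      using fl[of t] unfolding f0 distrib_left distrib_right by linarith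
  qed (auto intro!: continuous_intros)
  then obtain t where t: "(\<exists>i. f' t + H i (q $ i + e) \<le> 0) \<or> f' t + F (\<chi> i. q $ i + e) \<le> 0" by blast
  have "f' t + F (\<chi> i. q $ i + e) > 0 \<and> (\<forall>i. f' t + H i ((\<chi> i. q $ i + e) $ i) > 0)"
    by (rule e(2)[OF f'b]) (use e in simp)
  then show False using t by (auto simp: not_le[symmetric])
qed

lemma usc_env_eq:
  assumes "continuous_on S u" "z \<in> S"
  shows "usc_env S u z = ereal (u z)"
proof (rule antisym)
  show "ereal (u z) \<le> usc_env S u z"
    unfolding usc_env_def by (intro INF_greatest SUP_upper) (use assms(2) in auto)
  show "usc_env S u z \<le> ereal (u z)"
  proof (rule ereal_le_epsilon2)
    fix \<epsilon> :: real assume "\<epsilon> > 0"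
    then obtain d where d: "d > 0" "\<And>w. w \<in> S \<Longrightarrow> dist w z < d \<Longrightarrow> dist (u w) (u z) < \<epsilon>"
      using assms unfolding continuous_on_iff by metis
    have "(SUP w\<in>S \<inter> ball z d. ereal (u w)) \<le> ereal (u z + \<epsilon>)"
    proof (rule SUP_least)
      fix w assume "w \<in> S \<inter> ball z d"
      then have "dist (u w) (u z) < \<epsilon>" using d(2)[of w] by (auto simp: dist_commute)
      then show "ereal (u w) \<le> ereal (u z + \<epsilon>)" by (simp add: dist_real_def)
    qed
    then show "usc_env S u z \<le> ereal (u z) + ereal \<epsilon>"
      unfolding usc_env_def using d(1) by (intro INF_lower2[of d]) auto
  qed
qed

lemma lsc_env_eq:
  assumes "continuous_on S u" "z \<in> S"
  shows "lsc_env S u z = ereal (u z)"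
proof (rule antisym)
  show "lsc_env S u z \<le> ereal (u z)"
    unfolding lsc_env_def by (intro SUP_least INF_lower) (use assms(2) in auto)
  show "ereal (u z) \<le> lsc_env S u z"
  proof (rule ereal_le_epsilon2)
    fix \<epsilon> :: real assume "\<epsilon> > 0"
    then obtain d where d: "d > 0" "\<And>w. w \<in> S \<Longrightarrow> dist w z < d \<Longrightarrow> dist (u w) (u z) < \<epsilon>"
      using assms unfolding continuous_on_iff by metis
    have "ereal (u z - \<epsilon>) \<le> (INF w\<in>S \<inter> ball z d. ereal (u w))"
    proof (rule INF_greatest)
      fix w assume "w \<in> S \<inter> ball z d"
      then have "dist (u w) (u z) < \<epsilon>" using d(2)[of w] by (auto simp: dist_commute)
      then show "ereal (u z - \<epsilon>) \<le> ereal (u w)" by (simp add: dist_real_def)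
    qed
    also have "\<dots> \<le> lsc_env S u z"
      unfolding lsc_env_def using d(1) by (intro SUP_upper) auto
    finally have "ereal (u z - \<epsilon>) + ereal \<epsilon> \<le> lsc_env S u z + ereal \<epsilon>" by (rule add_right_mono)
    then show "ereal (u z) \<le> lsc_env S u z + ereal \<epsilon>" by simp
  qed
qed

lemma touches_above_continuous:
  fixes u :: "real \<times> ('n::finite) junction \<Rightarrow> real"
  assumes cu: "continuous_on ({0..} \<times> UNIV) u" and z: "z \<in> {0<..<T} \<times> UNIV"
  shows "touches_above ({0<..<T} \<times> UNIV) \<phi> (usc_env ({0..<T} \<times> UNIV) u) z \<longleftrightarrow>
         (\<exists>e>0. \<forall>w\<in>({0<..<T} \<times> UNIV) \<inter> ball z e. u w - \<phi> w \<le> u z - \<phi> z)"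
proof -
  have c: "continuous_on ({0..<T} \<times> UNIV) u" by (rule continuous_on_subset[OF cu]) auto
  have e: "usc_env ({0..<T} \<times> UNIV) u w = ereal (u w)" if "w \<in> {0<..<T} \<times> UNIV" for w
    by (rule usc_env_eq[OF c]) (use that in auto)
  show ?thesis unfolding touches_above_def
    by (intro ex_cong1 conj_cong refl ball_cong) (use e z in auto)
qed

lemma touches_below_continuous:
  fixes u :: "real \<times> ('n::finite) junction \<Rightarrow> real"
  assumes cu: "continuous_on ({0..} \<times> UNIV) u" and z: "z \<in> {0<..<T} \<times> UNIV"
  shows "touches_below ({0<..<T} \<times> UNIV) \<phi> (lsc_env ({0..<T} \<times> UNIV) u) z \<longleftrightarrow>
         (\<exists>e>0. \<forall>w\<in>({0<..<T} \<times> UNIV) \<inter> ball z e. u z - \<phi> z \<le> u w - \<phi> w)"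
proof -
  have c: "continuous_on ({0..<T} \<times> UNIV) u" by (rule continuous_on_subset[OF cu]) auto
  have e: "lsc_env ({0..<T} \<times> UNIV) u w = ereal (u w)" if "w \<in> {0<..<T} \<times> UNIV" for w
    by (rule lsc_env_eq[OF c]) (use that in auto)
  show ?thesis unfolding touches_below_def
    by (intro ex_cong1 conj_cong refl ball_cong) (use e z in auto)
qed

lemma at_within_nonneg_ne_bot: "0 \<le> (r::real) \<Longrightarrow> at r within {0..} \<noteq> bot"
proof -
  assume "0 \<le> r"
  then have "at_right r \<le> at r within {0..}" by (intro at_le) auto
  then show ?thesis using trivial_limit_at_right_real[of r] by (metis bot.extremum_uniqueI)
qed

text \<open>
  A test function has, up to the origin, the first-order expansion whose coefficients are \<open>time_deriv\<close> and
  \<open>branch_deriv\<close>.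
\<close>

lemma C1_test_branch_derivatives:
  fixes \<phi> :: "real \<times> ('n::finite) junction \<Rightarrow> real" and i :: 'n and t r :: real
  assumes C1: "C1_test T \<phi>" and t: "t \<in> {0<..<T}" and r: "0 \<le> r"
  defines "x \<equiv> branch_pt i r"
  shows "((\<lambda>s. \<phi> (s, x)) has_real_derivative time_deriv \<phi> t x) (at t)"
    and "((\<lambda>p. \<phi> (t, branch_pt i p)) has_vector_derivative branch_deriv i \<phi> t x) (at r within {0..})"
    and "\<epsilon> > 0 \<Longrightarrow> \<exists>\<rho>>0. \<forall>t' r'. t' \<in> {0<..<T} \<longrightarrow> 0 \<le> r' \<longrightarrow> \<bar>t' - t\<bar> < \<rho> \<longrightarrow> \<bar>r' - r\<bar> < \<rho> \<longrightarrow>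
       \<bar>\<phi> (t', branch_pt i r') - \<phi> (t, x) - time_deriv \<phi> t x * (t' - t) - branch_deriv i \<phi> t x * (r' - r)\<bar>
         \<le> \<epsilon> * (\<bar>t' - t\<bar> + \<bar>r' - r\<bar>)"
proof -
  define S where "S = {0<..<T} \<times> {0::real..}"
  define \<psi> where "\<psi> = (\<lambda>(t, r). \<phi> (t, branch_pt i r))"
  have "C1_on S \<psi>" using C1 unfolding C1_test_def S_def \<psi>_def by blast
  then obtain D where "\<forall>z\<in>S. (\<psi> has_derivative blinfun_apply (D z)) (at z within S)"
    unfolding C1_on_def by blast
  moreover have tr: "(t, r) \<in> S" using t r by (simp add: S_def)
  ultimately have D: "(\<psi> has_derivative blinfun_apply (D (t, r))) (at (t, r) within S)" by blast
  define a where "a = D (t, r) (1, 0)"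
  define q where "q = D (t, r) (0, 1)"
  have Dh: "D (t, r) (h, k) = a * h + q * k" for h k
  proof -
    have "(h, k) = h *\<^sub>R (1::real, 0::real) + k *\<^sub>R (0::real, 1::real)" by simp
    then have "D (t, r) (h, k) = h *\<^sub>R D (t, r) (1, 0) + k *\<^sub>R D (t, r) (0, 1)"
      by (simp only: blinfun.add_right blinfun.scaleR_right)
    then show ?thesis by (simp add: a_def q_def mult.commute)
  qed
  have "(\<psi> has_derivative blinfun_apply (D (t, r))) (at (t, r) within (\<lambda>s. (s, r)) ` {0<..<T})"
    by (rule has_derivative_subset[OF D]) (use r in \<open>auto simp: S_def\<close>)
  moreover have "((\<lambda>s. (s, r)) has_derivative (\<lambda>h. (h, 0))) (at t within {0<..<T})"
    by (auto intro!: derivative_eq_intros)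
  ultimately have "((\<psi> \<circ> (\<lambda>s. (s, r))) has_derivative blinfun_apply (D (t, r)) \<circ> (\<lambda>h. (h, 0))) (at t within {0<..<T})"
    by (intro diff_chain_within)
  then have "((\<lambda>s. \<phi> (s, x)) has_derivative (\<lambda>h. a * h)) (at t within {0<..<T})"
    by (simp add: o_def \<psi>_def Dh x_def)
  moreover have "at t within {0<..<T} = at t" using t by (intro at_within_open) auto
  ultimately have at: "((\<lambda>s. \<phi> (s, x)) has_real_derivative a) (at t)"
    by (simp only: has_field_derivative_def)
  then have ta: "time_deriv \<phi> t x = a" unfolding time_deriv_def by (rule DERIV_imp_deriv)
  show "((\<lambda>s. \<phi> (s, x)) has_real_derivative time_deriv \<phi> t x) (at t)" using at ta by simp
  have "(\<psi> has_derivative blinfun_apply (D (t, r))) (at (t, r) within (\<lambda>p. (t, p)) ` {0..})"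
    by (rule has_derivative_subset[OF D]) (use t in \<open>auto simp: S_def\<close>)
  moreover have "((\<lambda>p. (t, p)) has_derivative (\<lambda>h. (0, h))) (at r within {0..})"
    by (auto intro!: derivative_eq_intros)
  ultimately have "((\<psi> \<circ> (\<lambda>p. (t, p))) has_derivative blinfun_apply (D (t, r)) \<circ> (\<lambda>h. (0, h))) (at r within {0..})"
    by (intro diff_chain_within)
  then have "((\<lambda>p. \<phi> (t, branch_pt i p)) has_derivative (\<lambda>h. h *\<^sub>R q)) (at r within {0..})"
    by (simp add: o_def \<psi>_def Dh mult.commute)
  then have qt: "((\<lambda>p. \<phi> (t, branch_pt i p)) has_vector_derivative q) (at r within {0..})"
    by (simp add: has_vector_derivative_def)
  then have bq: "branch_deriv i \<phi> t x = q"
    unfolding branch_deriv_def x_def radius_branch_pt[OF r]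
    by (rule vector_derivative_within[OF at_within_nonneg_ne_bot[OF r]])
  show "((\<lambda>p. \<phi> (t, branch_pt i p)) has_vector_derivative branch_deriv i \<phi> t x) (at r within {0..})"
    using qt bq by simp
  assume "\<epsilon> > 0"
  then obtain d where d: "d > 0" "\<And>y. y \<in> S \<Longrightarrow> norm (y - (t, r)) < d \<Longrightarrow>
      norm (\<psi> y - \<psi> (t, r) - D (t, r) (y - (t, r))) \<le> \<epsilon> * norm (y - (t, r))"
    using D unfolding has_derivative_within_alt by blast
  show "\<exists>\<rho>>0. \<forall>t' r'. t' \<in> {0<..<T} \<longrightarrow> 0 \<le> r' \<longrightarrow> \<bar>t' - t\<bar> < \<rho> \<longrightarrow> \<bar>r' - r\<bar> < \<rho> \<longrightarrow>
       \<bar>\<phi> (t', branch_pt i r') - \<phi> (t, x) - time_deriv \<phi> t x * (t' - t) - branch_deriv i \<phi> t x * (r' - r)\<bar>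
         \<le> \<epsilon> * (\<bar>t' - t\<bar> + \<bar>r' - r\<bar>)"
  proof (rule exI[of _ "d/2"], intro conjI allI impI)
    fix t' r' assume t': "t' \<in> {0<..<T}" "0 \<le> r'" "\<bar>t' - t\<bar> < d/2" "\<bar>r' - r\<bar> < d/2"
    have n: "norm ((t', r') - (t, r)) \<le> \<bar>t' - t\<bar> + \<bar>r' - r\<bar>"
      using sqrt_sum_squares_le_sum_abs[of "t' - t" "r' - r"] by (simp add: norm_Pair)
    then have "norm ((t', r') - (t, r)) < d" using t' by linarith
    then have "norm (\<psi> (t', r') - \<psi> (t, r) - D (t, r) ((t', r') - (t, r))) \<le> \<epsilon> * norm ((t', r') - (t, r))"
      using t' by (intro d(2)) (auto simp: S_def)
    also have "\<dots> \<le> \<epsilon> * (\<bar>t' - t\<bar> + \<bar>r' - r\<bar>)" using n \<open>\<epsilon> > 0\<close> by (intro mult_left_mono) auto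
    finally show "\<bar>\<phi> (t', branch_pt i r') - \<phi> (t, x) - time_deriv \<phi> t x * (t' - t) - branch_deriv i \<phi> t x * (r' - r)\<bar>
         \<le> \<epsilon> * (\<bar>t' - t\<bar> + \<bar>r' - r\<bar>)"
      unfolding ta bq by (simp add: \<psi>_def Dh x_def algebra_simps)
  qed (use d in auto)
qed

lemma C1_on_uminus: "C1_on S \<psi> \<Longrightarrow> C1_on S (\<lambda>z. - \<psi> z)"
proof -
  assume "C1_on S \<psi>"
  then obtain D where D: "continuous_on S D" "\<And>z. z \<in> S \<Longrightarrow> (\<psi> has_derivative blinfun_apply (D z)) (at z within S)"
    unfolding C1_on_def by blast
  have "((\<lambda>z. - \<psi> z) has_derivative blinfun_apply (- D z)) (at z within S)" if "z \<in> S" for z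
    by (rule has_derivative_eq_rhs[OF has_derivative_minus[OF D(2)[OF that]]])
       (simp add: fun_eq_iff blinfun.minus_left)
  then show ?thesis unfolding C1_on_def using D(1) continuous_on_minus by blast
qed

lemma C1_test_uminus: "C1_test T \<phi> \<Longrightarrow> C1_test T (\<lambda>z. - \<phi> z)"
  unfolding C1_test_def using C1_on_uminus continuous_on_minus by (force simp: case_prod_unfold)

lemma time_deriv_uminus:
  assumes "C1_test T \<phi>" "t \<in> {0<..<T}"
  shows "time_deriv (\<lambda>z. - \<phi> z) t x = - time_deriv \<phi> t x"
proof -
  obtain i r where x: "0 \<le> r" "x = branch_pt i r" by (rule junction_cases)
  have "((\<lambda>s. \<phi> (s, x)) has_real_derivative time_deriv \<phi> t x) (at t)"
    using C1_test_branch_derivatives(1)[OF assms x(1)] x by simp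
  from DERIV_minus[OF this] show ?thesis unfolding time_deriv_def by (rule DERIV_imp_deriv)
qed

lemma branch_deriv_uminus:
  assumes "C1_test T \<phi>" "t \<in> {0<..<T}" "x \<in> branch i"
  shows "branch_deriv i (\<lambda>z. - \<phi> z) t x = - branch_deriv i \<phi> t x"
proof -
  obtain r where x: "0 \<le> r" "x = branch_pt i r" using assms(3) by (auto simp: branch_def)
  have "((\<lambda>p. \<phi> (t, branch_pt i p)) has_vector_derivative branch_deriv i \<phi> t x) (at r within {0..})"
    using C1_test_branch_derivatives(2)[OF assms(1,2) x(1)] x by simp
  from has_vector_derivative_minus[OF this]
  have "((\<lambda>p. - \<phi> (t, branch_pt i p)) has_vector_derivative - branch_deriv i \<phi> t x) (at r within {0..})" .
  then show ?thesis unfolding branch_deriv_def[of i "\<lambda>z. - \<phi> z"] x(2) radius_branch_pt[OF x(1)]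
    by (rule vector_derivative_within[OF at_within_nonneg_ne_bot[OF x(1)]])
qed

lemma origin_in_branch: "origin \<in> branch i"
  unfolding branch_def using branch_pt_0[of i] by (metis atLeast_iff image_eqI order_refl)

lemma supersolution_iff_negated_subsolution:
  fixes u :: "real \<times> ('n::finite) junction \<Rightarrow> real"
  assumes cu: "continuous_on ({0..} \<times> UNIV) u"
  shows "relaxed_supersolution T H F u \<longleftrightarrow>
         relaxed_subsolution T (\<lambda>i p. - H i (- p)) (\<lambda>q. - F (- q)) (\<lambda>z. - u z)"
proof -
  have cu': "continuous_on ({0..} \<times> UNIV) (\<lambda>z. - u z)" by (intro continuous_on_minus cu)
  have touch: "touches_above ({0<..<T} \<times> UNIV) (\<lambda>z. - \<phi> z) (usc_env ({0..<T} \<times> UNIV) (\<lambda>z. - u z)) (t, x)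
      \<longleftrightarrow> touches_below ({0<..<T} \<times> UNIV) \<phi> (lsc_env ({0..<T} \<times> UNIV) u) (t, x)"
    if "t \<in> {0<..<T}" for \<phi> t x
  proof -
    have z: "(t, x) \<in> {0<..<T} \<times> UNIV" using that by simp
    show ?thesis unfolding touches_above_continuous[OF cu' z] touches_below_continuous[OF cu z]
      by (intro ex_cong1 conj_cong refl ball_cong) auto
  qed
  have ineq: "((\<forall>i. x \<in> branch i - {origin} \<longrightarrow>
               time_deriv (\<lambda>z. - \<phi> z) t x + - H i (- branch_deriv i (\<lambda>z. - \<phi> z) t x) \<le> 0) \<and>
            (x = origin \<longrightarrow>
               time_deriv (\<lambda>z. - \<phi> z) t x + - F (- gradient_at_origin (\<lambda>z. - \<phi> z) t) \<le> 0 \<or>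
               (\<exists>i. time_deriv (\<lambda>z. - \<phi> z) t x + - H i (- branch_deriv i (\<lambda>z. - \<phi> z) t x) \<le> 0)))
     \<longleftrightarrow> ((\<forall>i. x \<in> branch i - {origin} \<longrightarrow>
               time_deriv \<phi> t x + H i (branch_deriv i \<phi> t x) \<ge> 0) \<and>
            (x = origin \<longrightarrow>
               time_deriv \<phi> t x + F (gradient_at_origin \<phi> t) \<ge> 0 \<or>
               (\<exists>i. time_deriv \<phi> t x + H i (branch_deriv i \<phi> t x) \<ge> 0)))"
    if "C1_test T \<phi>" "t \<in> {0<..<T}" for \<phi> t x
  proof -
    note td = time_deriv_uminus[OF that] and bd = branch_deriv_uminus[OF that]
    have gd: "- gradient_at_origin (\<lambda>z. - \<phi> z) t = gradient_at_origin \<phi> t"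
      by (simp add: vec_eq_iff gradient_at_origin_def bd[OF origin_in_branch])
    have e: "(- c + - b \<le> 0) = (0 \<le> c + b)" for b c :: real by auto
    show ?thesis
    proof (cases "x = origin")
      case True
      show ?thesis unfolding True gd td bd[OF origin_in_branch] minus_minus e by (rule refl)
    next
      case False
      then show ?thesis by (auto simp: td bd)
    qed
  qed
  show ?thesis
  proof
    assume sup: "relaxed_supersolution T H F u"
    show "relaxed_subsolution T (\<lambda>i p. - H i (- p)) (\<lambda>q. - F (- q)) (\<lambda>z. - u z)"
      unfolding relaxed_subsolution_def
    proof (intro allI impI ballI)
      fix \<phi> t x assume C1: "C1_test T \<phi>" and t: "t \<in> {0<..<T}"
        and tch: "touches_above ({0<..<T} \<times> UNIV) \<phi> (usc_env ({0..<T} \<times> UNIV) (\<lambda>z. - u z)) (t, x)"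
      note C1' = C1_test_uminus[OF C1]
      have "touches_below ({0<..<T} \<times> UNIV) (\<lambda>z. - \<phi> z) (lsc_env ({0..<T} \<times> UNIV) u) (t, x)"
        using touch[OF t, of "\<lambda>z. - \<phi> z" x] tch by simp
      with sup C1' t have "(\<forall>i. x \<in> branch i - {origin} \<longrightarrow>
               time_deriv (\<lambda>z. - \<phi> z) t x + H i (branch_deriv i (\<lambda>z. - \<phi> z) t x) \<ge> 0) \<and>
            (x = origin \<longrightarrow>
               time_deriv (\<lambda>z. - \<phi> z) t x + F (gradient_at_origin (\<lambda>z. - \<phi> z) t) \<ge> 0 \<or>
               (\<exists>i. time_deriv (\<lambda>z. - \<phi> z) t x + H i (branch_deriv i (\<lambda>z. - \<phi> z) t x) \<ge> 0))"
        unfolding relaxed_supersolution_def by blast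
      then show "(\<forall>i. x \<in> branch i - {origin} \<longrightarrow>
               time_deriv \<phi> t x + - H i (- branch_deriv i \<phi> t x) \<le> 0) \<and>
            (x = origin \<longrightarrow>
               time_deriv \<phi> t x + - F (- gradient_at_origin \<phi> t) \<le> 0 \<or>
               (\<exists>i. time_deriv \<phi> t x + - H i (- branch_deriv i \<phi> t x) \<le> 0))"
        using ineq[OF C1' t, of x] by simp
    qed
  next
    assume sub: "relaxed_subsolution T (\<lambda>i p. - H i (- p)) (\<lambda>q. - F (- q)) (\<lambda>z. - u z)"
    show "relaxed_supersolution T H F u"
      unfolding relaxed_supersolution_def
    proof (intro allI impI ballI)
      fix \<phi> t x assume C1: "C1_test T \<phi>" and t: "t \<in> {0<..<T}"
        and tch: "touches_below ({0<..<T} \<times> UNIV) \<phi> (lsc_env ({0..<T} \<times> UNIV) u) (t, x)"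
      have "touches_above ({0<..<T} \<times> UNIV) (\<lambda>z. - \<phi> z) (usc_env ({0..<T} \<times> UNIV) (\<lambda>z. - u z)) (t, x)"
        using touch[OF t, of \<phi> x] tch by simp
      with sub C1_test_uminus[OF C1] t show "(\<forall>i. x \<in> branch i - {origin} \<longrightarrow>
               time_deriv \<phi> t x + H i (branch_deriv i \<phi> t x) \<ge> 0) \<and>
            (x = origin \<longrightarrow>
               time_deriv \<phi> t x + F (gradient_at_origin \<phi> t) \<ge> 0 \<or>
               (\<exists>i. time_deriv \<phi> t x + H i (branch_deriv i \<phi> t x) \<ge> 0))"
        unfolding ineq[OF C1 t, symmetric] relaxed_subsolution_def by blast
    qed
  qed
qed

section \<open>Tools for the existence proof\<close>

lemma Rep_junction_nth: "0 \<le> r \<Longrightarrow> Rep_junction (branch_pt j r) $ i = (if j = i then r else 0)"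
  by (simp add: Rep_branch_pt axis_def)

lemma Rep_junction_Lipschitz: "\<bar>Rep_junction x $ i - Rep_junction y $ i\<bar> \<le> dist x (y :: ('n::finite) junction)"
proof -
  obtain j r where x: "0 \<le> r" "x = branch_pt j r" by (rule junction_cases)
  obtain k s where y: "0 \<le> s" "y = branch_pt k s" by (rule junction_cases)
  show ?thesis using x y by (auto simp: dist_branch_pt Rep_junction_nth)
qed

lemma continuous_on_Rep_junction_nth [continuous_intros]:
  assumes "continuous_on S f"
  shows "continuous_on S (\<lambda>z. Rep_junction (f z :: ('n::finite) junction) $ i)"
proof -
  have "continuous_on UNIV (\<lambda>x :: 'n junction. Rep_junction x $ i)"
    unfolding continuous_on_iff by (metis dist_real_def le_less_trans Rep_junction_Lipschitz)
  then show ?thesis by (rule continuous_on_compose2[OF _ assms]) auto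
qed

lemma near_branch_point:
  assumes "0 < r0" "dist x (branch_pt i r0) < r0"
  obtains r where "0 < r" "x = branch_pt i r" "dist x (branch_pt i r0) = \<bar>r - r0\<bar>"
proof -
  obtain j r where x: "0 \<le> r" "x = branch_pt j r" by (rule junction_cases)
  then show ?thesis using assms that[of r] by (cases "j = i") (auto simp: dist_branch_pt split: if_splits)
qed

lemma dist_origin: "0 \<le> r \<Longrightarrow> dist (branch_pt j r) origin = r"
  using dist_branch_pt[of r 0 j j] by (simp add: branch_pt_0)

text \<open>
  Used throughout to compare first derivatives at a contact point.
\<close>

lemma linear_le_quadratic:
  fixes c :: real
  assumes "e > 0" "\<And>h. 0 < h \<Longrightarrow> h < e \<Longrightarrow> c * h \<le> M * h\<^sup>2"
  shows "c \<le> 0"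
proof (rule ccontr)
  assume "\<not> ?thesis"
  define h where "h = min (e / 2) (c / (2 * (\<bar>M\<bar> + 1)))"
  have h: "0 < h" "h < e" "h \<le> c / (2 * (\<bar>M\<bar> + 1))"
    using assms(1) \<open>\<not> c \<le> 0\<close> by (auto simp: h_def)
  have "c * h \<le> M * h * h" using assms(2)[OF h(1,2)] by (simp add: power2_eq_square mult.assoc)
  then have "c \<le> M * h" using h(1) by simp
  also have "\<dots> \<le> (\<bar>M\<bar> + 1) * h" using h(1) by (intro mult_right_mono) auto
  also have "\<dots> \<le> (\<bar>M\<bar> + 1) * (c / (2 * (\<bar>M\<bar> + 1)))" using h(3) by (intro mult_left_mono) auto
  also have "\<dots> = c / 2"
  proof -
    have "x * (c / (2 * x)) = c / 2" if "x \<noteq> 0" for x using that by simp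
    then show ?thesis by (metis abs_ge_zero add_nonneg_eq_0_iff zero_le_one zero_neq_one)
  qed
  finally show False using \<open>\<not> c \<le> 0\<close> by simp
qed

lemma antimono_all_variables:
  fixes F :: "real ^ 'n::finite \<Rightarrow> real"
  assumes F: "nonincreasing_in_each_variable F" and le: "\<And>i. p $ i \<le> q $ i"
  shows "F q \<le> F p"
proof -
  define r where "r A = (\<chi> j. if j \<in> A then q $ j else p $ j)" for A
  have "F (r A) \<le> F p" if "finite A" for A
    using that
  proof (induction A)
    case empty
    have "r {} = p" by (simp add: r_def vec_eq_iff)
    then show ?case by simp
  next
    case (insert i A)
    have "r (insert i A) = (\<chi> j. if j = i then q $ i else r A $ j)"
      by (auto simp: r_def vec_eq_iff)
    moreover have "r A = (\<chi> j. if j = i then p $ i else r A $ j)"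
      using insert(2) by (auto simp: r_def vec_eq_iff)
    moreover have "F (\<chi> j. if j = i then q $ i else r A $ j) \<le> F (\<chi> j. if j = i then p $ i else r A $ j)"
      using F le[of i] unfolding nonincreasing_in_each_variable_def by (blast dest: antimonoD)
    ultimately show ?case using insert.IH by simp
  qed
  from this[of UNIV] have "F (r UNIV) \<le> F p" by simp
  moreover have "r UNIV = q" by (simp add: r_def vec_eq_iff)
  ultimately show ?thesis by simp
qed

definition quadratic_subsolution_at :: "('n::finite \<Rightarrow> real \<Rightarrow> real) \<Rightarrow> (real ^ 'n \<Rightarrow> real) \<Rightarrow> (real \<times> 'n junction \<Rightarrow> real) \<Rightarrow> real \<Rightarrow> 'n junction \<Rightarrow> bool" where
  "quadratic_subsolution_at H F u t x \<longleftrightarrow>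
     (\<forall>i r a q. x = branch_pt i r \<longrightarrow> 0 < r \<longrightarrow> upper_slope2 (\<lambda>t r. u (t, branch_pt i r)) t r a q \<longrightarrow> a + H i q \<le> 0) \<and>
     (\<forall>a q. x = origin \<longrightarrow> vertex_slope u t a q \<longrightarrow> a + F q \<le> 0 \<or> (\<exists>i. a + H i (q $ i) \<le> 0))"

lemma quadratic_subsolution_iff_quadratic_subsolution_at: "quadratic_subsolution H F u \<longleftrightarrow> (\<forall>t>0. \<forall>x. quadratic_subsolution_at H F u t x)"
  unfolding quadratic_subsolution_def quadratic_subsolution_at_def by blast

text \<open>
  The way in which maxima, time shifts and gluings of subsolutions are recognised as subsolutions: at each point
  it suffices to find one subsolution that touches from below, possibly at another time.
\<close>

lemma quadratic_subsolution_at_minorant: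
  assumes z: "quadratic_subsolution_at H F z s0 x0" and e: "e > 0"
    and le: "\<And>s x. \<bar>s - s0\<bar> < e \<Longrightarrow> dist x x0 < e \<Longrightarrow> z (s, x) - z (s0, x0) \<le> u (s - s0 + t0, x) - u (t0, x0)"
  shows "quadratic_subsolution_at H F u t0 x0"
  unfolding quadratic_subsolution_at_def
proof (intro conjI allI impI)
  fix i r0 a q assume x0: "x0 = branch_pt i r0" and r0: "0 < r0"
    and sl: "upper_slope2 (\<lambda>t r. u (t, branch_pt i r)) t0 r0 a q"
  obtain M d where d: "d > 0" "M \<ge> 0" "\<And>t' y'. \<bar>t' - t0\<bar> < d \<Longrightarrow> \<bar>y' - r0\<bar> < d \<Longrightarrow>
     u (t', branch_pt i y') \<le> u (t0, branch_pt i r0) + a * (t' - t0) + q * (y' - r0) + M * ((t' - t0)\<^sup>2 + (y' - r0)\<^sup>2)"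
    using upper_slope2E[OF sl] by metis
  have "upper_slope2 (\<lambda>t r. z (t, branch_pt i r)) s0 r0 a q"
  proof (rule upper_slope2I[where e = "min (min d e) r0" and M = M])
    fix s r assume s: "\<bar>s - s0\<bar> < min (min d e) r0" and r: "\<bar>r - r0\<bar> < min (min d e) r0"
    have "r > 0" using r by auto
    then have "dist (branch_pt i r) x0 < e" using r r0 by (simp add: x0 dist_branch_pt)
    then have "z (s, branch_pt i r) - z (s0, x0) \<le> u (s - s0 + t0, branch_pt i r) - u (t0, x0)"
      using le[of s "branch_pt i r"] s by simp
    then show "z (s, branch_pt i r) \<le> z (s0, branch_pt i r0) + a * (s - s0) + q * (r - r0) + M * ((s - s0)\<^sup>2 + (r - r0)\<^sup>2)"
      using d(3)[of "s - s0 + t0" r] s r by (simp add: x0)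
  qed (use d e r0 in auto)
  then show "a + H i q \<le> 0" using z x0 r0 unfolding quadratic_subsolution_at_def by blast
next
  fix a q assume x0: "x0 = origin" and sl: "vertex_slope u t0 a q"
  obtain M d where d: "d > 0" "\<And>i t' r. \<bar>t' - t0\<bar> < d \<Longrightarrow> 0 \<le> r \<Longrightarrow> r < d \<Longrightarrow>
     u (t', branch_pt i r) \<le> u (t0, origin) + a * (t' - t0) + q $ i * r + M * ((t' - t0)\<^sup>2 + r\<^sup>2)"
    using sl unfolding vertex_slope_def by blast
  have "vertex_slope z s0 a q"
  proof (rule vertex_slopeI[where e = "min d e" and M = M])
    fix i s r assume s: "\<bar>s - s0\<bar> < min d e" and r: "0 \<le> r" "r < min d e"
    have "dist (branch_pt i r) x0 < e" using r by (simp add: x0 dist_branch_pt flip: branch_pt_0[of i])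
    then have "z (s, branch_pt i r) - z (s0, x0) \<le> u (s - s0 + t0, branch_pt i r) - u (t0, x0)"
      using le[of s "branch_pt i r"] s by simp
    then show "z (s, branch_pt i r) \<le> z (s0, origin) + a * (s - s0) + q $ i * r + M * ((s - s0)\<^sup>2 + r\<^sup>2)"
      using d(2)[of "s - s0 + t0" r i] s r by (simp add: x0)
  qed (use d e in auto)
  then show "a + F q \<le> 0 \<or> (\<exists>i. a + H i (q $ i) \<le> 0)" using z x0 unfolding quadratic_subsolution_at_def by blast
qed

lemma quadratic_subsolution_at_mono:
  assumes "quadratic_subsolution_at H F z t0 x0" "z (t0, x0) = u (t0, x0)" "e > 0"
    and "\<And>t x. \<bar>t - t0\<bar> < e \<Longrightarrow> dist x x0 < e \<Longrightarrow> z (t, x) \<le> u (t, x)"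
  shows "quadratic_subsolution_at H F u t0 x0"
  by (rule quadratic_subsolution_at_minorant[OF assms(1,3)]) (use assms(2,4) in auto)

lemma dist_junction_Lipschitz:
  fixes f :: "('n::finite) junction \<Rightarrow> real"
  assumes "K \<ge> 0" "\<And>i r s. 0 \<le> r \<Longrightarrow> 0 \<le> s \<Longrightarrow> \<bar>f (branch_pt i r) - f (branch_pt i s)\<bar> \<le> K * \<bar>r - s\<bar>"
  shows "\<bar>f x - f y\<bar> \<le> K * dist x y"
proof -
  obtain i r where x: "0 \<le> r" "x = branch_pt i r" by (rule junction_cases)
  obtain j s where y: "0 \<le> s" "y = branch_pt j s" by (rule junction_cases)
  show ?thesis
  proof (cases "i = j")
    case True
    then show ?thesis using assms(2)[of r s i] x y by (simp add: dist_branch_pt)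
  next
    case False
    have "\<bar>f (branch_pt i r) - f origin\<bar> \<le> K * r" "\<bar>f (branch_pt j s) - f origin\<bar> \<le> K * s"
      using assms(2)[of r 0 i] assms(2)[of s 0 j] x y by (auto simp: branch_pt_0)
    then show ?thesis using x y False by (simp add: dist_branch_pt distrib_left)
  qed
qed

lemma upper_slope2_time:
  assumes "upper_slope2 A t y a q" "e > 0" "\<And>h. 0 < h \<Longrightarrow> h < e \<Longrightarrow> A t y - c * h \<le> A (t + h) y"
  shows "- c \<le> a"
proof -
  obtain M d where d: "d > 0" "\<And>t' y'. \<bar>t' - t\<bar> < d \<Longrightarrow> \<bar>y' - y\<bar> < d \<Longrightarrow>
       A t' y' \<le> A t y + a * (t' - t) + q * (y' - y) + M * ((t' - t)\<^sup>2 + (y' - y)\<^sup>2)"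
    using assms(1) unfolding upper_slope2_def by blast
  have "- c - a \<le> 0"
  proof (rule linear_le_quadratic[of "min d e" _ M])
    fix h assume h: "0 < h" "h < min d e"
    then show "(- c - a) * h \<le> M * h\<^sup>2"
      using d(2)[of "t + h" y] assms(3)[of h] d(1) by (simp add: left_diff_distrib)
  qed (use d assms in auto)
  then show ?thesis by simp
qed

text \<open>
  If the function decreases in time at rate at most \<open>C1\<close>, then a test function touching from above has time derivative at least
  \<open>- C1\<close>, so its slope \<open>q\<close> satisfies \<open>H\<^sub>i(q) \<le> C1\<close>.  Coercivity bounds \<open>q\<close>.
\<close>

lemma space_Lipschitz:
  fixes z :: "real \<times> ('n::finite) junction \<Rightarrow> real"
  assumes cz: "continuous_on ({0..} \<times> UNIV) z" and sz: "quadratic_subsolution H F z"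
    and mono: "\<And>t t' x. 0 \<le> t \<Longrightarrow> t \<le> t' \<Longrightarrow> z (t, x) - C1 * (t' - t) \<le> z (t', x)"
    and K: "\<And>i p. H i p \<le> C1 \<Longrightarrow> - K < p \<and> p < K"
    and t0: "0 < t0" and c: "0 \<le> c" "c < d"
  shows "\<bar>z (t0, branch_pt i d) - z (t0, branch_pt i c)\<bar> \<le> K * (d - c)"
proof (rule field_le_epsilon)
  fix \<epsilon> :: real assume \<epsilon>: "\<epsilon> > 0"
  define A where "A t y = z (t0 + t, branch_pt i (0 + 1 * y))" for t y
  define \<tau> where "\<tau> = t0 / 2"
  have \<tau>: "\<tau> > 0" "\<tau> < t0" using t0 by (auto simp: \<tau>_def)
  have cA: "continuous_on ({-\<tau>..\<tau>} \<times> {c..d}) (\<lambda>(t, y). A t y)"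
    unfolding A_def by (rule continuous_on_branch_affine[OF cz]) (use \<tau> c in auto)
  have comp: "compact ({-\<tau>..\<tau>} \<times> {c..d})" by (simp add: compact_Times)
  obtain B where B: "B > 0" "\<And>t y. \<bar>t\<bar> \<le> \<tau> \<Longrightarrow> c \<le> y \<Longrightarrow> y \<le> d \<Longrightarrow> \<bar>A t y\<bar> \<le> B"
  proof -
    have "bounded ((\<lambda>(t, y). A t y) ` ({-\<tau>..\<tau>} \<times> {c..d}))"
      by (intro compact_imp_bounded compact_continuous_image cA comp)
    then obtain B where "B > 0" "\<forall>w\<in>{-\<tau>..\<tau>} \<times> {c..d}. \<bar>case_prod A w\<bar> \<le> B"
      unfolding bounded_pos by auto
    then show ?thesis using that[of B] by force
  qed
  have "uniformly_continuous_on ({-\<tau>..\<tau>} \<times> {c..d}) (\<lambda>(t, y). A t y)"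
    by (rule compact_uniformly_continuous[OF cA comp])
  then obtain \<delta> where \<delta>: "\<delta> > 0" "\<And>w w'. w \<in> {-\<tau>..\<tau>} \<times> {c..d} \<Longrightarrow> w' \<in> {-\<tau>..\<tau>} \<times> {c..d} \<Longrightarrow> dist w' w < \<delta> \<Longrightarrow>
      dist (case_prod A w') (case_prod A w) < \<epsilon>"
    using \<epsilon> unfolding uniformly_continuous_on_def by blast
  define \<tau>1 where "\<tau>1 = min (\<tau> / 2) \<delta>"
  have \<tau>1: "\<tau>1 > 0" "\<tau>1 < \<tau>" "\<tau>1 \<le> \<delta>" using \<tau> \<delta> by (auto simp: \<tau>1_def)
  define N where "N = (2 * B + 1) / \<tau>1\<^sup>2"
  have N: "N > 0" "N * \<tau>1\<^sup>2 = 2 * B + 1" using B \<tau>1 by (auto simp: N_def)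
  have near: "A t y < A 0 y + \<epsilon>" if "\<bar>t\<bar> < \<tau>1" "c \<le> y" "y \<le> d" for t y
    using \<delta>(2)[of "(0, y)" "(t, y)"] that \<tau>1 \<tau> by (simp add: dist_Pair_Pair dist_real_def abs_less_iff)
  obtain V where V: "continuous_on {c..d} V"
    "\<And>y. c \<le> y \<Longrightarrow> y \<le> d \<Longrightarrow> \<exists>t. \<bar>t\<bar> < \<tau>1 \<and> V y = A t y - N * t\<^sup>2"
    "\<And>t y. c \<le> y \<Longrightarrow> y \<le> d \<Longrightarrow> \<bar>t\<bar> \<le> \<tau> \<Longrightarrow> A t y \<le> V y + N * t\<^sup>2"
    "\<And>y q. c < y \<Longrightarrow> y < d \<Longrightarrow> upper_slope V y q \<Longrightarrow> q \<in> {-K<..<K}"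
  proof (rule time_sup[OF \<tau>1(1,2) cA, of N "{-K<..<K}"])
    fix t y assume y: "c \<le> y" "y \<le> d" and t: "\<bar>t\<bar> \<le> \<tau>" "\<tau>1 \<le> \<bar>t\<bar>"
    have "\<tau>1\<^sup>2 \<le> t\<^sup>2" using t(2) \<tau>1(1) by (simp add: abs_le_square_iff[symmetric])
    then have "N * \<tau>1\<^sup>2 \<le> N * t\<^sup>2" using N by (intro mult_left_mono) auto
    then show "A t y - N * t\<^sup>2 < A 0 y" using B(2)[OF t(1) y] B(2)[OF _ y, of 0] \<tau> N(2) by linarith
  next
    fix t y q assume t: "\<bar>t\<bar> < \<tau>1" and y: "c < y" "y < d" and sl: "upper_slope2 A t y (2 * N * t) q"
    have tt: "t0 + t > 0" using t \<tau>1 \<tau> by auto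
    have "upper_slope2 (\<lambda>t r. z (t, branch_pt i r)) (t0 + t) (0 + 1 * y) (2 * N * t) (1 * q)"
      by (rule upper_slope2_affine) (use sl in \<open>simp_all add: A_def[abs_def]\<close>)
    then have sl': "upper_slope2 (\<lambda>t r. z (t, branch_pt i r)) (t0 + t) y (2 * N * t) q" by simp
    then have "2 * N * t + H i q \<le> 0" by (intro quadratic_subsolution_interior[OF sz]) (use tt y c in auto)
    moreover have "- C1 \<le> 2 * N * t"
      by (rule upper_slope2_time[OF sl', of 1]) (use mono[of "t0 + t" "t0 + t + _"] tt in auto)
    ultimately show "q \<in> {-K<..<K}" using K[of i q] by simp
  qed blast
  have Vd: "V d - V c \<le> K * (d - c)" by (rule slope_upper[OF c(2) V(1)]) (use V(4) in auto)
  have "- K * (d - c) \<le> V d - V c" by (rule slope_lower[OF c(2) V(1)]) (use V(4) in auto)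
  then have Vc: "- (K * (d - c)) \<le> V d - V c" by simp
  have Vn: "V y < A 0 y + \<epsilon>" if y: "c \<le> y" "y \<le> d" for y
  proof -
    obtain t where "\<bar>t\<bar> < \<tau>1" "V y = A t y - N * t\<^sup>2" using V(2)[OF y] by blast
    moreover have "0 \<le> N * t\<^sup>2" for t using N by simp
    ultimately show ?thesis using near[OF _ y, of t] by (smt (verit))
  qed
  have AV: "A 0 y \<le> V y" if "c \<le> y" "y \<le> d" for y using V(3)[OF that, of 0] \<tau> by simp
  have "\<bar>A 0 d - A 0 c\<bar> \<le> K * (d - c) + \<epsilon>"
    using Vd Vc Vn[of c] Vn[of d] c AV[of c] AV[of d] by (simp add: abs_le_iff)
  then show "\<bar>z (t0, branch_pt i d) - z (t0, branch_pt i c)\<bar> \<le> K * (d - c) + \<epsilon>" by (simp add: A_def)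
qed

lemma continuous_of_Lipschitz:
  fixes u :: "real \<times> ('n::finite) junction \<Rightarrow> real"
  assumes "C \<ge> 0" "K \<ge> 0"
    and t: "\<And>t s x. 0 \<le> t \<Longrightarrow> 0 \<le> s \<Longrightarrow> \<bar>u (t, x) - u (s, x)\<bar> \<le> C * \<bar>t - s\<bar>"
    and x: "\<And>t x y. 0 \<le> t \<Longrightarrow> \<bar>u (t, x) - u (t, y)\<bar> \<le> K * dist x y"
  shows "continuous_on ({0..} \<times> UNIV) u"
  unfolding continuous_on_iff
proof (intro ballI allI impI)
  fix z :: "real \<times> 'n junction" and \<epsilon> :: real assume z: "z \<in> {0..} \<times> UNIV" and \<epsilon>: "\<epsilon> > 0"
  define d where "d = \<epsilon> / (C + K + 1)"
  have d: "d > 0" "(C + K + 1) * d = \<epsilon>" using assms(1,2) \<epsilon> by (auto simp: d_def)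
  show "\<exists>d>0. \<forall>z'\<in>{0..} \<times> UNIV. dist z' z < d \<longrightarrow> dist (u z') (u z) < \<epsilon>"
  proof (intro exI[of _ d] conjI ballI impI d(1))
    fix z' assume z': "z' \<in> {0..} \<times> (UNIV :: 'n junction set)" "dist z' z < d"
    obtain t x s y where zz: "z = (t, x)" "z' = (s, y)" by (cases z, cases z')
    have "dist s t \<le> dist z' z" "dist y x \<le> dist z' z"
      unfolding zz by (metis dist_fst_le fst_conv, metis dist_snd_le snd_conv)
    then have st: "\<bar>s - t\<bar> < d" "dist y x < d" using z'(2) by (auto simp: dist_real_def)
    have "\<bar>u (s, y) - u (t, x)\<bar> \<le> C * \<bar>s - t\<bar> + K * dist y x"
      using t[of s t y] x[of t y x] z z' by (auto simp: zz)
    also have "\<dots> \<le> C * d + K * d" using st assms(1,2) by (intro add_mono mult_left_mono) auto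
    also have "\<dots> < \<epsilon>" using d by (simp add: distrib_right)
    finally show "dist (u z') (u z) < \<epsilon>" by (simp add: zz dist_real_def)
  qed
qed

section \<open>Perron solution for Lipschitz initial data\<close>

text \<open>
  The barriers \<open>u\<^sub>0 \<plusminus> C t\<close> are a sub- and a supersolution for this \<open>C\<close>; monotonicity of \<open>F\<close> is needed at the origin,
  where a test function touching a barrier from above has slopes at least \<open>- L0\<close>.
\<close>

locale perron =
  fixes H :: "'n::finite \<Rightarrow> real \<Rightarrow> real" and F :: "real ^ 'n \<Rightarrow> real" and u0 :: "'n junction \<Rightarrow> real"
    and L0 C K :: real
  assumes cH: "\<And>i. continuous_on UNIV (H i)" and cF: "continuous_on UNIV F"
    and F_mono: "nonincreasing_in_each_variable F"
    and u0: "\<And>x y. \<bar>u0 x - u0 y\<bar> \<le> L0 * dist x y"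
    and L0: "0 \<le> L0" and C0: "0 \<le> C"
    and HC: "\<And>i p. \<bar>p\<bar> \<le> L0 \<Longrightarrow> \<bar>H i p\<bar> \<le> C"
    and FC: "F (\<chi> i. - L0) \<le> C" "- C \<le> F (\<chi> i. L0)"
    and HK: "\<And>i p. H i p \<le> C + 1 \<Longrightarrow> - K < p \<and> p < K" and L0K: "L0 \<le> K"
begin

text \<open>
  The last condition makes candidates equi-Lipschitz in space.  The supremum turns out to decrease at rate at most \<open>C\<close>; the
  larger rate \<open>C + 1\<close> leaves room for raising it by a paraboloid.
\<close>

definition candidate :: "(real \<times> 'n junction \<Rightarrow> real) \<Rightarrow> bool" where
  "candidate z \<longleftrightarrow> continuous_on ({0..} \<times> UNIV) z \<and> quadratic_subsolution H F z \<and>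
     (\<forall>t\<ge>0. \<forall>x. z (t, x) \<le> u0 x + C * t) \<and>
     (\<forall>t t' x. 0 \<le> t \<longrightarrow> t \<le> t' \<longrightarrow> z (t, x) - (C + 1) * (t' - t) \<le> z (t', x))"

definition sol :: "real \<times> 'n junction \<Rightarrow> real" where
  "sol w = (SUP z\<in>{z. candidate z}. z w)"

lemma K0: "0 \<le> K" using L0 L0K by simp

lemma u0_branch:
  assumes "0 \<le> r" "0 \<le> s"
  shows "\<bar>u0 (branch_pt i r) - u0 (branch_pt i s)\<bar> \<le> L0 * \<bar>r - s\<bar>"
  using u0[of "branch_pt i r" "branch_pt i s"] assms by (simp add: dist_branch_pt)

lemma continuous_u0: "continuous_on UNIV u0"
  unfolding continuous_on_iff
proof (intro ballI allI impI)
  fix x \<epsilon> assume "(0::real) < \<epsilon>"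
  have "dist (u0 y) (u0 x) < \<epsilon>" if "dist y x < \<epsilon> / (L0 + 1)" for y
  proof -
    have "\<bar>u0 y - u0 x\<bar> \<le> (L0 + 1) * dist y x"
      using u0[of y x] zero_le_dist[of y x] unfolding distrib_right mult_1 by linarith
    also have "\<dots> < (L0 + 1) * (\<epsilon> / (L0 + 1))" using that L0 by (intro mult_strict_left_mono) auto
    also have "\<dots> = \<epsilon>" using L0 by simp
    finally show ?thesis by (simp add: dist_real_def)
  qed
  then show "\<exists>d>0. \<forall>y\<in>UNIV. dist y x < d \<longrightarrow> dist (u0 y) (u0 x) < \<epsilon>"
    using \<open>0 < \<epsilon>\<close> L0 by (intro exI[of _ "\<epsilon> / (L0 + 1)"]) auto
qed

lemma continuous_u0_comp [continuous_intros]: "continuous_on S f \<Longrightarrow> continuous_on S (\<lambda>z. u0 (f z))"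
  by (rule continuous_on_compose2[OF continuous_u0]) auto

lemma lower_barrier_quadratic_subsolution_at:
  assumes "t0 > 0"
  shows "quadratic_subsolution_at H F (\<lambda>w. u0 (snd w) - C * fst w) t0 x0"
  unfolding quadratic_subsolution_at_def
proof (intro conjI allI impI)
  fix i r0 a q assume r0: "0 < r0"
    and "upper_slope2 (\<lambda>t r. u0 (snd (t, branch_pt i r)) - C * fst (t, branch_pt i r)) t0 r0 a q"
  then obtain M d where d: "d > 0" "\<And>t r. \<bar>t - t0\<bar> < d \<Longrightarrow> \<bar>r - r0\<bar> < d \<Longrightarrow>
     u0 (branch_pt i r) - C * t \<le> u0 (branch_pt i r0) - C * t0 + a * (t - t0) + q * (r - r0) + M * ((t - t0)\<^sup>2 + (r - r0)\<^sup>2)"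
    unfolding upper_slope2_def by auto
  have "a + C \<le> 0"
  proof (rule linear_le_quadratic[OF d(1), of _ M])
    fix h assume "0 < h" "h < d"
    then show "(a + C) * h \<le> M * h\<^sup>2" using d(2)[of "t0 - h" r0] by (simp add: algebra_simps)
  qed
  moreover have "q - L0 \<le> 0"
  proof (rule linear_le_quadratic[of "min d r0" _ M])
    fix h assume h: "0 < h" "h < min d r0"
    then show "(q - L0) * h \<le> M * h\<^sup>2"
      using d(2)[of t0 "r0 - h"] u0_branch[of "r0 - h" r0 i] d(1) by (simp add: algebra_simps)
  qed (use d r0 in auto)
  moreover have "- L0 - q \<le> 0"
  proof (rule linear_le_quadratic[OF d(1), of _ M])
    fix h assume h: "0 < h" "h < d"
    then show "(- L0 - q) * h \<le> M * h\<^sup>2"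
      using d(2)[of t0 "r0 + h"] u0_branch[of "r0 + h" r0 i] d(1) r0 by (simp add: algebra_simps)
  qed
  ultimately have "a + C \<le> 0" "\<bar>q\<bar> \<le> L0" by auto
  with HC[of q i] show "a + H i q \<le> 0" by (auto simp: abs_le_iff)
next
  fix a q assume "vertex_slope (\<lambda>w. u0 (snd w) - C * fst w) t0 a q"
  then obtain M d where d: "d > 0" "\<And>i t r. \<bar>t - t0\<bar> < d \<Longrightarrow> 0 \<le> r \<Longrightarrow> r < d \<Longrightarrow>
     u0 (branch_pt i r) - C * t \<le> u0 origin - C * t0 + a * (t - t0) + q $ i * r + M * ((t - t0)\<^sup>2 + r\<^sup>2)"
    unfolding vertex_slope_def fst_conv snd_conv by blast
  have "a + C \<le> 0"
  proof (rule linear_le_quadratic[OF d(1), of _ M])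
    fix h assume "0 < h" "h < d"
    then show "(a + C) * h \<le> M * h\<^sup>2" using d(2)[of "t0 - h" 0] by (simp add: algebra_simps branch_pt_0)
  qed
  moreover have q: "- L0 - q $ i \<le> 0" for i
  proof (rule linear_le_quadratic[OF d(1), of _ M])
    fix h assume h: "0 < h" "h < d"
    then show "(- L0 - q $ i) * h \<le> M * h\<^sup>2"
      using d(2)[of t0 h i] u0_branch[of h 0 i] d(1) by (simp add: algebra_simps branch_pt_0)
  qed
  moreover have "F q \<le> F (\<chi> i. - L0)" by (rule antimono_all_variables[OF F_mono]) (use q in simp)
  ultimately show "a + F q \<le> 0 \<or> (\<exists>i. a + H i (q $ i) \<le> 0)" using FC by simp
qed

lemma candidate_lower_barrier: "candidate (\<lambda>w. u0 (snd w) - C * fst w)"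
  unfolding candidate_def
proof (intro conjI allI impI)
  show "quadratic_subsolution H F (\<lambda>w. u0 (snd w) - C * fst w)" unfolding quadratic_subsolution_iff_quadratic_subsolution_at using lower_barrier_quadratic_subsolution_at by blast
qed (auto intro!: continuous_intros simp: C0 algebra_simps)

lemma candidate_upper: "candidate z \<Longrightarrow> t \<ge> 0 \<Longrightarrow> z (t, x) \<le> u0 x + C * t"
  by (simp add: candidate_def)

lemma candidate_mono: "candidate z \<Longrightarrow> 0 \<le> t \<Longrightarrow> t \<le> t' \<Longrightarrow> z (t, x) - (C + 1) * (t' - t) \<le> z (t', x)"
  unfolding candidate_def by blast

lemma candidate_le_sol:
  assumes "candidate z" "t \<ge> 0"
  shows "z (t, x) \<le> sol (t, x)"
  unfolding sol_def
proof (rule cSUP_upper)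
  show "bdd_above ((\<lambda>z. z (t, x)) ` {z. candidate z})"
  proof (rule bdd_aboveI2)
    fix z assume "z \<in> {z. candidate z}"
    then show "z (t, x) \<le> u0 x + C * t" using candidate_upper[of z t x] assms(2) by simp
  qed
qed (use assms in simp)

lemma sol_least: "(\<And>z. candidate z \<Longrightarrow> z w \<le> c) \<Longrightarrow> sol w \<le> c"
  unfolding sol_def
proof (rule cSUP_least)
  show "{z. candidate z} \<noteq> {}" using candidate_lower_barrier by blast
qed simp

lemma sol_approx:
  assumes "\<epsilon> > 0"
  obtains z where "candidate z" "sol w - \<epsilon> < z w"
proof -
  have "\<not> (\<forall>z. candidate z \<longrightarrow> z w \<le> sol w - \<epsilon>)"
    using sol_least[of w "sol w - \<epsilon>"] assms by force
  then show ?thesis using that by (meson not_le)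
qed

lemma sol_upper: "t \<ge> 0 \<Longrightarrow> sol (t, x) \<le> u0 x + C * t"
  by (rule sol_least) (rule candidate_upper)

lemma sol_lower: "t \<ge> 0 \<Longrightarrow> u0 x - C * t \<le> sol (t, x)"
  using candidate_le_sol[OF candidate_lower_barrier, of t x] by simp

lemma sol_0: "sol (0, x) = u0 x"
  using sol_upper[of 0 x] sol_lower[of 0 x] by simp

lemma candidate_shift:
  assumes z: "candidate z" and h: "h \<ge> 0"
  shows "candidate (\<lambda>w. z (fst w + h, snd w) - C * h)"
  unfolding candidate_def
proof (intro conjI allI impI)
  have cz: "continuous_on ({0..} \<times> UNIV) z" and sz: "quadratic_subsolution H F z" using z by (auto simp: candidate_def)
  show "continuous_on ({0..} \<times> UNIV) (\<lambda>w. z (fst w + h, snd w) - C * h)"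
    by (intro continuous_on_diff continuous_on_const continuous_on_compose2[OF cz]) (use h in \<open>auto intro!: continuous_intros\<close>)
  show "quadratic_subsolution H F (\<lambda>w. z (fst w + h, snd w) - C * h)"
    unfolding quadratic_subsolution_iff_quadratic_subsolution_at
  proof (intro allI impI)
    fix t x assume "0 < (t::real)"
    then have "quadratic_subsolution_at H F z (t + h) x" using sz h unfolding quadratic_subsolution_iff_quadratic_subsolution_at by auto
    then show "quadratic_subsolution_at H F (\<lambda>w. z (fst w + h, snd w) - C * h) t x"
      by (rule quadratic_subsolution_at_minorant[of _ _ _ _ _ 1]) auto
  qed
  show "z (fst (t, x) + h, snd (t, x)) - C * h \<le> u0 x + C * t" if "0 \<le> t" for t x
    using candidate_upper[OF z, of "t + h" x] that h by (simp add: distrib_left)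
  show "z (fst (t, x) + h, snd (t, x)) - C * h - (C + 1) * (t' - t) \<le> z (fst (t', x) + h, snd (t', x)) - C * h"
    if "0 \<le> t" "t \<le> t'" for t t' x
  proof -
    have "z (t + h, x) - (C + 1) * ((t' + h) - (t + h)) \<le> z (t' + h, x)"
      by (rule candidate_mono[OF z]) (use that h in auto)
    then show ?thesis by simp
  qed
qed

text \<open>
  Starting \<open>z - C h\<close> from time \<open>h\<close> on, on top of the lower barrier.  For \<open>t \<le> h\<close> the delayed function is at most
  \<open>u\<^sub>0 - C h\<close> and hence below the barrier, so it matters only where it is a subsolution.
\<close>

lemma candidate_delay:
  assumes z: "candidate z" and h: "h \<ge> 0"
  shows "candidate (\<lambda>w. max (u0 (snd w) - C * fst w) (z (max (fst w - h) 0, snd w) - C * h))"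
    (is "candidate ?y")
  unfolding candidate_def
proof (intro conjI allI impI)
  have cz: "continuous_on ({0..} \<times> UNIV) z" and sz: "quadratic_subsolution H F z" using z by (auto simp: candidate_def)
  show "continuous_on ({0..} \<times> UNIV) ?y"
    by (intro continuous_on_max continuous_intros continuous_on_compose2[OF cz]) auto
  show "quadratic_subsolution H F ?y"
    unfolding quadratic_subsolution_iff_quadratic_subsolution_at
  proof (intro allI impI)
    fix t0 :: real and x0 assume t0: "0 < t0"
    show "quadratic_subsolution_at H F ?y t0 x0"
    proof (cases "z (max (t0 - h) 0, x0) - C * h \<le> u0 x0 - C * t0")
      case True
      show ?thesis
        by (rule quadratic_subsolution_at_mono[OF lower_barrier_quadratic_subsolution_at[OF t0], of _ _ 1]) (use True in auto)
    next
      case False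
      have th: "t0 > h"
      proof (rule ccontr)
        assume "\<not> t0 > h"
        then have "z (max (t0 - h) 0, x0) - C * h \<le> u0 x0 - C * h" using candidate_upper[OF z, of 0 x0] by simp
        also have "\<dots> \<le> u0 x0 - C * t0" using \<open>\<not> t0 > h\<close> C0 by (simp add: mult_left_mono)
        finally show False using False by simp
      qed
      have "quadratic_subsolution_at H F z (t0 - h) x0" using sz th unfolding quadratic_subsolution_iff_quadratic_subsolution_at by auto
      then show ?thesis
      proof (rule quadratic_subsolution_at_minorant[of _ _ _ _ _ "t0 - h"])
        fix s x assume s: "\<bar>s - (t0 - h)\<bar> < t0 - h"
        have "s > 0" using s by linarith
        then have "?y (s - (t0 - h) + t0, x) \<ge> z (s, x) - C * h" by simp
        moreover have "max (t0 - h) 0 = t0 - h" using th by simp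
        then have "?y (t0, x0) = z (t0 - h, x0) - C * h" using False by simp
        ultimately show "z (s, x) - z (t0 - h, x0) \<le> ?y (s - (t0 - h) + t0, x) - ?y (t0, x0)" by linarith
      qed (use th in auto)
    qed
  qed
  show "?y (t, x) \<le> u0 x + C * t" if t: "0 \<le> t" for t x
  proof -
    have "z (max (t - h) 0, x) \<le> u0 x + C * max (t - h) 0" by (rule candidate_upper[OF z]) simp
    moreover have "C * max (t - h) 0 \<le> C * t" using t h C0 by (intro mult_left_mono) auto
    moreover have "0 \<le> C * h" "0 \<le> C * t" using h C0 t by auto
    ultimately show ?thesis by simp
  qed
  show "?y (t, x) - (C + 1) * (t' - t) \<le> ?y (t', x)" if t: "0 \<le> t" "t \<le> t'" for t t' x
  proof -
    have "u0 x - C * t - (C + 1) * (t' - t) \<le> u0 x - C * t'" using t by (simp add: algebra_simps)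
    moreover have "z (max (t - h) 0, x) - (C + 1) * (max (t' - h) 0 - max (t - h) 0) \<le> z (max (t' - h) 0, x)"
      by (rule candidate_mono[OF z]) (use t in auto)
    moreover have "(C + 1) * (max (t' - h) 0 - max (t - h) 0) \<le> (C + 1) * (t' - t)"
      using C0 t by (intro mult_left_mono) auto
    ultimately show ?thesis by (simp add: max_def)
  qed
qed

text \<open>
  Both bounds come from shifting candidates in time: forward for the upper one, with a delay for the lower one.
\<close>

lemma sol_time:
  assumes "0 \<le> t" "t \<le> t'"
  shows "\<bar>sol (t', x) - sol (t, x)\<bar> \<le> C * (t' - t)"
proof -
  have "sol (t', x) \<le> sol (t, x) + C * (t' - t)"
  proof (rule sol_least)
    fix z assume z: "candidate z"
    show "z (t', x) \<le> sol (t, x) + C * (t' - t)"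
      using candidate_le_sol[OF candidate_shift[OF z, of "t' - t"] assms(1), of x] assms by simp
  qed
  moreover have "sol (t, x) \<le> sol (t', x) + C * (t' - t)"
  proof (rule sol_least)
    fix z assume z: "candidate z"
    show "z (t, x) \<le> sol (t', x) + C * (t' - t)"
      using candidate_le_sol[OF candidate_delay[OF z, of "t' - t"], of t' x] assms by (simp add: max_def split: if_splits)
  qed
  ultimately show ?thesis by linarith
qed

lemma sol_time_Lipschitz: "0 \<le> t \<Longrightarrow> 0 \<le> s \<Longrightarrow> \<bar>sol (t, x) - sol (s, x)\<bar> \<le> C * \<bar>t - s\<bar>"
  using sol_time[of s t x] sol_time[of t s x] by (cases "s \<le> t") auto

lemma candidate_branch:
  assumes z: "candidate z" and "0 < t" "0 \<le> r" "0 \<le> s"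
  shows "\<bar>z (t, branch_pt i r) - z (t, branch_pt i s)\<bar> \<le> K * \<bar>r - s\<bar>"
proof -
  have *: "\<bar>z (t, branch_pt i d) - z (t, branch_pt i c)\<bar> \<le> K * (d - c)" if "0 \<le> c" "c < d" for c d
    by (rule space_Lipschitz[where z = z and F = F and H = H and ?C1.0 = "C + 1"]) (use z assms(2) that HK in \<open>auto simp: candidate_def\<close>)
  show ?thesis using *[of s r] *[of r s] assms by (cases r s rule: linorder_cases) (auto simp: abs_minus_commute)
qed

lemma sol_space_Lipschitz:
  assumes "0 \<le> t"
  shows "\<bar>sol (t, x) - sol (t, y)\<bar> \<le> K * dist x y"
proof (rule dist_junction_Lipschitz[OF K0])
  fix i and r s :: real assume rs: "0 \<le> r" "0 \<le> s"
  have *: "sol (t, branch_pt i r) \<le> sol (t, branch_pt i s) + K * \<bar>r - s\<bar>" if rs: "0 \<le> r" "0 \<le> s" for r s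
  proof (cases "t = 0")
    case True
    have "L0 * \<bar>r - s\<bar> \<le> K * \<bar>r - s\<bar>" using L0K by (intro mult_right_mono) auto
    then show ?thesis using u0_branch[OF rs, of i] True by (simp add: sol_0)
  next
    case False
    show ?thesis
    proof (rule sol_least)
      fix z assume z: "candidate z"
      show "z (t, branch_pt i r) \<le> sol (t, branch_pt i s) + K * \<bar>r - s\<bar>"
        using candidate_branch[OF z _ rs, of t i] candidate_le_sol[OF z assms, of "branch_pt i s"] False assms by force
    qed
  qed
  show "\<bar>sol (t, branch_pt i r) - sol (t, branch_pt i s)\<bar> \<le> K * \<bar>r - s\<bar>"
    using *[OF rs] *[OF rs(2,1)] by (simp add: abs_minus_commute abs_le_iff)
qed

lemma continuous_sol: "continuous_on ({0..} \<times> UNIV) sol"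
proof (rule continuous_of_Lipschitz[where u = sol, OF C0 K0])
  show "\<bar>sol (t, x) - sol (s, x)\<bar> \<le> C * \<bar>t - s\<bar>" if "0 \<le> t" "0 \<le> s" for t s x
    by (rule sol_time_Lipschitz[OF that])
  show "\<bar>sol (t, x) - sol (t, y)\<bar> \<le> K * dist x y" if "0 \<le> t" for t x y
    by (rule sol_space_Lipschitz[OF that])
qed

lemma quadratic_subsolution_sol: "quadratic_subsolution H F sol"
proof (rule quadratic_subsolution_stable[OF cH cF])
  fix \<epsilon> t0 :: real and x0 assume e: "\<epsilon> > 0" "t0 > 0"
  obtain z where z: "candidate z" "sol (t0, x0) - \<epsilon> < z (t0, x0)" using sol_approx[OF e(1)] .
  have "z (t, x) \<le> sol (t, x) + \<epsilon>" if "t \<ge> 0" for t x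
    using candidate_le_sol[OF z(1) that, of x] e(1) by linarith
  moreover have "continuous_on ({0..} \<times> UNIV) z" "quadratic_subsolution H F z" using z(1) unfolding candidate_def by blast+
  ultimately show "\<exists>z. continuous_on ({0..} \<times> UNIV) z \<and> quadratic_subsolution H F z \<and> sol (t0, x0) - \<epsilon> \<le> z (t0, x0) \<and>
      (\<forall>t\<ge>0. \<forall>x. z (t, x) \<le> sol (t, x) + \<epsilon>)"
    using less_imp_le[OF z(2)] by blast
qed

text \<open>
  Perron's argument.  Suppose \<open>sol\<close> is touched from below, strictly under the upper barrier, by a paraboloid that is a
  strict subsolution near the contact point.  A large quadratic coefficient \<open>N\<close> makes the paraboloid lie below \<open>sol\<close>
  everywhere, since \<open>sol\<close> is Lipschitz; raised by \<open>\<rho>\<^sup>2\<close> it exceeds \<open>sol\<close> only within distance \<open>\<rho>\<close> of the contact point.  The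
  maximum of both is a candidate larger than \<open>sol\<close>.
\<close>

lemma bump:
  assumes t0: "0 < t0" and clin: "continuous_on UNIV lin" and lin0: "lin x0 = 0"
    and linL: "\<And>x. \<bar>lin x\<bar> \<le> L * dist x x0" and L: "L \<ge> 0"
    and near: "e > 0" "\<And>t x. \<bar>t - t0\<bar> < e \<Longrightarrow> dist x x0 < e \<Longrightarrow>
        sol (t0, x0) + a * (t - t0) + lin x - M * ((t - t0)\<^sup>2 + (dist x x0)\<^sup>2) \<le> sol (t, x)"
    and below: "sol (t0, x0) < u0 x0 + C * t0" and a: "- C \<le> a"
    and sub: "\<And>N c. \<exists>e>0. \<forall>t x. \<bar>t - t0\<bar> < e \<longrightarrow> dist x x0 < e \<longrightarrow>
        quadratic_subsolution_at H F (\<lambda>w. c + a * (fst w - t0) + lin (snd w) - N * ((fst w - t0)\<^sup>2 + (dist (snd w) x0)\<^sup>2)) t x"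
  shows False
proof -
  define S where "S = \<bar>a\<bar> + C + L + K"
  have S: "S \<ge> 0" using C0 K0 L by (simp add: S_def)
  define N where "N = \<bar>M\<bar> + 1 + S / e"
  have N: "N - 1 \<ge> M" "N - 1 \<ge> S / e" "N > 0" 
  proof -
    have "S / e \<ge> 0" using S near(1) by simp
    then show "N - 1 \<ge> M" "N - 1 \<ge> S / e" "N > 0" unfolding N_def by linarith+
  qed
  define P where "P t x = sol (t0, x0) + a * (t - t0) + lin x - N * ((t - t0)\<^sup>2 + (dist x x0)\<^sup>2)" for t x
  have P: "P t x + ((t - t0)\<^sup>2 + (dist x x0)\<^sup>2) \<le> sol (t, x)" if t: "t \<ge> 0" for t x
  proof -
    define D where "D = (t - t0)\<^sup>2 + (dist x x0)\<^sup>2"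
    have D0: "D \<ge> 0" by (simp add: D_def)
    have PD: "P t x + D = sol (t0, x0) + a * (t - t0) + lin x - (N - 1) * D"
      by (simp add: P_def D_def left_diff_distrib)
    have "P t x + D \<le> sol (t, x)"
    proof (cases "\<bar>t - t0\<bar> < e \<and> dist x x0 < e")
      case True
      have "M * D \<le> (N - 1) * D" using N D0 by (intro mult_right_mono) auto
      then show ?thesis using near(2)[of t x, folded D_def] True unfolding PD by linarith
    next
      case False
      define m where "m = max \<bar>t - t0\<bar> (dist x x0)"
      have m: "\<bar>t - t0\<bar> \<le> m" "dist x x0 \<le> m" by (simp_all add: m_def)
      have "m \<ge> e" "m \<ge> 0" using False m abs_ge_zero[of "t - t0"] by linarith+
      note m = this(1) m this(2)
      have mD: "m\<^sup>2 \<le> D"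
      proof (cases "\<bar>t - t0\<bar> \<le> dist x x0")
        case True
        then have "m = dist x x0" by (simp add: m_def)
        then show ?thesis by (simp add: D_def)
      next
        case False
        then have "m = \<bar>t - t0\<bar>" by (simp add: m_def)
        then show ?thesis by (simp add: D_def)
      qed
      have "e * m \<le> m * m" using m by (intro mult_right_mono) auto
      then have "e * m \<le> D" using mD by (simp add: power2_eq_square)
      then have "S / e * (e * m) \<le> S / e * D"
        using S near(1) by (intro mult_left_mono) auto
      also have "\<dots> \<le> (N - 1) * D" using N D0 by (intro mult_right_mono) auto
      finally have SD: "S * m \<le> (N - 1) * D" using near(1) by simp
      have "a * (t - t0) \<le> \<bar>a\<bar> * \<bar>t - t0\<bar>" by (metis abs_ge_self abs_mult)
      also have "\<dots> \<le> \<bar>a\<bar> * m" using m by (intro mult_left_mono) auto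
      finally have 1: "a * (t - t0) \<le> \<bar>a\<bar> * m" .
      have "lin x \<le> L * dist x x0" using linL[of x] by simp
      also have "\<dots> \<le> L * m" using m L by (intro mult_left_mono) auto
      finally have 2: "lin x \<le> L * m" .
      have "C * \<bar>t - t0\<bar> \<le> C * m" "K * dist x x0 \<le> K * m" using m C0 K0 by (auto intro!: mult_left_mono)
      then have "sol (t, x) \<ge> sol (t0, x0) - C * m - K * m"
        using sol_time_Lipschitz[of t t0 x] sol_space_Lipschitz[of t0 x x0] t t0 by linarith
      then show ?thesis using 1 2 SD unfolding PD S_def by (simp add: distrib_right)
    qed
    then show ?thesis by (simp add: D_def)
  qed
  define gap where "gap = u0 x0 + C * t0 - sol (t0, x0)"
  have gap: "gap > 0" using below by (simp add: gap_def)
  obtain e1 where e1: "e1 > 0" and subP: "\<And>t x c. \<bar>t - t0\<bar> < e1 \<Longrightarrow> dist x x0 < e1 \<Longrightarrow>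
      quadratic_subsolution_at H F (\<lambda>w. P (fst w) (snd w) + c) t x"
  proof -
    obtain e1 where e1: "e1 > 0" "\<And>t x. \<bar>t - t0\<bar> < e1 \<Longrightarrow> dist x x0 < e1 \<Longrightarrow>
        quadratic_subsolution_at H F (\<lambda>w. sol (t0, x0) + a * (fst w - t0) + lin (snd w) - N * ((fst w - t0)\<^sup>2 + (dist (snd w) x0)\<^sup>2)) t x"
      using sub[of "sol (t0, x0)" N] by blast
    show ?thesis
    proof (rule that[OF e1(1)])
      fix t x and c :: real assume tx: "\<bar>t - t0\<bar> < e1" "dist x x0 < e1"
      show "quadratic_subsolution_at H F (\<lambda>w. P (fst w) (snd w) + c) t x"
        by (rule quadratic_subsolution_at_minorant[OF e1(2)[OF tx], of 1]) (auto simp: P_def)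
    qed
  qed
  define G where "G = \<bar>a\<bar> + L + L0 + C + 1"
  have G: "G \<ge> 1" using C0 L0 L by (simp add: G_def)
  \<comment> \<open>In turn: the paraboloid is a subsolution, time is positive, its rate is at least \<open>- (C + 1)\<close>, \<open>\<rho>\<^sup>2 \<le> \<rho>\<close>, and it stays below the upper barrier.\<close>
  define \<rho> where "\<rho> = Min {e1 / 2, t0 / 2, 1 / (2 * N), 1, gap / G}"
  have \<rho>: "\<rho> > 0" "\<rho> < e1" "\<rho> < t0" "\<rho> \<le> 1 / (2 * N)" "\<rho> \<le> 1" "\<rho> \<le> gap / G"
  proof -
    have "\<rho> \<le> e1 / 2" "\<rho> \<le> t0 / 2" unfolding \<rho>_def by (rule Min_le; simp)+
    then show "\<rho> < e1" "\<rho> < t0" using e1 t0 by auto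
    show "\<rho> > 0" using e1 t0 N gap G by (auto simp: \<rho>_def)
    show "\<rho> \<le> 1 / (2 * N)" "\<rho> \<le> 1" "\<rho> \<le> gap / G" unfolding \<rho>_def by (rule Min_le; simp)+
  qed
  have N\<rho>: "2 * N * \<rho> \<le> 1" using \<rho>(4) N(3) by (simp add: pos_le_divide_eq mult.commute)
  have G\<rho>: "G * \<rho> \<le> gap" using \<rho>(6) G by (simp add: pos_le_divide_eq mult.commute)
  define Q where "Q t x = P t x + \<rho>\<^sup>2" for t x
  have small: "\<bar>t - t0\<bar> < \<rho> \<and> dist x x0 < \<rho>" if "t \<ge> 0" "sol (t, x) < Q t x" for t x
  proof -
    have "(t - t0)\<^sup>2 + (dist x x0)\<^sup>2 < \<rho>\<^sup>2" using P[OF that(1), of x] that(2) by (simp add: Q_def)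
    then have "\<bar>t - t0\<bar>\<^sup>2 < \<rho>\<^sup>2" "(dist x x0)\<^sup>2 < \<rho>\<^sup>2" by (auto intro: le_less_trans[rotated])
    then show ?thesis using \<rho>(1) by (auto intro: power2_less_imp_less)
  qed
  define z where "z w = max (sol w) (Q (fst w) (snd w))" for w
  have "candidate z"
    unfolding candidate_def
  proof (intro conjI allI impI)
    have "continuous_on S lin" for S by (rule continuous_on_subset[OF clin]) simp
    then have "continuous_on ({0..} \<times> UNIV) (\<lambda>w::real \<times> 'n junction. lin (snd w))"
      by (rule continuous_on_compose2) (auto intro!: continuous_intros)
    then show "continuous_on ({0..} \<times> UNIV) z"
      unfolding z_def Q_def P_def by (intro continuous_intros continuous_sol)
    show "quadratic_subsolution H F z"
      unfolding quadratic_subsolution_iff_quadratic_subsolution_at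
    proof (intro allI impI)
      fix t x assume t: "0 < (t::real)"
      show "quadratic_subsolution_at H F z t x"
      proof (cases "sol (t, x) < Q t x")
        case True
        have tx: "\<bar>t - t0\<bar> < e1" "dist x x0 < e1" using small[of t x] True t \<rho> by auto
        show ?thesis
          by (rule quadratic_subsolution_at_mono[OF subP[OF tx, of "\<rho>\<^sup>2"], of _ 1]) (use True in \<open>auto simp: z_def Q_def\<close>)
      next
        case False
        have "quadratic_subsolution_at H F sol t x" using quadratic_subsolution_sol t by (simp add: quadratic_subsolution_iff_quadratic_subsolution_at)
        then show ?thesis by (rule quadratic_subsolution_at_mono[of _ _ _ _ _ _ 1]) (use False in \<open>auto simp: z_def\<close>)
      qed
    qed
    show "z (t, x) \<le> u0 x + C * t" if t: "0 \<le> t" for t x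
    proof (cases "sol (t, x) < Q t x")
      case True
      then have tx: "\<bar>t - t0\<bar> < \<rho>" "dist x x0 < \<rho>" using small[OF t] by auto
      have "a * (t - t0) \<le> \<bar>a\<bar> * \<bar>t - t0\<bar>" by (metis abs_ge_self abs_mult)
      also have "\<dots> \<le> \<bar>a\<bar> * \<rho>" using tx by (intro mult_left_mono) auto
      finally have 1: "a * (t - t0) \<le> \<bar>a\<bar> * \<rho>" .
      have "lin x \<le> L * dist x x0" using linL[of x] by simp
      also have "\<dots> \<le> L * \<rho>" using tx L by (intro mult_left_mono) auto
      finally have 2: "lin x \<le> L * \<rho>" .
      have 3: "L0 * dist x x0 \<le> L0 * \<rho>" "C * \<bar>t - t0\<bar> \<le> C * \<rho>" using tx C0 L0 by (auto intro!: mult_left_mono)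
      have 4: "C * t0 - C * t \<le> C * \<bar>t - t0\<bar>"
        using C0 by (simp flip: right_diff_distrib) (intro mult_left_mono, auto)
      have 5: "\<rho>\<^sup>2 \<le> \<rho>" using \<rho> by (simp add: power2_eq_square mult_left_le)
      have 6: "0 \<le> N * ((t - t0)\<^sup>2 + (dist x x0)\<^sup>2)" using N by simp
      have "Q t x \<le> u0 x + C * t"
        using 1 2 3 4 5 6 u0[of x0 x] G\<rho> unfolding Q_def P_def gap_def G_def distrib_right
        by (simp add: dist_commute)
      then show ?thesis using sol_upper[OF t, of x] by (simp add: z_def)
    qed (use sol_upper[OF t, of x] in \<open>simp add: z_def\<close>)
    show "z (t, x) - (C + 1) * (t' - t) \<le> z (t', x)" if t: "0 \<le> t" "t \<le> t'" for t t' x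
    proof -
      have mono: "sol (s, x) - (C + 1) * (s' - s) \<le> sol (s', x)" if "0 \<le> s" "s \<le> s'" for s s'
        using sol_time[OF that, of x] that by (simp add: distrib_right abs_le_iff)
      show ?thesis
      proof (cases "sol (t, x) < Q t x")
        case False
        then show ?thesis using mono[OF t] by (simp add: z_def)
      next
        case True
        then have tt: "\<bar>t - t0\<bar> < \<rho>" using small[OF t(1)] by auto
        define s where "s = min t' (t0 + \<rho>)"
        have s: "t \<le> s" "s \<le> t'" "s - t0 \<le> \<rho>" using t tt by (auto simp: s_def)
        have "Q s x - Q t x = (s - t) * (a - N * ((s - t0) + (t - t0)))"
          by (simp add: Q_def P_def power2_eq_square algebra_simps)
        also have "\<dots> \<ge> (s - t) * (- (C + 1))"
        proof (rule mult_left_mono)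
          have "N * ((s - t0) + (t - t0)) \<le> N * (2 * \<rho>)" using s tt N by (intro mult_left_mono) auto
          then show "- (C + 1) \<le> a - N * ((s - t0) + (t - t0))" using N\<rho> a by (simp add: mult_ac)
        qed (use s in auto)
        finally have Q: "Q t x - (C + 1) * (s - t) \<le> Q s x" by (simp add: algebra_simps)
        show ?thesis
        proof (cases "t' \<le> t0 + \<rho>")
          case True
          then have "s = t'" by (simp add: s_def)
          \<comment> \<open>The paraboloid itself decreases at rate at most \<open>C + 1\<close> up to time \<open>t0 + \<rho>\<close>.\<close>
          then show ?thesis using Q \<open>sol (t, x) < Q t x\<close> by (simp add: z_def)
        next
          case False
          then have "s = t0 + \<rho>" by (simp add: s_def)
          \<comment> \<open>After time \<open>t0 + \<rho>\<close> the rate is that of \<open>sol\<close>, which is above the paraboloid again.\<close>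
          then have "Q s x \<le> sol (s, x)" using small[of s x] t0 \<rho> by force
          moreover have "sol (s, x) - (C + 1) * (t' - s) \<le> sol (t', x)" using mono[of s t'] s t by simp
          moreover have "(C + 1) * (t' - t) = (C + 1) * (t' - s) + (C + 1) * (s - t)" by (simp add: algebra_simps)
          ultimately show ?thesis using Q True by (simp add: z_def)
        qed
      qed
    qed
  qed
  then have "z (t0, x0) \<le> sol (t0, x0)" by (rule candidate_le_sol) (use t0 in simp)
  then show False using \<rho>(1) by (simp add: z_def Q_def P_def lin0)
qed

text \<open>
  Time slopes of functions touching \<open>sol\<close> from below are at least \<open>- C\<close>, and at least \<open>C\<close> where \<open>sol\<close> meets the upper barrier.
\<close>

lemma below_barrier_time:
  assumes t0: "0 < t0" and d: "d > 0"
    and tch: "\<And>t. \<bar>t - t0\<bar> < d \<Longrightarrow> sol (t0, x0) + a * (t - t0) - M * (t - t0)\<^sup>2 \<le> sol (t, x0)"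
  shows "- C \<le> a" and "u0 x0 + C * t0 \<le> sol (t0, x0) \<Longrightarrow> C \<le> a"
proof -
  have "- C - a \<le> 0"
  proof (rule linear_le_quadratic[of "min d t0" _ M])
    fix h assume h: "0 < h" "h < min d t0"
    then have "\<bar>t0 - h - t0\<bar> < d" by simp
    from tch[OF this] have "sol (t0, x0) - a * h - M * h\<^sup>2 \<le> sol (t0 - h, x0)" by simp
    moreover have "sol (t0 - h, x0) - C * h \<le> sol (t0, x0)" using sol_time[of "t0 - h" t0 x0] h by simp
    ultimately show "(- C - a) * h \<le> M * h\<^sup>2" by (simp add: left_diff_distrib)
  qed (use d t0 in auto)
  then show "- C \<le> a" by simp
  assume top: "u0 x0 + C * t0 \<le> sol (t0, x0)"
  have "C - a \<le> 0"
  proof (rule linear_le_quadratic[of "min d t0" _ M])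
    fix h assume h: "0 < h" "h < min d t0"
    then have "\<bar>t0 - h - t0\<bar> < d" by simp
    from tch[OF this] have "sol (t0, x0) - a * h - M * h\<^sup>2 \<le> sol (t0 - h, x0)" by simp
    moreover have "sol (t0 - h, x0) \<le> u0 x0 + C * (t0 - h)" using h by (intro sol_upper) auto
    ultimately show "(C - a) * h \<le> M * h\<^sup>2" using top by (simp add: left_diff_distrib right_diff_distrib)
  qed (use d t0 in auto)
  then show "C \<le> a" by simp
qed

lemma slope_of_smooth:
  assumes sl: "upper_slope2 A t y a q" and d: "d > 0"
    and t: "\<And>h. \<bar>h\<bar> < d \<Longrightarrow> A (t + h) y = A t y + b * h - N * h\<^sup>2"
    and y: "\<And>h. \<bar>h\<bar> < d \<Longrightarrow> A t (y + h) = A t y + p * h - N * h\<^sup>2"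
  shows "a = b" "q = p"
proof -
  obtain M e where e: "e > 0" "\<And>t' y'. \<bar>t' - t\<bar> < e \<Longrightarrow> \<bar>y' - y\<bar> < e \<Longrightarrow>
       A t' y' \<le> A t y + a * (t' - t) + q * (y' - y) + M * ((t' - t)\<^sup>2 + (y' - y)\<^sup>2)"
    using sl unfolding upper_slope2_def by blast
  have "b - a \<le> 0"
  proof (rule linear_le_quadratic[of "min d e" _ "M + N"])
    fix h assume "0 < h" "h < min d e"
    then show "(b - a) * h \<le> (M + N) * h\<^sup>2" using e(2)[of "t + h" y] t[of h] e(1) by (simp add: algebra_simps)
  qed (use d e in auto)
  moreover have "a - b \<le> 0"
  proof (rule linear_le_quadratic[of "min d e" _ "M + N"])
    fix h assume "0 < h" "h < min d e"
    then show "(a - b) * h \<le> (M + N) * h\<^sup>2" using e(2)[of "t - h" y] t[of "- h"] e(1) by (simp add: algebra_simps)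
  qed (use d e in auto)
  moreover have "p - q \<le> 0"
  proof (rule linear_le_quadratic[of "min d e" _ "M + N"])
    fix h assume "0 < h" "h < min d e"
    then show "(p - q) * h \<le> (M + N) * h\<^sup>2" using e(2)[of t "y + h"] y[of h] e(1) by (simp add: algebra_simps)
  qed (use d e in auto)
  moreover have "q - p \<le> 0"
  proof (rule linear_le_quadratic[of "min d e" _ "M + N"])
    fix h assume "0 < h" "h < min d e"
    then show "(q - p) * h \<le> (M + N) * h\<^sup>2" using e(2)[of t "y - h"] y[of "- h"] e(1) by (simp add: algebra_simps)
  qed (use d e in auto)
  ultimately show "a = b" "q = p" by auto
qed

text \<open>
  If the inequality failed, the touching paraboloid would be a strict subsolution, contrary to \<open>bump\<close>.  Contact with the upper
  barrier is excluded, since there \<open>C \<le> a\<close> and \<open>\<bar>q\<bar> \<le> L0\<close>.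
\<close>

lemma sol_super_interior:
  assumes t0: "0 < t0" and r0: "0 < r0"
    and sl: "upper_slope2 (\<lambda>t r. - sol (t, branch_pt i r)) t0 r0 (- a) (- q)"
  shows "0 \<le> a + H i q"
proof (rule ccontr)
  assume neg: "\<not> ?thesis"
  define x0 where "x0 = branch_pt i r0"
  obtain M d where d: "d > 0" "M \<ge> 0" "\<And>t' y'. \<bar>t' - t0\<bar> < d \<Longrightarrow> \<bar>y' - r0\<bar> < d \<Longrightarrow>
     - sol (t', branch_pt i y') \<le> - sol (t0, branch_pt i r0) + - a * (t' - t0) + - q * (y' - r0)
       + M * ((t' - t0)\<^sup>2 + (y' - r0)\<^sup>2)"
    using upper_slope2E[OF sl] by metis
  have tch: "sol (t0, x0) + a * (t - t0) + q * (r - r0) - M * ((t - t0)\<^sup>2 + (r - r0)\<^sup>2) \<le> sol (t, branch_pt i r)"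
    if "\<bar>t - t0\<bar> < d" "\<bar>r - r0\<bar> < d" for t r
    using d(3)[OF that] by (simp add: x0_def)
  have tt: "sol (t0, x0) + a * (t - t0) - M * (t - t0)\<^sup>2 \<le> sol (t, x0)" if "\<bar>t - t0\<bar> < d" for t
    using tch[of t r0] that d by (simp add: x0_def)
  have aC: "- C \<le> a" by (rule below_barrier_time(1)[OF t0 d(1) tt])
  have below: "sol (t0, x0) < u0 x0 + C * t0"
  proof (rule ccontr)
    assume "\<not> ?thesis"
    then have top: "u0 x0 + C * t0 \<le> sol (t0, x0)" by simp
    have "C \<le> a" by (rule below_barrier_time(2)[OF t0 d(1) tt top])
    moreover have br: "q * (r - r0) - M * (r - r0)\<^sup>2 \<le> L0 * \<bar>r - r0\<bar>" if "\<bar>r - r0\<bar> < min d r0" for r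
    proof -
      have "r > 0" using that by auto
      then show ?thesis
        using tch[of t0 r] that d sol_upper[of t0 "branch_pt i r"] top t0 u0_branch[of r r0 i] r0 by (simp add: x0_def)
    qed
    have "q - L0 \<le> 0"
    proof (rule linear_le_quadratic[of "min d r0" _ M])
      fix h assume "0 < h" "h < min d r0"
      then show "(q - L0) * h \<le> M * h\<^sup>2" using br[of "r0 + h"] by (simp add: left_diff_distrib)
    qed (use d r0 in auto)
    moreover have "- q - L0 \<le> 0"
    proof (rule linear_le_quadratic[of "min d r0" _ M])
      fix h assume "0 < h" "h < min d r0"
      then show "(- q - L0) * h \<le> M * h\<^sup>2" using br[of "r0 - h"] by (simp add: left_diff_distrib)
    qed (use d r0 in auto)
    ultimately show False using HC[of q i] neg by (simp add: abs_le_iff)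
  qed
  define lin where "lin x = q * (Rep_junction x $ i - r0)" for x :: "'n junction"
  have linb: "lin (branch_pt i r) = q * (r - r0)" if "0 \<le> r" for r using that by (simp add: lin_def Rep_junction_nth)
  obtain e0 where e0: "e0 > 0" "\<And>a' q'. \<bar>a' + a\<bar> \<le> e0 \<Longrightarrow> \<bar>q' - q\<bar> \<le> e0 \<Longrightarrow> a' - H i q' > 0"
  proof -
    have "continuous_on UNIV (\<lambda>p. - H i p)" by (intro continuous_on_minus cH)
    moreover have "- a + - H i q > 0" using neg by simp
    ultimately show ?thesis using that interior_pos_near[of "\<lambda>p. - H i p" "- a" q] by auto
  qed
  show False
  proof (rule bump[where lin = lin and ?x0.0 = x0 and L = "\<bar>q\<bar>" and e = "min d r0" and M = M, OF t0])
    show "continuous_on UNIV lin" unfolding lin_def[abs_def] by (intro continuous_intros)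
    show "lin x0 = 0" using r0 by (simp add: x0_def linb)
    show "\<bar>lin x\<bar> \<le> \<bar>q\<bar> * dist x x0" for x
      using mult_left_mono[OF Rep_junction_Lipschitz[of x i x0], of "\<bar>q\<bar>"] r0
      by (simp add: lin_def abs_mult x0_def Rep_junction_nth)
    show "sol (t0, x0) + a * (t - t0) + lin x - M * ((t - t0)\<^sup>2 + (dist x x0)\<^sup>2) \<le> sol (t, x)"
      if t: "\<bar>t - t0\<bar> < min d r0" and x: "dist x x0 < min d r0" for t x
    proof -
      have "dist x (branch_pt i r0) < r0" using x by (simp add: x0_def)
      then obtain r where "0 < r" "x = branch_pt i r" "dist x (branch_pt i r0) = \<bar>r - r0\<bar>"
        by (rule near_branch_point[OF r0])
      then show ?thesis using tch[of t r] t x by (simp add: x0_def linb)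
    qed
    fix N c
    define e where "e = min r0 (e0 / (2 * \<bar>N\<bar> + 1))"
    have e: "e > 0" "e \<le> r0" "(2 * \<bar>N\<bar> + 1) * e \<le> e0"
    proof -
      have "e \<le> e0 / (2 * \<bar>N\<bar> + 1)" by (simp add: e_def)
      then show "(2 * \<bar>N\<bar> + 1) * e \<le> e0" by (subst (asm) pos_le_divide_eq) (auto simp: mult.commute)
    qed (use e0 r0 in \<open>auto simp: e_def\<close>)
    have sm: "\<bar>2 * N * s\<bar> \<le> e0" if "\<bar>s\<bar> < e" for s
    proof -
      have "\<bar>2 * N * s\<bar> \<le> (2 * \<bar>N\<bar> + 1) * \<bar>s\<bar>" by (simp add: abs_mult distrib_right)
      also have "\<dots> \<le> (2 * \<bar>N\<bar> + 1) * e" using that by (intro mult_left_mono) auto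
      finally show ?thesis using e(3) by linarith
    qed
    define Q where "Q w = c + a * (fst w - t0) + lin (snd w) - N * ((fst w - t0)\<^sup>2 + (dist (snd w) x0)\<^sup>2)" for w
    have Qb: "Q (t, branch_pt i r) = c + a * (t - t0) + q * (r - r0) - N * ((t - t0)\<^sup>2 + (r - r0)\<^sup>2)" if "0 \<le> r" for t r
      using that r0 by (simp add: Q_def linb x0_def dist_branch_pt)
    have "\<exists>e>0. \<forall>t x. \<bar>t - t0\<bar> < e \<longrightarrow> dist x x0 < e \<longrightarrow> quadratic_subsolution_at H F Q t x"
    proof (intro exI[of _ e] conjI allI impI e(1))
      fix t x assume t: "\<bar>t - t0\<bar> < e" and x: "dist x x0 < e"
      have "dist x (branch_pt i r0) < r0" using x e by (simp add: x0_def)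
      then obtain r where r: "0 < r" "x = branch_pt i r" "dist x (branch_pt i r0) = \<bar>r - r0\<bar>"
        by (rule near_branch_point[OF r0])
      have rr: "\<bar>r - r0\<bar> < e" using r x by (simp add: x0_def)
      show "quadratic_subsolution_at H F Q t x"
        unfolding quadratic_subsolution_at_def
      proof (intro conjI allI impI)
        fix j s a' q' assume "x = branch_pt j s" "0 < s" and sl': "upper_slope2 (\<lambda>t r. Q (t, branch_pt j r)) t s a' q'"
        then have js: "j = i" "s = r" using r branch_pt_eq_iff[of r s i j] by auto
        have sl'': "upper_slope2 (\<lambda>t r. Q (t, branch_pt i r)) t r a' q'" using sl' js by simp
        have "Q (t + h, branch_pt i r) = Q (t, branch_pt i r) + (a - 2 * N * (t - t0)) * h - N * h\<^sup>2" for h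
          using r(1) by (simp add: Qb power2_eq_square algebra_simps)
        moreover have "Q (t, branch_pt i (r + h)) = Q (t, branch_pt i r) + (q - 2 * N * (r - r0)) * h - N * h\<^sup>2" if "\<bar>h\<bar> < r" for h
          using r(1) that by (simp add: Qb power2_eq_square algebra_simps)
        ultimately have "a' = a - 2 * N * (t - t0)" "q' = q - 2 * N * (r - r0)"
          using slope_of_smooth[OF sl'' r(1)] by blast+
        then show "a' + H j q' \<le> 0" using e0(2)[of "- a'" q'] sm[OF t] sm[OF rr] js by simp
      next
        fix a' q' assume "x = origin"
        then have False using r branch_pt_eq_iff[of r 0 i i] by (simp add: branch_pt_0)
        then show "a' + F q' \<le> 0 \<or> (\<exists>i. a' + H i (q' $ i) \<le> 0)" by simp
      qed
    qed
    then show "\<exists>e>0. \<forall>t x. \<bar>t - t0\<bar> < e \<longrightarrow> dist x x0 < e \<longrightarrow>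
        quadratic_subsolution_at H F (\<lambda>w. c + a * (fst w - t0) + lin (snd w) - N * ((fst w - t0)\<^sup>2 + (dist (snd w) x0)\<^sup>2)) t x"
      by (simp only: Q_def[abs_def])
  qed (use d r0 below aC in auto)
qed

text \<open>
  As in the interior.  That both alternatives fail is exactly what makes the paraboloid a strict
  subsolution at the origin and on the adjacent branches.  A function touching the paraboloid from above at the origin
  has larger slopes \<open>q'\<close>, for which \<open>F(q') \<le> F(q)\<close>.
\<close>

lemma sol_super_vertex:
  assumes t0: "0 < t0" and sl: "vertex_slope (\<lambda>w. - sol w) t0 (- a) (- q)"
  shows "0 \<le> a + F q \<or> (\<exists>i. 0 \<le> a + H i (q $ i))"
proof (rule ccontr)
  assume "\<not> ?thesis"
  then have n: "\<not> 0 \<le> a + F q" "\<And>i. \<not> 0 \<le> a + H i (q $ i)" by blast+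
  have negF: "a + F q < 0" using n(1) by linarith
  have negH: "a + H i (q $ i) < 0" for i using n(2)[of i] by linarith
  obtain M d where d: "d > 0" and raw: "\<And>i t r. \<bar>t - t0\<bar> < d \<Longrightarrow> 0 \<le> r \<Longrightarrow> r < d \<Longrightarrow>
     - sol (t, branch_pt i r) \<le> - sol (t0, origin) + - a * (t - t0) + (- q) $ i * r + M * ((t - t0)\<^sup>2 + r\<^sup>2)"
    using sl unfolding vertex_slope_def by blast
  have tch: "sol (t0, origin) + a * (t - t0) + q $ i * r - M * ((t - t0)\<^sup>2 + r\<^sup>2) \<le> sol (t, branch_pt i r)"
    if "\<bar>t - t0\<bar> < d" "0 \<le> r" "r < d" for i t r using raw[OF that, of i] by simp
  have tt: "sol (t0, origin) + a * (t - t0) - M * (t - t0)\<^sup>2 \<le> sol (t, origin)" if "\<bar>t - t0\<bar> < d" for t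
    using tch[of t 0] that d by (simp add: branch_pt_0)
  have aC: "- C \<le> a" by (rule below_barrier_time(1)[OF t0 d(1) tt])
  have below: "sol (t0, origin) < u0 origin + C * t0"
  proof (rule ccontr)
    assume "\<not> ?thesis"
    then have top: "u0 origin + C * t0 \<le> sol (t0, origin)" by simp
    have Ca: "C \<le> a" by (rule below_barrier_time(2)[OF t0 d(1) tt top])
    have "q $ i - L0 \<le> 0" for i
    proof (rule linear_le_quadratic[OF d, of _ M])
      fix h assume h: "0 < h" "h < d"
      have "\<bar>u0 (branch_pt i h) - u0 origin\<bar> \<le> L0 * h" using u0_branch[of h 0 i] h by (simp add: branch_pt_0)
      then show "(q $ i - L0) * h \<le> M * h\<^sup>2"
        using tch[of t0 h i] h d sol_upper[of t0 "branch_pt i h"] top t0 by (simp add: left_diff_distrib)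
    qed
    then have "F (\<chi> i. L0) \<le> F q" by (intro antimono_all_variables[OF F_mono]) auto
    then show False using FC negF Ca by simp
  qed
  define lin where "lin x = (\<Sum>k\<in>UNIV. q $ k * Rep_junction x $ k)" for x :: "'n junction"
  have linb: "lin (branch_pt j r) = q $ j * r" if "0 \<le> r" for j r
    using that by (simp add: lin_def Rep_junction_nth if_distrib[of "\<lambda>x. _ * x"] cong: if_cong)
  obtain e0 where e0: "e0 > 0" "\<And>a' q'. \<bar>a' + a\<bar> \<le> e0 \<Longrightarrow> (\<And>i. \<bar>q' $ i - q $ i\<bar> \<le> e0) \<Longrightarrow>
      a' - F q' > 0 \<and> (\<forall>i. a' - H i (q' $ i) > 0)"
  proof -
    have nF: "- a + - F q > 0" using negF by simp
    have nH: "- a + - H i (q $ i) > 0" for i using negH[of i] by simp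
    have "\<exists>e>0. \<forall>a' q'. \<bar>a' - (- a)\<bar> \<le> e \<longrightarrow> (\<forall>i. \<bar>q' $ i - q $ i\<bar> \<le> e) \<longrightarrow>
        a' + - F q' > 0 \<and> (\<forall>i. a' + - H i (q' $ i) > 0)"
      by (intro vertex_pos_near[where H = "\<lambda>i p. - H i p" and F = "\<lambda>q. - F q"] continuous_on_minus cH cF nF nH)
    then show ?thesis using that by auto
  qed
  show False
  proof (rule bump[where lin = lin and ?x0.0 = origin and L = "norm q" and e = d and M = M, OF t0])
    show "continuous_on UNIV lin" unfolding lin_def[abs_def] by (intro continuous_intros)
    show "lin origin = 0" using linb[of 0] by (simp add: branch_pt_0)
    show "\<bar>lin x\<bar> \<le> norm q * dist x origin" for x
    proof -
      obtain j r where x: "0 \<le> r" "x = branch_pt j r" by (rule junction_cases)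
      then show ?thesis using component_le_norm_cart[of q j] by (simp add: linb dist_origin abs_mult mult_right_mono)
    qed
    show "sol (t0, origin) + a * (t - t0) + lin x - M * ((t - t0)\<^sup>2 + (dist x origin)\<^sup>2) \<le> sol (t, x)"
      if t: "\<bar>t - t0\<bar> < d" and x: "dist x origin < d" for t x
    proof -
      obtain j r where "0 \<le> r" "x = branch_pt j r" by (rule junction_cases)
      then show ?thesis using tch[of t r j] t x by (simp add: linb dist_origin)
    qed
    fix N c
    define e where "e = e0 / (2 * \<bar>N\<bar> + 1)"
    have e: "e > 0" "(2 * \<bar>N\<bar> + 1) * e = e0" using e0 by (auto simp: e_def)
    have sm: "\<bar>2 * N * s\<bar> \<le> e0" if "\<bar>s\<bar> < e" for s
    proof -
      have "\<bar>2 * N * s\<bar> \<le> (2 * \<bar>N\<bar> + 1) * \<bar>s\<bar>" by (simp add: abs_mult distrib_right)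
      also have "\<dots> \<le> (2 * \<bar>N\<bar> + 1) * e" using that by (intro mult_left_mono) auto
      finally show ?thesis using e(2) by linarith
    qed
    define Q where "Q w = c + a * (fst w - t0) + lin (snd w) - N * ((fst w - t0)\<^sup>2 + (dist (snd w) origin)\<^sup>2)" for w
    have Qb: "Q (t, branch_pt j r) = c + a * (t - t0) + q $ j * r - N * ((t - t0)\<^sup>2 + r\<^sup>2)" if "0 \<le> r" for t j r
      using that by (simp add: Q_def linb dist_origin)
    have "\<exists>e>0. \<forall>t x. \<bar>t - t0\<bar> < e \<longrightarrow> dist x origin < e \<longrightarrow> quadratic_subsolution_at H F Q t x"
    proof (intro exI[of _ e] conjI allI impI e(1))
      fix t and x :: "'n junction" assume t: "\<bar>t - t0\<bar> < e" and x: "dist x origin < e"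
      show "quadratic_subsolution_at H F Q t x"
        unfolding quadratic_subsolution_at_def
      proof (intro conjI allI impI)
        fix j s a' q' assume xs: "x = branch_pt j s" "0 < s" and sl': "upper_slope2 (\<lambda>t r. Q (t, branch_pt j r)) t s a' q'"
        have ss: "\<bar>s\<bar> < e" using x xs by (simp add: dist_origin)
        have "Q (t + h, branch_pt j s) = Q (t, branch_pt j s) + (a - 2 * N * (t - t0)) * h - N * h\<^sup>2" for h
          using xs(2) by (simp add: Qb power2_eq_square algebra_simps)
        moreover have "Q (t, branch_pt j (s + h)) = Q (t, branch_pt j s) + (q $ j - 2 * N * s) * h - N * h\<^sup>2" if "\<bar>h\<bar> < s" for h
          using xs(2) that by (simp add: Qb power2_eq_square algebra_simps)
        ultimately have "a' = a - 2 * N * (t - t0)" "q' = q $ j - 2 * N * s"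
          using slope_of_smooth[OF sl' xs(2)] by blast+
        note ab = this
        have "\<bar>- a' + a\<bar> \<le> e0" using sm[OF t] ab by simp
        moreover have "\<bar>(\<chi> k. if k = j then q' else q $ k) $ i - q $ i\<bar> \<le> e0" for i
          using sm[OF ss] ab e0(1) by simp
        ultimately have "- a' - H j ((\<chi> k. if k = j then q' else q $ k) $ j) > 0" using e0(2) by blast
        then show "a' + H j q' \<le> 0" by simp
      next
        fix a' q' assume xo: "x = origin" and sl': "vertex_slope Q t a' q'"
        obtain M' d' where d': "d' > 0" "\<And>i t' r. \<bar>t' - t\<bar> < d' \<Longrightarrow> 0 \<le> r \<Longrightarrow> r < d' \<Longrightarrow>
           Q (t', branch_pt i r) \<le> Q (t, origin) + a' * (t' - t) + q' $ i * r + M' * ((t' - t)\<^sup>2 + r\<^sup>2)"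
          using sl' unfolding vertex_slope_def by blast
        have Qo: "Q (t', origin) = c + a * (t' - t0) - N * (t' - t0)\<^sup>2" for t'
          using Qb[of 0 t'] by (simp add: branch_pt_0)
        have d1: "c + a * (t' - t0) + q $ i * r - N * ((t' - t0)\<^sup>2 + r\<^sup>2)
            \<le> c + a * (t - t0) - N * (t - t0)\<^sup>2 + a' * (t' - t) + q' $ i * r + M' * ((t' - t)\<^sup>2 + r\<^sup>2)"
          if "\<bar>t' - t\<bar> < d'" "0 \<le> r" "r < d'" for i t' r
          using d'(2)[OF that, of i] unfolding Qb[OF that(2)] Qo .
        define b where "b = a - 2 * N * (t - t0)"
        have "a' - b \<le> 0"
        proof (rule linear_le_quadratic[OF d'(1), of _ "M' + N"])
          fix h assume "0 < h" "h < d'"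
          then show "(a' - b) * h \<le> (M' + N) * h\<^sup>2"
            using d1[of "t - h" 0] by (simp add: b_def power2_eq_square algebra_simps)
        qed
        moreover have q': "q $ i - q' $ i \<le> 0" for i
        proof (rule linear_le_quadratic[OF d'(1), of _ "M' + N"])
          fix h assume "0 < h" "h < d'"
          then show "(q $ i - q' $ i) * h \<le> (M' + N) * h\<^sup>2"
            using d1[of t h i] d'(1) by (simp add: power2_eq_square algebra_simps)
        qed
        have "F q' \<le> F q" by (rule antimono_all_variables[OF F_mono]) (use q' in simp)
        moreover have "- b - F q > 0" using e0(2)[of "- b" q] sm[OF t] e0(1) by (simp add: b_def)
        ultimately show "a' + F q' \<le> 0 \<or> (\<exists>i. a' + H i (q' $ i) \<le> 0)" by simp
      qed
    qed
    then show "\<exists>e>0. \<forall>t x. \<bar>t - t0\<bar> < e \<longrightarrow> dist x origin < e \<longrightarrow>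
        quadratic_subsolution_at H F (\<lambda>w. c + a * (fst w - t0) + lin (snd w) - N * ((fst w - t0)\<^sup>2 + (dist (snd w) origin)\<^sup>2)) t x"
      by (simp only: Q_def[abs_def])
  qed (use d below aC in auto)
qed

lemma quadratic_supersolution_sol: "quadratic_supersolution H F sol"
  unfolding quadratic_supersolution_def quadratic_subsolution_def
proof (intro conjI allI impI)
  fix i t r a q assume "0 < t" "0 < r" "upper_slope2 (\<lambda>t r. - sol (t, branch_pt i r)) t r a q"
  then show "a + - H i (- q) \<le> 0" using sol_super_interior[of t r i "- a" "- q"] by simp
next
  fix t a q assume "0 < t" "vertex_slope (\<lambda>w. - sol w) t a q"
  then show "a + - F (- q) \<le> 0 \<or> (\<exists>i. a + - H i (- (q $ i)) \<le> 0)" using sol_super_vertex[of t "- a" "- q"] by auto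
qed

end

section \<open>Relaxed solutions satisfy the quadratic inequalities\<close>

lemma C1_test_separable:
  fixes g :: "('n::finite) junction \<Rightarrow> real"
  assumes f: "\<And>t. (f has_real_derivative f' t) (at t)" "continuous_on UNIV f'"
    and g: "continuous_on UNIV g" "\<And>j r. 0 \<le> r \<Longrightarrow> g (branch_pt j r) = G j r"
    and G: "\<And>j r. (G j has_real_derivative G' j r) (at r)" "\<And>j. continuous_on UNIV (G' j)"
  shows "C1_test T (\<lambda>(t, x). f t + g x)"
    and "time_deriv (\<lambda>(t, x). f t + g x) t x = f' t"
    and "0 \<le> r \<Longrightarrow> branch_deriv j (\<lambda>(t, x). f t + g x) t (branch_pt j r) = G' j r"
proof -
  show "C1_test T (\<lambda>(t, x). f t + g x)"
    unfolding C1_test_def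
  proof (intro conjI allI)
    have cf: "continuous_on UNIV f" using f(1) by (intro continuous_at_imp_continuous_on) (blast intro: DERIV_isCont)
    have "continuous_on ({0<..<T} \<times> UNIV) (\<lambda>w. f (fst w))"
      by (rule continuous_on_compose2[OF cf continuous_on_fst[OF continuous_on_id]]) simp
    moreover have "continuous_on ({0<..<T} \<times> UNIV) (\<lambda>w. g (snd w))"
      by (rule continuous_on_compose2[OF g(1) continuous_on_snd[OF continuous_on_id]]) simp
    ultimately have "continuous_on ({0<..<T} \<times> UNIV) (\<lambda>w. f (fst w) + g (snd w))"
      by (rule continuous_on_add)
    then show "continuous_on ({0<..<T} \<times> UNIV) (\<lambda>(t, x). f t + g x)" by (simp add: case_prod_unfold)
    fix j
    let ?S = "{0<..<T} \<times> {0::real..}"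
    define D :: "real \<times> real \<Rightarrow> (real \<times> real) \<Rightarrow>\<^sub>L real"
      where "D z = f' (fst z) *\<^sub>R fst_blinfun + G' j (snd z) *\<^sub>R snd_blinfun" for z
    have "continuous_on ?S (\<lambda>z. f' (fst z))"
      by (rule continuous_on_compose2[OF f(2) continuous_on_fst[OF continuous_on_id]]) simp
    moreover have "continuous_on ?S (\<lambda>z. G' j (snd z))"
      by (rule continuous_on_compose2[OF G(2) continuous_on_snd[OF continuous_on_id]]) simp
    ultimately have "continuous_on ?S D"
      unfolding D_def[abs_def] by (intro continuous_on_add continuous_on_scaleR continuous_on_const)
    moreover have "((\<lambda>(t, r). f t + g (branch_pt j r)) has_derivative blinfun_apply (D z)) (at z within ?S)"
      if z: "z \<in> ?S" for z
    proof -
      have fd: "((\<lambda>w. f (fst w)) has_derivative (\<lambda>h. f' (fst z) * fst h)) (at z within ?S)"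
        by (rule has_derivative_eq_rhs[OF has_derivative_compose[OF has_derivative_fst[OF has_derivative_ident]
              f(1)[unfolded has_field_derivative_def]]]) simp
      have Gd: "((\<lambda>w. G j (snd w)) has_derivative (\<lambda>h. G' j (snd z) * snd h)) (at z within ?S)"
        by (rule has_derivative_eq_rhs[OF has_derivative_compose[OF has_derivative_snd[OF has_derivative_ident]
              G(1)[unfolded has_field_derivative_def]]]) simp
      have "((\<lambda>w. f (fst w) + G j (snd w)) has_derivative blinfun_apply (D z)) (at z within ?S)"
        by (rule has_derivative_eq_rhs[OF has_derivative_add[OF fd Gd]])
           (simp add: D_def fun_eq_iff blinfun.add_left blinfun.scaleR_left)
      then show ?thesis
        by (rule has_derivative_transform[OF z, rotated]) (auto simp: g(2))
    qed
    ultimately show "C1_on ?S (\<lambda>(t, r). case (t, branch_pt j r) of (t, x) \<Rightarrow> f t + g x)"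
      unfolding C1_on_def by auto
  qed
  have "((\<lambda>s. f s + g x) has_real_derivative f' t) (at t)"
    using DERIV_add[OF f(1) DERIV_const] by simp
  then show "time_deriv (\<lambda>(t, x). f t + g x) t x = f' t"
    unfolding time_deriv_def by (simp add: DERIV_imp_deriv)
  assume r: "0 \<le> r"
  have "((\<lambda>r. f t + G j r) has_real_derivative G' j r) (at r)"
    using DERIV_add[OF DERIV_const G(1)] by simp
  then have "((\<lambda>r. f t + G j r) has_vector_derivative G' j r) (at r within {0..})"
    by (simp add: has_real_derivative_iff_has_vector_derivative has_vector_derivative_at_within)
  then have "((\<lambda>r. f t + g (branch_pt j r)) has_vector_derivative G' j r) (at r within {0..})"
    by (rule has_vector_derivative_transform[rotated 2]) (use r g(2) in auto)
  then show "branch_deriv j (\<lambda>(t, x). f t + g x) t (branch_pt j r) = G' j r"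
    unfolding branch_deriv_def radius_branch_pt[OF r]
    by (simp add: vector_derivative_within[OF at_within_nonneg_ne_bot[OF r]])
qed

lemma dist_le_dist_fst_snd: "dist (t, x) (s, y) \<le> dist t s + dist x (y :: 'a::metric_space)"
  unfolding dist_Pair_Pair by (rule sqrt_sum_squares_le_sum) auto

text \<open>
  The quadratic test functions extend to the whole junction: one depending on the \<open>i\<close>-th coordinate only is
  constant in space on the other branches.
\<close>

lemma relaxed_imp_quadratic_subsolution:
  fixes u :: "real \<times> ('n::finite) junction \<Rightarrow> real"
  assumes cu: "continuous_on ({0..} \<times> UNIV) u" and sub: "\<And>T. T > 0 \<Longrightarrow> relaxed_subsolution T H F u"
  shows "quadratic_subsolution H F u"
  unfolding quadratic_subsolution_def
proof (intro conjI allI impI)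
  fix i t0 r0 a q assume t0: "0 < t0" and r0: "0 < r0" and sl: "upper_slope2 (\<lambda>t r. u (t, branch_pt i r)) t0 r0 a q"
  obtain M d where d: "d > 0" "M \<ge> 0" "\<And>t' y'. \<bar>t' - t0\<bar> < d \<Longrightarrow> \<bar>y' - r0\<bar> < d \<Longrightarrow>
     u (t', branch_pt i y') \<le> u (t0, branch_pt i r0) + a * (t' - t0) + q * (y' - r0) + M * ((t' - t0)\<^sup>2 + (y' - r0)\<^sup>2)"
    using upper_slope2E[OF sl] by metis
  define T where "T = t0 + 1"
  have T: "T > 0" "t0 \<in> {0<..<T}" using t0 by (auto simp: T_def)
  define f where "f t = a * (t - t0) + M * (t - t0)\<^sup>2" for t
  define g where "g x = q * (Rep_junction x $ i - r0) + M * (Rep_junction x $ i - r0)\<^sup>2" for x :: "'n junction"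
  define G :: "'n \<Rightarrow> real \<Rightarrow> real" where "G j r = (if j = i then q * (r - r0) + M * (r - r0)\<^sup>2 else q * (0 - r0) + M * (0 - r0)\<^sup>2)" for j r
  define f' where "f' t = a + M * (2 * (t - t0))" for t
  define G' :: "'n \<Rightarrow> real \<Rightarrow> real" where "G' j r = (if j = i then q + M * (2 * (r - r0)) else 0)" for j r
  have df: "(f has_real_derivative f' t) (at t)" for t
    unfolding f_def[abs_def] f'_def by (auto intro!: derivative_eq_intros)
  have cf: "continuous_on UNIV f'" unfolding f'_def[abs_def] by (intro continuous_intros)
  have cg: "continuous_on UNIV g" unfolding g_def[abs_def] by (intro continuous_intros)
  have gG: "g (branch_pt j r) = G j r" if "0 \<le> r" for j r
    using that by (simp add: g_def G_def Rep_junction_nth)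
  have dG: "(G j has_real_derivative G' j r) (at r)" for j r
    unfolding G_def[abs_def] G'_def by (cases "j = i") (auto intro!: derivative_eq_intros)
  have cG: "continuous_on UNIV (G' j)" for j
    unfolding G'_def[abs_def] by (cases "j = i") (auto intro!: continuous_intros)
  let ?\<phi> = "\<lambda>(t, x). f t + g x"
  have C1: "C1_test T ?\<phi>" by (rule C1_test_separable(1)[of f f' g G G']) (fact df cf cg gG dG cG)+
  have td: "time_deriv ?\<phi> t0 (branch_pt i r0) = a"
    by (subst C1_test_separable(2)[of f f' g G G']) (fact df cf cg gG dG cG | simp add: f'_def)+
  have bd: "branch_deriv i ?\<phi> t0 (branch_pt i r0) = q"
    by (subst C1_test_separable(3)[of f f' g G G']) (fact df cf cg gG dG cG | use r0 in \<open>simp add: G'_def\<close>)+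
  have "touches_above ({0<..<T} \<times> UNIV) ?\<phi> (usc_env ({0..<T} \<times> UNIV) u) (t0, branch_pt i r0)"
  proof (subst touches_above_continuous[OF cu])
    show "\<exists>e>0. \<forall>w\<in>({0<..<T} \<times> UNIV) \<inter> ball (t0, branch_pt i r0) e. u w - ?\<phi> w \<le> u (t0, branch_pt i r0) - ?\<phi> (t0, branch_pt i r0)"
    proof (intro exI[of _ "min d r0"] conjI ballI)
      fix w :: "real \<times> 'n junction" assume "w \<in> ({0<..<T} \<times> UNIV) \<inter> ball (t0, branch_pt i r0) (min d r0)"
      moreover obtain t x where w: "w = (t, x)" by (cases w)
      ultimately have D: "dist w (t0, branch_pt i r0) < min d r0" by (simp add: dist_commute)
      have 1: "\<bar>t - t0\<bar> < d" using dist_fst_le[of w "(t0, branch_pt i r0)"] D w by (simp add: dist_real_def)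
      have 2: "dist x (branch_pt i r0) < d" "dist x (branch_pt i r0) < r0"
        using dist_snd_le[of w "(t0, branch_pt i r0)"] D w by auto
      obtain r where r: "0 < r" "x = branch_pt i r" "dist x (branch_pt i r0) = \<bar>r - r0\<bar>"
        using near_branch_point[OF r0 2(2)] .
      show "u w - ?\<phi> w \<le> u (t0, branch_pt i r0) - ?\<phi> (t0, branch_pt i r0)"
        using d(3)[of t r] 1 2 r r0 by (simp add: w f_def gG G_def distrib_left)
    qed (use d r0 in auto)
  qed (use T in auto)
  moreover have "branch_pt i r0 \<in> branch i - {origin}"
    using r0 branch_pt_eq_iff[of r0 0 i i] by (auto simp: branch_pt_in_branch_iff branch_pt_0)
  ultimately show "a + H i q \<le> 0"
    using sub[OF T(1)] C1 T(2) td bd unfolding relaxed_subsolution_def by metis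
next
  fix t0 a q assume t0: "0 < t0" and sl: "vertex_slope u t0 a q"
  obtain M d where d: "d > 0" "\<And>i t' r. \<bar>t' - t0\<bar> < d \<Longrightarrow> 0 \<le> r \<Longrightarrow> r < d \<Longrightarrow>
     u (t', branch_pt i r) \<le> u (t0, origin) + a * (t' - t0) + q $ i * r + M * ((t' - t0)\<^sup>2 + r\<^sup>2)"
    using sl unfolding vertex_slope_def by blast
  define T where "T = t0 + 1"
  have T: "T > 0" "t0 \<in> {0<..<T}" using t0 by (auto simp: T_def)
  define f where "f t = a * (t - t0) + M * (t - t0)\<^sup>2" for t
  define g where "g x = (\<Sum>k\<in>UNIV. q $ k * (Rep_junction x $ k)) + M * (radius x)\<^sup>2" for x :: "'n junction"
  define G :: "'n \<Rightarrow> real \<Rightarrow> real" where "G j r = q $ j * r + M * r\<^sup>2" for j r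
  define f' where "f' t = a + M * (2 * (t - t0))" for t
  define G' :: "'n \<Rightarrow> real \<Rightarrow> real" where "G' j r = q $ j + M * (2 * r)" for j r
  have df: "(f has_real_derivative f' t) (at t)" for t
    unfolding f_def[abs_def] f'_def by (auto intro!: derivative_eq_intros)
  have cf: "continuous_on UNIV f'" unfolding f'_def[abs_def] by (intro continuous_intros)
  have cg: "continuous_on UNIV g" unfolding g_def[abs_def] by (intro continuous_intros)
  have gG: "g (branch_pt j r) = G j r" if "0 \<le> r" for j r
    using that by (simp add: g_def G_def Rep_junction_nth radius_branch_pt if_distrib[of "\<lambda>x. _ * x"] cong: if_cong)
  have dG: "(G j has_real_derivative G' j r) (at r)" for j r
    unfolding G_def[abs_def] G'_def by (auto intro!: derivative_eq_intros)
  have cG: "continuous_on UNIV (G' j)" for j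
    unfolding G'_def[abs_def] by (auto intro!: continuous_intros)
  let ?\<phi> = "\<lambda>(t, x). f t + g x"
  have C1: "C1_test T ?\<phi>" by (rule C1_test_separable(1)[of f f' g G G']) (fact df cf cg gG dG cG)+
  have td: "time_deriv ?\<phi> t0 origin = a"
    by (subst C1_test_separable(2)[of f f' g G G']) (fact df cf cg gG dG cG | simp add: f'_def)+
  have bd0: "branch_deriv i ?\<phi> t0 (branch_pt i 0) = q $ i" for i
    by (subst C1_test_separable(3)[of f f' g G G']) (fact df cf cg gG dG cG | simp add: G'_def)+
  have bd: "branch_deriv i ?\<phi> t0 origin = q $ i" for i using bd0[of i] by (simp add: branch_pt_0)
  have gr: "gradient_at_origin ?\<phi> t0 = q" by (simp add: gradient_at_origin_def bd vec_eq_iff)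
  have "touches_above ({0<..<T} \<times> UNIV) ?\<phi> (usc_env ({0..<T} \<times> UNIV) u) (t0, origin)"
  proof (subst touches_above_continuous[OF cu])
    show "\<exists>e>0. \<forall>w\<in>({0<..<T} \<times> UNIV) \<inter> ball (t0, origin) e. u w - ?\<phi> w \<le> u (t0, origin) - ?\<phi> (t0, origin)"
    proof (intro exI[of _ d] conjI ballI)
      fix w :: "real \<times> 'n junction" assume "w \<in> ({0<..<T} \<times> UNIV) \<inter> ball (t0, origin) d"
      moreover obtain t x where w: "w = (t, x)" by (cases w)
      ultimately have D: "dist w (t0, origin) < d" by (simp add: dist_commute)
      obtain j r where r: "0 \<le> r" "x = branch_pt j r" by (rule junction_cases)
      have 1: "\<bar>t - t0\<bar> < d" using dist_fst_le[of w "(t0, origin)"] D w by (simp add: dist_real_def)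
      have 2: "r < d" using dist_snd_le[of w "(t0, origin)"] D w r by (simp add: dist_origin)
      have g0: "g origin = 0" using gG[of 0 j] by (simp add: branch_pt_0 G_def)
      show "u w - ?\<phi> w \<le> u (t0, origin) - ?\<phi> (t0, origin)"
        using d(2)[of t r j] 1 2 r by (simp add: w f_def gG G_def g0 distrib_left)
    qed (use d in auto)
  qed (use T in auto)
  then have "time_deriv ?\<phi> t0 origin + F (gradient_at_origin ?\<phi> t0) \<le> 0 \<or>
        (\<exists>i. time_deriv ?\<phi> t0 origin + H i (branch_deriv i ?\<phi> t0 origin) \<le> 0)"
    using sub[OF T(1)] C1 T(2) unfolding relaxed_subsolution_def by blast
  then show "a + F q \<le> 0 \<or> (\<exists>i. a + H i (q $ i) \<le> 0)" by (simp only: td gr bd)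
qed

lemma quadratic_subsolution_imp_relaxed:
  fixes u :: "real \<times> ('n::finite) junction \<Rightarrow> real"
  assumes H: "\<And>i. continuous_on UNIV (H i)" and F: "continuous_on UNIV F"
    and cu: "continuous_on ({0..} \<times> UNIV) u" and su: "quadratic_subsolution H F u"
  shows "relaxed_subsolution T H F u"
  unfolding relaxed_subsolution_def
proof (intro allI impI ballI)
  fix \<phi> t0 and x0 :: "'n junction" assume C1: "C1_test T \<phi>" and t0: "t0 \<in> {0<..<T}"
    and "touches_above ({0<..<T} \<times> UNIV) \<phi> (usc_env ({0..<T} \<times> UNIV) u) (t0, x0)"
  then obtain e where e: "e > 0" "\<And>w. w \<in> ({0<..<T} \<times> UNIV) \<inter> ball (t0, x0) e \<Longrightarrow> u w - \<phi> w \<le> u (t0, x0) - \<phi> (t0, x0)"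
    using touches_above_continuous[OF cu, of "(t0, x0)" T \<phi>] by auto
  define a where "a = time_deriv \<phi> t0 x0"
  define m where "m = min (e / 2) (min t0 (T - t0))"
  have m: "m > 0" using e(1) t0 by (simp add: m_def)
  have m': "m \<le> e / 2" "m \<le> t0" "m \<le> T - t0" unfolding m_def by linarith+
  have touch: "u (t, branch_pt i r) \<le> u (t0, x0) + (\<phi> (t, branch_pt i r) - \<phi> (t0, x0))" "t \<in> {0<..<T}"
    if "\<bar>t - t0\<bar> < m" "x0 = branch_pt i r0" "0 \<le> r0" "0 \<le> r" "\<bar>r - r0\<bar> < m" for t r i r0
  proof -
    show t: "t \<in> {0<..<T}" using that m' by auto
    have "dist (t, branch_pt i r) (t0, x0) \<le> \<bar>t - t0\<bar> + \<bar>r - r0\<bar>"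
      using dist_le_dist_fst_snd[of t "branch_pt i r" t0 x0] that by (simp add: dist_real_def dist_branch_pt)
    also have "\<dots> < e" using that m' by linarith
    finally show "u (t, branch_pt i r) \<le> u (t0, x0) + (\<phi> (t, branch_pt i r) - \<phi> (t0, x0))"
      using e(2)[of "(t, branch_pt i r)"] t by (simp add: dist_commute)
  qed
  have jet: "\<exists>\<rho>>0. \<forall>t r. \<bar>t - t0\<bar> < \<rho> \<longrightarrow> 0 \<le> r \<longrightarrow> \<bar>r - r0\<bar> < \<rho> \<longrightarrow>
        u (t, branch_pt i r) \<le> u (t0, x0) + a * (t - t0) + branch_deriv i \<phi> t0 x0 * (r - r0) + \<epsilon> * (\<bar>t - t0\<bar> + \<bar>r - r0\<bar>)"
    if x0: "x0 = branch_pt i r0" "0 \<le> r0" and "\<epsilon> > 0" for i r0 \<epsilon>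
  proof -
    obtain \<rho> where \<rho>: "\<rho> > 0" "\<And>t' r'. t' \<in> {0<..<T} \<Longrightarrow> 0 \<le> r' \<Longrightarrow> \<bar>t' - t0\<bar> < \<rho> \<Longrightarrow> \<bar>r' - r0\<bar> < \<rho> \<Longrightarrow>
       \<bar>\<phi> (t', branch_pt i r') - \<phi> (t0, x0) - a * (t' - t0) - branch_deriv i \<phi> t0 x0 * (r' - r0)\<bar>
         \<le> \<epsilon> * (\<bar>t' - t0\<bar> + \<bar>r' - r0\<bar>)"
      using C1_test_branch_derivatives(3)[OF C1 t0 x0(2) \<open>\<epsilon> > 0\<close>, of i] unfolding a_def x0(1) by blast
    show ?thesis
    proof (intro exI[of _ "min \<rho> m"] conjI allI impI)
      fix t r assume "\<bar>t - t0\<bar> < min \<rho> m" "0 \<le> r" "\<bar>r - r0\<bar> < min \<rho> m"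
      then show "u (t, branch_pt i r) \<le> u (t0, x0) + a * (t - t0) + branch_deriv i \<phi> t0 x0 * (r - r0) + \<epsilon> * (\<bar>t - t0\<bar> + \<bar>r - r0\<bar>)"
        using touch[OF _ x0, of t r] \<rho>(2)[of t r] by (simp add: abs_le_iff)
    qed (use \<rho> m in auto)
  qed
  show "(\<forall>i. x0 \<in> branch i - {origin} \<longrightarrow> time_deriv \<phi> t0 x0 + H i (branch_deriv i \<phi> t0 x0) \<le> 0) \<and>
        (x0 = origin \<longrightarrow> time_deriv \<phi> t0 x0 + F (gradient_at_origin \<phi> t0) \<le> 0 \<or>
               (\<exists>i. time_deriv \<phi> t0 x0 + H i (branch_deriv i \<phi> t0 x0) \<le> 0))"
  proof (intro conjI allI impI)
    fix i assume "x0 \<in> branch i - {origin}"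
    then obtain r0 where x0: "x0 = branch_pt i r0" "0 \<le> r0" and "r0 \<noteq> 0"
      using branch_pt_0[of i] by (auto simp: branch_def)
    then have r0: "r0 > 0" by simp
    have "a + H i (branch_deriv i \<phi> t0 x0) \<le> 0"
    proof (rule quadratic_subsolution_ojet_interior[where H = H, OF H cu su _ r0])
      fix \<epsilon> :: real assume "\<epsilon> > 0"
      obtain \<rho> where \<rho>: "\<rho> > 0" "\<And>t r. \<bar>t - t0\<bar> < \<rho> \<Longrightarrow> 0 \<le> r \<Longrightarrow> \<bar>r - r0\<bar> < \<rho> \<Longrightarrow>
        u (t, branch_pt i r) \<le> u (t0, x0) + a * (t - t0) + branch_deriv i \<phi> t0 x0 * (r - r0) + \<epsilon> * (\<bar>t - t0\<bar> + \<bar>r - r0\<bar>)"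
        using jet[OF x0 \<open>\<epsilon> > 0\<close>] by blast
      show "\<exists>\<rho>>0. \<forall>t r. \<bar>t - t0\<bar> < \<rho> \<longrightarrow> \<bar>r - r0\<bar> < \<rho> \<longrightarrow> u (t, branch_pt i r) \<le> u (t0, branch_pt i r0)
          + a * (t - t0) + branch_deriv i \<phi> t0 x0 * (r - r0) + \<epsilon> * (\<bar>t - t0\<bar> + \<bar>r - r0\<bar>)"
        by (intro exI[of _ "min \<rho> r0"]) (use \<rho> r0 x0 in auto)
    qed (use t0 in auto)
    then show "time_deriv \<phi> t0 x0 + H i (branch_deriv i \<phi> t0 x0) \<le> 0" by (simp add: a_def)
  next
    assume x0: "x0 = origin"
    have "a + F (gradient_at_origin \<phi> t0) \<le> 0 \<or> (\<exists>i. a + H i (gradient_at_origin \<phi> t0 $ i) \<le> 0)"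
    proof (rule quadratic_subsolution_ojet_vertex[where H = H and F = F, OF H F cu su])
      fix \<epsilon> :: real assume "\<epsilon> > 0"
      have "\<forall>i. \<exists>\<rho>>0. \<forall>t r. \<bar>t - t0\<bar> < \<rho> \<longrightarrow> 0 \<le> r \<longrightarrow> \<bar>r - 0\<bar> < \<rho> \<longrightarrow>
        u (t, branch_pt i r) \<le> u (t0, x0) + a * (t - t0) + branch_deriv i \<phi> t0 x0 * (r - 0) + \<epsilon> * (\<bar>t - t0\<bar> + \<bar>r - 0\<bar>)"
        by (intro allI jet) (use x0 \<open>\<epsilon> > 0\<close> in \<open>auto simp: branch_pt_0\<close>)
      then obtain \<rho> where \<rho>: "\<And>i. \<rho> i > 0" "\<And>i t r. \<bar>t - t0\<bar> < \<rho> i \<Longrightarrow> 0 \<le> r \<Longrightarrow> \<bar>r - 0\<bar> < \<rho> i \<Longrightarrow>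
        u (t, branch_pt i r) \<le> u (t0, x0) + a * (t - t0) + branch_deriv i \<phi> t0 x0 * (r - 0) + \<epsilon> * (\<bar>t - t0\<bar> + \<bar>r - 0\<bar>)"
        by metis
      show "\<exists>\<rho>>0. \<forall>i t r. \<bar>t - t0\<bar> < \<rho> \<longrightarrow> 0 \<le> r \<longrightarrow> r < \<rho> \<longrightarrow> u (t, branch_pt i r) \<le> u (t0, origin) + a * (t - t0)
          + gradient_at_origin \<phi> t0 $ i * r + \<epsilon> * (\<bar>t - t0\<bar> + r)"
      proof (intro exI[of _ "Min (range \<rho>)"] conjI allI impI)
        fix i t r assume "\<bar>t - t0\<bar> < Min (range \<rho>)" "0 \<le> r" "r < Min (range \<rho>)"
        moreover have "Min (range \<rho>) \<le> \<rho> i" by simp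
        ultimately show "u (t, branch_pt i r) \<le> u (t0, origin) + a * (t - t0) + gradient_at_origin \<phi> t0 $ i * r + \<epsilon> * (\<bar>t - t0\<bar> + r)"
          using \<rho>(2)[of t i r] by (simp add: gradient_at_origin_def x0)
      qed (use \<rho>(1) in simp)
    qed (use t0 in auto)
    then show "time_deriv \<phi> t0 x0 + F (gradient_at_origin \<phi> t0) \<le> 0 \<or>
               (\<exists>i. time_deriv \<phi> t0 x0 + H i (branch_deriv i \<phi> t0 x0) \<le> 0)"
      by (simp add: a_def gradient_at_origin_def x0)
  qed
qed

section \<open>Existence and uniqueness\<close>

lemma existence_Lipschitz:
  fixes H :: "'n::finite \<Rightarrow> real \<Rightarrow> real" and F :: "real ^ 'n \<Rightarrow> real" and u0 :: "'n junction \<Rightarrow> real"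
  assumes H: "\<And>i. continuous_on UNIV (H i)" "\<And>i. coercive (H i)"
    and F: "continuous_on UNIV F" "nonincreasing_in_each_variable F"
    and u0: "L \<ge> 0" "\<And>x y. \<bar>u0 x - u0 y\<bar> \<le> L * dist x y"
  shows "\<exists>u C. C \<ge> 0 \<and> continuous_on ({0..} \<times> UNIV) u \<and> quadratic_subsolution H F u \<and> quadratic_supersolution H F u \<and>
    (\<forall>t\<ge>0. \<forall>x. \<bar>u (t, x) - u0 x\<bar> \<le> C * t) \<and>
    (\<forall>t\<ge>0. \<forall>s\<ge>0. \<forall>x. \<bar>u (t, x) - u (s, x)\<bar> \<le> C * \<bar>t - s\<bar>)"
proof -
  have "\<forall>i. \<exists>B. \<forall>p\<in>{-L..L}. \<bar>H i p\<bar> \<le> B"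
  proof
    fix i
    have "bounded (H i ` {-L..L})"
      by (intro compact_imp_bounded compact_continuous_image continuous_on_subset[OF H(1)]) auto
    then show "\<exists>B. \<forall>p\<in>{-L..L}. \<bar>H i p\<bar> \<le> B" unfolding bounded_iff by auto
  qed
  then obtain B where B: "\<And>i p. p \<in> {-L..L} \<Longrightarrow> \<bar>H i p\<bar> \<le> B i" by metis
  define C where "C = (\<Sum>i\<in>UNIV. \<bar>B i\<bar>) + \<bar>F (\<chi> i. - L)\<bar> + \<bar>F (\<chi> i. L)\<bar>"
  have sB: "0 \<le> (\<Sum>i\<in>UNIV. \<bar>B i\<bar>)" by (simp add: sum_nonneg)
  have BC: "B i \<le> C" for i
  proof -
    have "\<bar>B i\<bar> \<le> (\<Sum>i\<in>UNIV. \<bar>B i\<bar>)" by (rule member_le_sum) auto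
    then show ?thesis by (simp add: C_def)
  qed
  have C: "C \<ge> 0" "F (\<chi> i. - L) \<le> C" "- C \<le> F (\<chi> i. L)"
    unfolding C_def using sB by linarith+
  have "\<forall>i. \<exists>R. \<forall>p. H i p \<le> C + 1 \<longrightarrow> \<bar>p\<bar> < R"
  proof
    fix i
    have "eventually (\<lambda>p. H i p > C + 1) at_infinity"
      using H(2)[of i] unfolding coercive_def filterlim_at_top_dense by blast
    then obtain R where "\<And>p. R \<le> norm p \<Longrightarrow> H i p > C + 1" unfolding eventually_at_infinity by blast
    then show "\<exists>R. \<forall>p. H i p \<le> C + 1 \<longrightarrow> \<bar>p\<bar> < R" by (intro exI[of _ R]) (force simp: not_le[symmetric])
  qed
  then obtain R where R: "\<And>i p. H i p \<le> C + 1 \<Longrightarrow> \<bar>p\<bar> < R i" by metis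
  define K where "K = (\<Sum>i\<in>UNIV. \<bar>R i\<bar>) + L"
  have RK: "R i \<le> K" for i
  proof -
    have "\<bar>R i\<bar> \<le> (\<Sum>i\<in>UNIV. \<bar>R i\<bar>)" by (rule member_le_sum) auto
    then show ?thesis using u0(1) by (simp add: K_def)
  qed
  have LK: "L \<le> K" by (simp add: K_def sum_nonneg)
  interpret perron H F u0 L C K
  proof
    show "\<bar>H i p\<bar> \<le> C" if "\<bar>p\<bar> \<le> L" for i p using B[of p i] BC[of i] that by (auto simp: abs_le_iff)
    show "- K < p \<and> p < K" if "H i p \<le> C + 1" for i p using R[OF that] RK[of i] by auto
  qed (fact H F u0 C LK)+
  have "\<bar>sol (t, x) - u0 x\<bar> \<le> C * t" if "t \<ge> 0" for t x
    using sol_upper[OF that, of x] sol_lower[OF that, of x] by linarith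
  then show ?thesis
    by (intro exI[of _ sol] exI[of _ C]) (use C(1) continuous_sol quadratic_subsolution_sol quadratic_supersolution_sol sol_time_Lipschitz in blast)
qed

lemma uniformly_continuous_linear_growth:
  fixes g :: "real \<Rightarrow> real"
  assumes "\<delta> > 0" and g: "\<And>r s. 0 \<le> r \<Longrightarrow> 0 \<le> s \<Longrightarrow> \<bar>r - s\<bar> \<le> \<delta> \<Longrightarrow> \<bar>g r - g s\<bar> \<le> \<eta>"
    and rs: "0 \<le> r" "0 \<le> s"
  shows "\<bar>g r - g s\<bar> \<le> \<eta> * (\<bar>r - s\<bar> / \<delta> + 1)"
proof -
  have \<eta>: "\<eta> \<ge> 0" using g[of 0 0] assms(1) by simp
  have step: "\<bar>g r - g s\<bar> \<le> \<eta> * real n" if "0 \<le> s" "s \<le> r" "r - s \<le> \<delta> * real n" for n r s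
    using that
  proof (induction n arbitrary: r)
    case 0
    then show ?case by simp
  next
    case (Suc n)
    define r' where "r' = max s (r - \<delta>)"
    have "\<bar>g r - g r'\<bar> \<le> \<eta>" using Suc.prems assms(1) by (intro g) (auto simp: r'_def max_def)
    moreover have "\<bar>g r' - g s\<bar> \<le> \<eta> * real n"
      using Suc.prems assms(1) by (intro Suc.IH) (auto simp: r'_def max_def algebra_simps)
    ultimately show ?case by (simp add: distrib_left)
  qed
  define n where "n = nat \<lceil>\<bar>r - s\<bar> / \<delta>\<rceil>"
  have n: "\<bar>r - s\<bar> / \<delta> \<le> real n" "real n \<le> \<bar>r - s\<bar> / \<delta> + 1"
    using assms(1) by (auto simp: n_def of_nat_ceiling of_nat_nat)
  have "\<bar>r - s\<bar> \<le> \<delta> * real n" using n(1) assms(1) by (simp add: pos_divide_le_eq mult.commute)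
  then have "\<bar>g r - g s\<bar> \<le> \<eta> * real n"
    using step[of s r n] step[of r s n] rs by (cases "s \<le> r") (auto simp: abs_minus_commute)
  also have "\<dots> \<le> \<eta> * (\<bar>r - s\<bar> / \<delta> + 1)" using n(2) \<eta> by (intro mult_left_mono)
  finally show ?thesis .
qed

text \<open>
  The junction is a length space, so a uniformly continuous function grows at most linearly at large distances, with an
  arbitrarily small additive error; the inf-convolution \<open>inf\<^sub>y (u\<^sub>0(y) + L d(x, y))\<close> is then a uniform approximation.
\<close>

lemma Lipschitz_approximation:
  fixes u0 :: "('n::finite) junction \<Rightarrow> real"
  assumes uc: "uniformly_continuous_on UNIV u0" and "\<epsilon> > 0"
  shows "\<exists>v L. L \<ge> 0 \<and> (\<forall>x y. \<bar>v x - v y\<bar> \<le> L * dist x y) \<and> (\<forall>x. \<bar>v x - u0 x\<bar> \<le> \<epsilon>)"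
proof -
  define \<eta> where "\<eta> = \<epsilon> / 2"
  have \<eta>: "\<eta> > 0" using assms(2) by (simp add: \<eta>_def)
  obtain d where d: "d > 0" "\<And>x y. dist y x < d \<Longrightarrow> dist (u0 y) (u0 x) < \<eta>"
    using uc \<eta> unfolding uniformly_continuous_on_def by blast
  define \<delta> where "\<delta> = d / 2"
  have \<delta>: "\<delta> > 0" "\<delta> < d" using d by (auto simp: \<delta>_def)
  define L where "L = \<eta> / \<delta>"
  have L: "L \<ge> 0" using \<eta> \<delta> by (simp add: L_def)
  have br: "\<bar>u0 (branch_pt i r) - u0 (branch_pt i s)\<bar> \<le> L * \<bar>r - s\<bar> + \<eta>" if "0 \<le> r" "0 \<le> s" for i r s
  proof -
    have "\<bar>u0 (branch_pt i r) - u0 (branch_pt i s)\<bar> \<le> \<eta>" if "0 \<le> r" "0 \<le> s" "\<bar>r - s\<bar> \<le> \<delta>" for r s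
      using d(2)[of "branch_pt i r" "branch_pt i s"] that \<delta> by (simp add: dist_branch_pt dist_real_def)
    from uniformly_continuous_linear_growth[of \<delta> "\<lambda>r. u0 (branch_pt i r)", OF \<delta>(1) this that]
    show ?thesis by (simp add: L_def distrib_left)
  qed
  have growth: "u0 x - u0 y \<le> L * dist x y + \<epsilon>" for x y
  proof -
    obtain i r where x: "0 \<le> r" "x = branch_pt i r" by (rule junction_cases)
    obtain j s where y: "0 \<le> s" "y = branch_pt j s" by (rule junction_cases)
    show ?thesis
    proof (cases "i = j")
      case True
      then show ?thesis using br[OF x(1) y(1), of i] x y \<eta> by (simp add: dist_branch_pt \<eta>_def)
    next
      case False
      have "\<bar>u0 x - u0 origin\<bar> \<le> L * r + \<eta>" "\<bar>u0 y - u0 origin\<bar> \<le> L * s + \<eta>"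
        using br[OF x(1) order_refl, of i] br[OF y(1) order_refl, of j] x y by (auto simp: branch_pt_0)
      moreover have "\<epsilon> = 2 * \<eta>" by (simp add: \<eta>_def)
      ultimately show ?thesis using x y False by (simp add: dist_branch_pt distrib_left)
    qed
  qed
  define v where "v x = (INF y. u0 y + L * dist x y)" for x
  have bdd: "bdd_below (range (\<lambda>y. u0 y + L * dist x y))" for x
    using growth[of x] by (intro bdd_belowI[of _ "u0 x - \<epsilon>"]) (auto simp: algebra_simps)
  have v_le: "v x \<le> u0 y + L * dist x y" for x y unfolding v_def by (rule cINF_lower[OF bdd]) simp
  have v_ge: "c \<le> v x" if "\<And>y. c \<le> u0 y + L * dist x y" for c x unfolding v_def by (rule cINF_greatest) (use that in auto)
  have lip: "v x - v y \<le> L * dist x y" for x y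
  proof -
    have "v x - L * dist x y \<le> v y"
    proof (rule v_ge)
      fix z
      have "L * dist x z \<le> L * (dist x y + dist y z)" using L by (intro mult_left_mono dist_triangle) auto
      then show "v x - L * dist x y \<le> u0 z + L * dist y z" using v_le[of x z] by (simp add: distrib_left)
    qed
    then show ?thesis by simp
  qed
  have "\<bar>v x - v y\<bar> \<le> L * dist x y" for x y using lip[of x y] lip[of y x] by (simp add: abs_le_iff dist_commute)
  moreover have "\<bar>v x - u0 x\<bar> \<le> \<epsilon>" for x
  proof -
    have "u0 x - \<epsilon> \<le> v x"
    proof (rule v_ge)
      fix y show "u0 x - \<epsilon> \<le> u0 y + L * dist x y" using growth[of x y] by simp
    qed
    moreover have "v x \<le> u0 x" using v_le[of x x] by simp
    ultimately show ?thesis using assms(2) by (simp add: abs_le_iff)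
  qed
  ultimately show ?thesis using L by blast
qed

lemma upper_slope2_add_const: "upper_slope2 (\<lambda>t y. A t y + c) t y a q \<longleftrightarrow> upper_slope2 A t y a q"
  unfolding upper_slope2_def by (simp add: add.assoc)

lemma quadratic_subsolution_add_const: "quadratic_subsolution H F (\<lambda>w. u w + c) \<longleftrightarrow> quadratic_subsolution H F u"
  unfolding quadratic_subsolution_def vertex_slope_def by (simp add: upper_slope2_add_const add.assoc)

lemma quadratic_supersolution_add_const: "quadratic_supersolution H F (\<lambda>w. u w + c) \<longleftrightarrow> quadratic_supersolution H F u"
  unfolding quadratic_supersolution_def using quadratic_subsolution_add_const[of _ _ "\<lambda>w. - u w" "- c"] by simp

lemma comparison_solutions:
  fixes u v :: "real \<times> ('n::finite) junction \<Rightarrow> real" and H :: "'n \<Rightarrow> real \<Rightarrow> real" and u0 :: "'n junction \<Rightarrow> real"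
  assumes H: "\<And>i. continuous_on UNIV (H i)" "\<And>i. quasi_convex (H i)" "\<And>i. coercive (H i)"
    and u: "continuous_on ({0..} \<times> UNIV) u" "quadratic_subsolution H F u"
    and v: "continuous_on ({0..} \<times> UNIV) v" "quadratic_supersolution H F v"
    and init: "\<And>x. u (0, x) \<le> v (0, x) + c"
    and bu: "\<And>T. \<exists>C. \<forall>t\<in>{0..T}. \<forall>x. \<bar>u (t, x) - u0 x\<bar> \<le> C"
    and bv: "\<And>T. \<exists>C. \<forall>t\<in>{0..T}. \<forall>x. \<bar>v (t, x) - u0 x\<bar> \<le> C"
    and L: "L \<ge> 0" "(\<forall>t\<ge>0. \<forall>s\<ge>0. \<forall>x. \<bar>u (t, x) - u (s, x)\<bar> \<le> L * \<bar>t - s\<bar>) \<or>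
                    (\<forall>t\<ge>0. \<forall>s\<ge>0. \<forall>x. \<bar>v (t, x) - v (s, x)\<bar> \<le> L * \<bar>t - s\<bar>)"
    and t: "t \<ge> 0"
  shows "u (t, x) \<le> v (t, x) + c"
proof -
  let ?w = "\<lambda>w. v w + c"
  have cw: "continuous_on ({0..} \<times> UNIV) ?w" by (intro continuous_intros v)
  have sw: "quadratic_supersolution H F ?w" using v(2) by (simp add: quadratic_supersolution_add_const)
  have bnd: "\<exists>C. \<forall>t\<in>{0..T}. \<forall>s\<in>{0..T}. \<forall>x. u (t, x) - ?w (s, x) \<le> C" for T
  proof -
    obtain C1 C2 where C: "\<And>t x. t \<in> {0..T} \<Longrightarrow> \<bar>u (t, x) - u0 x\<bar> \<le> C1" "\<And>t x. t \<in> {0..T} \<Longrightarrow> \<bar>v (t, x) - u0 x\<bar> \<le> C2"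
      using bu[of T] bv[of T] by blast
    have "u (t, x) - ?w (s, x) \<le> C1 + C2 - c" if "t \<in> {0..T}" "s \<in> {0..T}" for t s x
      using C(1)[OF that(1), of x] C(2)[OF that(2), of x] by linarith
    then show ?thesis by blast
  qed
  have L': "(\<forall>t\<ge>0. \<forall>s\<ge>0. \<forall>x. \<bar>u (t, x) - u (s, x)\<bar> \<le> L * \<bar>t - s\<bar>) \<or>
                    (\<forall>t\<ge>0. \<forall>s\<ge>0. \<forall>x. \<bar>?w (t, x) - ?w (s, x)\<bar> \<le> L * \<bar>t - s\<bar>)"
    using L(2) by simp
  show ?thesis
    by (rule comparison[where v = u and w = ?w and H = H and F = F and L = L and ?t1.0 = t and ?x1.0 = x])
       (fact H u cw sw init bnd L(1) L' t)+
qed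

theorem theorem1p6:
  fixes H :: "'n::finite \<Rightarrow> real \<Rightarrow> real"
    and F :: "real ^ 'n \<Rightarrow> real"
    and u0 :: "'n junction \<Rightarrow> real"
  assumes "\<And>i. continuous_on UNIV (H i)"
    and "\<And>i. quasi_convex (H i)"
    and "\<And>i. coercive (H i)"
    and "continuous_on UNIV F"
    and "nonincreasing_in_each_variable F"
    and "uniformly_continuous_on UNIV u0"
  shows "let S = {u :: real \<times> 'n junction \<Rightarrow> real.
                    continuous_on ({0..} \<times> UNIV) u \<and>
                    relaxed_solution H F u0 u \<and>
                    (\<forall>T>0. \<exists>C>0. \<forall>t\<in>{0..<T}. \<forall>x. \<bar>u (t, x) - u0 x\<bar> \<le> C)}
         in \<exists>u\<in>S. \<forall>v\<in>S. \<forall>t\<ge>0. \<forall>x. v (t, x) = u (t, x)"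
proof -
  note H = assms(1-3) and F = assms(4,5)
  define \<epsilon> where "\<epsilon> n = 1 / (real n + 1)" for n
  have \<epsilon>: "\<epsilon> n > 0" "\<epsilon> n \<le> 1" for n by (auto simp: \<epsilon>_def)
  have \<epsilon>0: "\<epsilon> \<longlonglongrightarrow> 0" unfolding \<epsilon>_def by (rule LIMSEQ_inverse_real_of_nat[unfolded inverse_eq_divide, simplified add.commute[of 1] of_nat_Suc])
  have small: "\<exists>n. \<epsilon> n < e" if "e > 0" for e
    using order_tendstoD(2)[OF \<epsilon>0 that] by (auto simp: eventually_sequentially)
  have "\<forall>n. \<exists>v L. L \<ge> 0 \<and> (\<forall>x y. \<bar>v x - v y\<bar> \<le> L * dist x y) \<and> (\<forall>x. \<bar>v x - u0 x\<bar> \<le> \<epsilon> n)"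
    using Lipschitz_approximation[OF assms(6)] \<epsilon>(1) by blast
  then obtain v L where v: "\<And>n. L n \<ge> 0" "\<And>n x y. \<bar>v n x - v n y\<bar> \<le> L n * dist x y" "\<And>n x. \<bar>v n x - u0 x\<bar> \<le> \<epsilon> n"
    by metis
  have "\<forall>n. \<exists>u C. C \<ge> 0 \<and> continuous_on ({0..} \<times> UNIV) u \<and> quadratic_subsolution H F u \<and> quadratic_supersolution H F u \<and>
    (\<forall>t\<ge>0. \<forall>x. \<bar>u (t, x) - v n x\<bar> \<le> C * t) \<and> (\<forall>t\<ge>0. \<forall>s\<ge>0. \<forall>x. \<bar>u (t, x) - u (s, x)\<bar> \<le> C * \<bar>t - s\<bar>)"
    by (intro allI existence_Lipschitz) (fact H F v(1) v(2))+
  then obtain U C where U: "\<And>n. C n \<ge> 0" "\<And>n. continuous_on ({0..} \<times> UNIV) (U n)" "\<And>n. quadratic_subsolution H F (U n)" "\<And>n. quadratic_supersolution H F (U n)"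
    and Uv: "\<And>n t x. t \<ge> 0 \<Longrightarrow> \<bar>U n (t, x) - v n x\<bar> \<le> C n * t"
    and Ut: "\<And>n. \<forall>t\<ge>0. \<forall>s\<ge>0. \<forall>x. \<bar>U n (t, x) - U n (s, x)\<bar> \<le> C n * \<bar>t - s\<bar>"
    by metis
  have Uu0: "\<bar>U n (t, x) - u0 x\<bar> \<le> C n * t + \<epsilon> n" if "t \<ge> 0" for n t x
    using Uv[OF that, of n x] v(3)[of n x] by linarith
  have Ub: "\<exists>B. \<forall>t\<in>{0..T}. \<forall>x. \<bar>U n (t, x) - u0 x\<bar> \<le> B" for n T
  proof (intro exI[of _ "C n * T + 1"] ballI allI)
    fix t x assume "t \<in> {0..T}"
    then have "C n * t \<le> C n * T" using U(1) by (intro mult_left_mono) auto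
    then show "\<bar>U n (t, x) - u0 x\<bar> \<le> C n * T + 1" using Uu0[of t n x] \<epsilon>(2)[of n] \<open>t \<in> {0..T}\<close> by auto
  qed
  have U0: "\<bar>U n (0, x) - u0 x\<bar> \<le> \<epsilon> n" for n x using Uu0[of 0 n x] by simp
  have Unm: "U n (t, x) \<le> U m (t, x) + (\<epsilon> n + \<epsilon> m)" if "t \<ge> 0" for n m t x
  proof (rule comparison_solutions[where u = "U n" and v = "U m" and H = H and F = F and ?u0.0 = u0 and L = "C n"])
    show "U n (0, x) \<le> U m (0, x) + (\<epsilon> n + \<epsilon> m)" for x using U0[of n x] U0[of m x] by linarith
    show "(\<forall>t\<ge>0. \<forall>s\<ge>0. \<forall>x. \<bar>U n (t, x) - U n (s, x)\<bar> \<le> C n * \<bar>t - s\<bar>) \<or>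
        (\<forall>t\<ge>0. \<forall>s\<ge>0. \<forall>x. \<bar>U m (t, x) - U m (s, x)\<bar> \<le> C n * \<bar>t - s\<bar>)" using Ut by blast
  qed (fact H U Ub that)+
  have conv: "convergent (\<lambda>n. U n (t, x))" if "t \<ge> 0" for t x
  proof (rule Cauchy_convergent, rule metric_CauchyI)
    fix e :: real assume "e > 0"
    then have "eventually (\<lambda>n. \<epsilon> n < e / 2) sequentially" by (intro order_tendstoD(2)[OF \<epsilon>0]) simp
    then obtain M where M: "\<And>n. n \<ge> M \<Longrightarrow> \<epsilon> n < e / 2" by (auto simp: eventually_sequentially)
    have "dist (U m (t, x)) (U n (t, x)) < e" if "m \<ge> M" "n \<ge> M" for m n
      using Unm[OF \<open>t \<ge> 0\<close>, of m x n] Unm[OF \<open>t \<ge> 0\<close>, of n x m] M[OF that(1)] M[OF that(2)]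
      by (simp add: dist_real_def abs_less_iff)
    then show "\<exists>M. \<forall>m\<ge>M. \<forall>n\<ge>M. dist (U m (t, x)) (U n (t, x)) < e" by blast
  qed
  define u where "u w = lim (\<lambda>n. U n w)" for w
  have lim: "(\<lambda>n. U n (t, x)) \<longlonglongrightarrow> u (t, x)" if "t \<ge> 0" for t x
    using conv[OF that, of x] by (simp add: u_def convergent_LIMSEQ_iff)
  have uU: "\<bar>u (t, x) - U n (t, x)\<bar> \<le> \<epsilon> n" if "t \<ge> 0" for n t x
  proof -
    have l: "(\<lambda>m. U m (t, x) + (\<epsilon> n + \<epsilon> m)) \<longlonglongrightarrow> u (t, x) + (\<epsilon> n + 0)"
      "(\<lambda>m. U n (t, x) + (\<epsilon> m + \<epsilon> n)) \<longlonglongrightarrow> U n (t, x) + (0 + \<epsilon> n)"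
      by (intro tendsto_intros lim[OF that] \<epsilon>0)+
    have "U n (t, x) \<le> u (t, x) + (\<epsilon> n + 0)"
      by (rule LIMSEQ_le_const[OF l(1)]) (use Unm[OF that] in blast)
    moreover have "u (t, x) \<le> U n (t, x) + (0 + \<epsilon> n)"
      by (rule LIMSEQ_le[OF lim[OF that] l(2)]) (use Unm[OF that] in blast)
    ultimately show ?thesis by (simp add: abs_le_iff)
  qed
  have cu: "continuous_on ({0..} \<times> UNIV) u"
  proof (rule uniform_limit_theorem[where f = U and F = sequentially])
    show "uniform_limit ({0..} \<times> UNIV) U u sequentially"
    proof (rule uniform_limitI)
      fix e :: real assume "e > 0"
      then have "eventually (\<lambda>n. \<epsilon> n < e) sequentially" by (intro order_tendstoD(2)[OF \<epsilon>0])
      then show "eventually (\<lambda>n. \<forall>w\<in>{0..} \<times> UNIV. dist (U n w) (u w) < e) sequentially"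
      proof eventually_elim
        case (elim n)
        show ?case
        proof
          fix w :: "real \<times> 'n junction" assume w: "w \<in> {0..} \<times> UNIV"
          obtain t x where tx: "w = (t, x)" by (cases w)
          then have "\<bar>u (t, x) - U n (t, x)\<bar> \<le> \<epsilon> n" using w by (intro uU) auto
          then show "dist (U n w) (u w) < e" using elim by (simp add: tx dist_real_def abs_minus_commute)
        qed
      qed
    qed
  qed (use U(2) in auto)
  have su: "quadratic_subsolution H F u"
  proof (rule quadratic_subsolution_stable[OF H(1) F(1)])
    fix e t0 :: real and x0 assume "e > 0" "t0 > 0"
    obtain n where n: "\<epsilon> n < e" using small[OF \<open>e > 0\<close>] by blast
    have "u (t, x) - e \<le> U n (t, x)" "U n (t, x) \<le> u (t, x) + e" if "t \<ge> 0" for t x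
      using uU[OF that, of x n] n by (auto simp: abs_le_iff)
    then show "\<exists>z. continuous_on ({0..} \<times> UNIV) z \<and> quadratic_subsolution H F z \<and> u (t0, x0) - e \<le> z (t0, x0) \<and>
        (\<forall>t\<ge>0. \<forall>x. z (t, x) \<le> u (t, x) + e)"
      using U(2,3) \<open>t0 > 0\<close> by (intro exI[of _ "U n"]) auto
  qed
  have cH': "continuous_on UNIV (\<lambda>p. - H i (- p))" for i
    by (intro continuous_on_minus continuous_on_compose2[OF H(1)] continuous_on_id) auto
  have cF': "continuous_on UNIV (\<lambda>q. - F (- q))"
    by (intro continuous_on_minus continuous_on_compose2[OF F(1)] continuous_on_id) auto
  have pu: "quadratic_supersolution H F u"
    unfolding quadratic_supersolution_def
  proof (rule quadratic_subsolution_stable[OF cH' cF'])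
    fix e t0 :: real and x0 assume "e > 0" "t0 > 0"
    obtain n where n: "\<epsilon> n < e" using small[OF \<open>e > 0\<close>] by blast
    have "- u (t, x) - e \<le> - U n (t, x)" "- U n (t, x) \<le> - u (t, x) + e" if "t \<ge> 0" for t x
      using uU[OF that, of x n] n by (auto simp: abs_le_iff)
    moreover have "continuous_on ({0..} \<times> UNIV) (\<lambda>w. - U n w)" using U(2) by (intro continuous_on_minus)
    ultimately show "\<exists>z. continuous_on ({0..} \<times> UNIV) z \<and> quadratic_subsolution (\<lambda>i p. - H i (- p)) (\<lambda>q. - F (- q)) z \<and>
        - u (t0, x0) - e \<le> z (t0, x0) \<and> (\<forall>t\<ge>0. \<forall>x. z (t, x) \<le> - u (t, x) + e)"
      using U(4)[unfolded quadratic_supersolution_def] \<open>t0 > 0\<close> by (intro exI[of _ "\<lambda>w. - U n w"]) auto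
  qed
  have u0: "u (0, x) = u0 x" for x
  proof (rule ccontr)
    assume "u (0, x) \<noteq> u0 x"
    then obtain n where "\<epsilon> n < \<bar>u (0, x) - u0 x\<bar> / 2" using small[of "\<bar>u (0, x) - u0 x\<bar> / 2"] by auto
    moreover have "\<bar>u (0, x) - u0 x\<bar> \<le> \<bar>u (0, x) - U n (0, x)\<bar> + \<bar>U n (0, x) - u0 x\<bar>" by simp
    ultimately show False using uU[OF order_refl, of x n] U0[of n x] by simp
  qed
  have env0: "initial_condition T u0 w \<longleftrightarrow> (\<forall>x. w (0, x) = u0 x)"
    if "continuous_on ({0..} \<times> UNIV) w" "T > 0" for w T
  proof -
    have c: "continuous_on ({0..<T} \<times> UNIV) w" by (rule continuous_on_subset[OF that(1)]) auto
    have "(0, x) \<in> {0..<T} \<times> UNIV" for x :: "'n junction" using that(2) by simp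
    then show ?thesis unfolding initial_condition_def by (auto simp: usc_env_eq[OF c] lsc_env_eq[OF c] intro: antisym)
  qed
  have rel: "relaxed_solution H F u0 u"
    unfolding relaxed_solution_def
  proof (intro allI impI conjI)
    fix T :: real assume "T > 0"
    show "relaxed_subsolution T H F u" by (rule quadratic_subsolution_imp_relaxed[OF H(1) F(1) cu su])
    show "relaxed_supersolution T H F u"
      unfolding supersolution_iff_negated_subsolution[OF cu]
      by (rule quadratic_subsolution_imp_relaxed[OF cH' cF' continuous_on_minus[OF cu] pu[unfolded quadratic_supersolution_def]])
    show "initial_condition T u0 u" using env0[OF cu \<open>T > 0\<close>] u0 by simp
  qed
  have bu: "\<exists>B>0. \<forall>t\<in>{0..<T}. \<forall>x. \<bar>u (t, x) - u0 x\<bar> \<le> B" if "T > 0" for T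
  proof (intro exI[of _ "C 0 * T + 2"] conjI ballI allI)
    fix t x assume "t \<in> {0..<T}"
    then have "C 0 * t \<le> C 0 * T" using U(1) by (intro mult_left_mono) auto
    then show "\<bar>u (t, x) - u0 x\<bar> \<le> C 0 * T + 2"
      using Uu0[of t 0 x] uU[of t x 0] \<epsilon>(2)[of 0] \<open>t \<in> {0..<T}\<close> by auto
  next
    show "0 < C 0 * T + 2" using U(1)[of 0] that by (simp add: add_nonneg_pos)
  qed
  have uniq: "w (t, x) = u (t, x)"
    if cw: "continuous_on ({0..} \<times> UNIV) w" and rw: "relaxed_solution H F u0 w"
      and bw: "\<forall>T>0. \<exists>C>0. \<forall>t\<in>{0..<T}. \<forall>x. \<bar>w (t, x) - u0 x\<bar> \<le> C" and t: "t \<ge> 0" for w t x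
  proof -
    have sw: "quadratic_subsolution H F w" by (rule relaxed_imp_quadratic_subsolution[OF cw]) (use rw in \<open>simp add: relaxed_solution_def\<close>)
    have pw: "quadratic_supersolution H F w" unfolding quadratic_supersolution_def
      by (rule relaxed_imp_quadratic_subsolution[OF continuous_on_minus[OF cw]])
         (use rw in \<open>simp add: relaxed_solution_def supersolution_iff_negated_subsolution[OF cw]\<close>)
    have w0: "w (0, x) = u0 x" for x using rw env0[OF cw, of 1] by (simp add: relaxed_solution_def)
    have bw': "\<exists>B. \<forall>t\<in>{0..T}. \<forall>x. \<bar>w (t, x) - u0 x\<bar> \<le> B" for T
    proof -
      have "\<bar>T\<bar> + 1 > 0" by simp
      then obtain B where "\<forall>t\<in>{0..<\<bar>T\<bar> + 1}. \<forall>x. \<bar>w (t, x) - u0 x\<bar> \<le> B" using bw by blast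
      then show ?thesis by (intro exI[of _ B]) auto
    qed
    have 1: "w (t, x) \<le> U n (t, x) + \<epsilon> n" for n
    proof (rule comparison_solutions[where u = w and v = "U n" and H = H and F = F and ?u0.0 = u0 and L = "C n"])
      show "w (0, x) \<le> U n (0, x) + \<epsilon> n" for x using U0[of n x] w0[of x] by linarith
      show "(\<forall>t\<ge>0. \<forall>s\<ge>0. \<forall>x. \<bar>w (t, x) - w (s, x)\<bar> \<le> C n * \<bar>t - s\<bar>) \<or>
        (\<forall>t\<ge>0. \<forall>s\<ge>0. \<forall>x. \<bar>U n (t, x) - U n (s, x)\<bar> \<le> C n * \<bar>t - s\<bar>)" using Ut by blast
    qed (fact H cw sw U Ub bw' t)+
    have 2: "U n (t, x) \<le> w (t, x) + \<epsilon> n" for n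
    proof (rule comparison_solutions[where u = "U n" and v = w and H = H and F = F and ?u0.0 = u0 and L = "C n"])
      show "U n (0, x) \<le> w (0, x) + \<epsilon> n" for x using U0[of n x] w0[of x] by linarith
      show "(\<forall>t\<ge>0. \<forall>s\<ge>0. \<forall>x. \<bar>U n (t, x) - U n (s, x)\<bar> \<le> C n * \<bar>t - s\<bar>) \<or>
        (\<forall>t\<ge>0. \<forall>s\<ge>0. \<forall>x. \<bar>w (t, x) - w (s, x)\<bar> \<le> C n * \<bar>t - s\<bar>)" using Ut by blast
    qed (fact H cw pw U Ub bw' t)+
    show ?thesis
    proof (rule ccontr)
      assume "w (t, x) \<noteq> u (t, x)"
      then obtain n where "\<epsilon> n < \<bar>w (t, x) - u (t, x)\<bar> / 2" using small[of "\<bar>w (t, x) - u (t, x)\<bar> / 2"] by auto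
      moreover have "\<bar>w (t, x) - U n (t, x)\<bar> \<le> \<epsilon> n" using 1[of n] 2[of n] by (simp add: abs_le_iff)
      moreover have "\<bar>w (t, x) - u (t, x)\<bar> \<le> \<bar>w (t, x) - U n (t, x)\<bar> + \<bar>u (t, x) - U n (t, x)\<bar>" by simp
      ultimately show False using uU[OF t, of x n] by simp
    qed
  qed
  define S where "S = {u :: real \<times> 'n junction \<Rightarrow> real.
                    continuous_on ({0..} \<times> UNIV) u \<and>
                    relaxed_solution H F u0 u \<and>
                    (\<forall>T>0. \<exists>C>0. \<forall>t\<in>{0..<T}. \<forall>x. \<bar>u (t, x) - u0 x\<bar> \<le> C)}"
  have "u \<in> S" unfolding S_def using cu rel bu by blast
  moreover have "w (t, x) = u (t, x)" if w: "w \<in> S" and t: "t \<ge> 0" for w t x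
  proof (rule uniq[OF _ _ _ t])
    show "continuous_on ({0..} \<times> UNIV) w" "relaxed_solution H F u0 w"
      "\<forall>T>0. \<exists>C>0. \<forall>t\<in>{0..<T}. \<forall>x. \<bar>w (t, x) - u0 x\<bar> \<le> C"
      using w unfolding S_def by blast+
  qed
  ultimately show ?thesis unfolding Let_def S_def[symmetric] by blast
qed

end
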